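(* Let $0\le l<u<\infty$, $\sigma>0$, $x\in[l,u]$, $\theta_0\in\mathbb{R}$ and $\rho>0$, and let $f:[l,u]\to\mathbb{R}$ be a known measurable function. Assume: (i) there is a constant $M>0$ such that $|f(x_1)-f(x_2)|\le M|x_1-x_2|$ for all $x_1,x_2\in[l,u]$; (ii) $f$ is not identically $0$ on $[l,u]$; (iii) the parameter space is $\Theta=\{\theta:|\theta-\theta_0|\le\rho\}$, where $\theta_0$ is the true parameter. Let $X=\{X_t\}_{t\ge0}$ be the solution of the reflected stochastic differential equation $$\mathrm{d}X_t=\theta_0 f(X_t)\,\mathrm{d}t+\sigma\,\mathrm{d}W_t+\mathrm{d}L_t-\mathrm{d}R_t,\qquad X_0=x,$$ with reflecting barriers $l$ and $u$. Let $$\tilde\theta_T=\frac{\int_0^Tf(X_t)\big(\mathrm{d}X_t-\mathrm{d}L_t+\mathrm{d}R_t\big)}{\int_0^Tf^2(X_t)\,\mathrm{d}t}$$ be the least squares estimator of $\theta_0$ based on the continuous observation of $X$ on $[0,T]$, and let $$F=\int_l^u f^2(y)\,\pi_{l,u}(y)\,\mathrm{d}y,\qquad \pi_{l,u}(y)=\frac{\exp\left(-\frac{2\theta_0}{\sigma^2}\int_l^y f(r)\,\mathrm{d}r\right)}{\int_l^u\exp\left(-\frac{2\theta_0}{\sigma^2}\int_l^z f(r)\,\mathrm{d}r\right)\mathrm{d}z}.$$ Then $\sqrt{T}(\tilde\theta_T-\theta_0)$ converges in distribution to $\mathcal{N}(0,\sigma^2F^{-1})$ as $T\to\infty$.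
   Context: $(\Omega,\mathcal{F},\mathbb{P},\{\mathcal{F}_t\}_{t\ge0})$ is a filtered probability space and $W$ is a one-dimensional standard Brownian motion adapted to $\{\mathcal{F}_t\}$. $X$ is the unique strong solution of the reflected equation; $L$ and $R$ are the minimal continuous increasing processes with $L_0=R_0=0$ such that $X_t\in[l,u]$ for all $t\ge0$; they increase only when $X$ hits $l$ and $u$ respectively, i.e. $\int_0^\infty I_{\{X_t>l\}}\,\mathrm{d}L_t=0$ and $\int_0^\infty I_{\{X_t<u\}}\,\mathrm{d}R_t=0$, where $I$ denotes the indicator. The function $\pi_{l,u}$ defined in the claim is the one given as the density of the unique invariant probability measure of $X$. The estimator $\tilde\theta_T$ is motivated heuristically as the minimizer over $\theta$ of $\int_0^T|\dot X_t-\theta f(X_t)-\dot L_t+\dot R_t|^2\,\mathrm{d}t$.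
   Formalization: The density π_{l,u} is taken with exponent +(2θ₀/σ²)∫f instead of the printed minus sign, since only the plus sign gives the invariant density of X; with the minus sign the claim fails, e.g. for l=0, u=1, f(y)=y, θ₀=σ=1. *)

theory Defs
  imports "HOL-Probability.Probability"
begin

section \<open>Filtered probability spaces and Brownian motion\<close>

text \<open>Processes are functions \<open>X t \<omega>\<close>; only times \<open>t \<ge> 0\<close> are ever constrained or used.\<close>

definition filtered_prob_space :: "'a measure \<Rightarrow> (real \<Rightarrow> 'a measure) \<Rightarrow> bool" where
  "filtered_prob_space M \<F> \<longleftrightarrow> prob_space M \<and> (\<forall>t\<ge>0. subalgebra M (\<F> t)) \<and>
     (\<forall>s\<ge>0. \<forall>t\<ge>s. sets (\<F> s) \<subseteq> sets (\<F> t))"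

definition adapted_process :: "(real \<Rightarrow> 'a measure) \<Rightarrow> (real \<Rightarrow> 'a \<Rightarrow> real) \<Rightarrow> bool" where
  "adapted_process \<F> X \<longleftrightarrow> (\<forall>t\<ge>0. X t \<in> borel_measurable (\<F> t))"

definition continuous_process :: "'a measure \<Rightarrow> (real \<Rightarrow> 'a \<Rightarrow> real) \<Rightarrow> bool" where
  "continuous_process M X \<longleftrightarrow> (\<forall>\<omega>\<in>space M. continuous_on {0..} (\<lambda>t. X t \<omega>))"

text \<open>Brownian motion with respect to the filtration: increments after time \<open>s\<close> are independent
  of \<open>\<F> s\<close>, not merely of the past of \<open>W\<close>.\<close>

definition brownian_motion ::
    "'a measure \<Rightarrow> (real \<Rightarrow> 'a measure) \<Rightarrow> (real \<Rightarrow> 'a \<Rightarrow> real) \<Rightarrow> bool" where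
  "brownian_motion M \<F> W \<longleftrightarrow>
     adapted_process \<F> W \<and> continuous_process M W \<and> (AE \<omega> in M. W 0 \<omega> = 0) \<and>
     (\<forall>s\<ge>0. \<forall>t>s.
        distributed M lborel (\<lambda>\<omega>. W t \<omega> - W s \<omega>) (\<lambda>x. ennreal (normal_density 0 (sqrt (t - s)) x)) \<and>
        prob_space.indep_set M (sets (\<F> s))
          (sets (vimage_algebra (space M) (\<lambda>\<omega>. W t \<omega> - W s \<omega>) borel)))"

section \<open>Reflected stochastic differential equations\<close>

text \<open>The Lebesgue--Stieltjes measure \<open>dA\<close> of a continuous nondecreasing \<open>A\<close> on \<open>[0,\<infinity>)\<close>.\<close>

definition stieltjes_measure :: "(real \<Rightarrow> real) \<Rightarrow> real measure" where
  "stieltjes_measure A = interval_measure (\<lambda>t. A (max 0 t))"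

definition regulator :: "'a measure \<Rightarrow> (real \<Rightarrow> 'a measure) \<Rightarrow> (real \<Rightarrow> 'a \<Rightarrow> real) \<Rightarrow> bool" where
  "regulator M \<F> A \<longleftrightarrow> adapted_process \<F> A \<and> continuous_process M A \<and>
     (\<forall>\<omega>\<in>space M. A 0 \<omega> = 0 \<and> mono_on {0..} (\<lambda>t. A t \<omega>))"

text \<open>Solutions of \<open>dX = b(X) dt + \<sigma> dW + dL - dR\<close>, \<open>X\<^sub>0 = x\<close>, on \<open>[l,u]\<close>.  Minimality of the
  regulators is expressed by the two complementarity conditions.\<close>

definition reflected_sde_solution ::
    "'a measure \<Rightarrow> (real \<Rightarrow> 'a measure) \<Rightarrow> (real \<Rightarrow> 'a \<Rightarrow> real) \<Rightarrow> (real \<Rightarrow> real) \<Rightarrow> real \<Rightarrow> real \<Rightarrow> real \<Rightarrow>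
     real \<Rightarrow> (real \<Rightarrow> 'a \<Rightarrow> real) \<Rightarrow> (real \<Rightarrow> 'a \<Rightarrow> real) \<Rightarrow> (real \<Rightarrow> 'a \<Rightarrow> real) \<Rightarrow> bool" where
  "reflected_sde_solution M \<F> W b \<sigma> l u x X L R \<longleftrightarrow>
     adapted_process \<F> X \<and> continuous_process M X \<and> regulator M \<F> L \<and> regulator M \<F> R \<and>
     (\<forall>\<omega>\<in>space M. \<forall>t\<ge>0. X t \<omega> \<in> {l..u}) \<and>
     (AE \<omega> in M. \<forall>t\<ge>0.
        X t \<omega> = x + (LINT s:{0..t}|lborel. b (X s \<omega>)) + \<sigma> * W t \<omega> + L t \<omega> - R t \<omega>) \<and>
     (AE \<omega> in M. (\<integral>\<^sup>+ t. indicator {t. 0 \<le> t \<and> X t \<omega> > l} t \<partial>stieltjes_measure (\<lambda>t. L t \<omega>)) = 0) \<and>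
     (AE \<omega> in M. (\<integral>\<^sup>+ t. indicator {t. 0 \<le> t \<and> X t \<omega> < u} t \<partial>stieltjes_measure (\<lambda>t. R t \<omega>)) = 0)"

section \<open>Stochastic integration\<close>

text \<open>The simple process \<open>\<Sum>i<n. \<xi> i * 1\<^bsub>(\<tau> i, \<tau> (i+1)]\<^esub>\<close> on \<open>(0,T]\<close>.\<close>

definition simple_integrand ::
    "(real \<Rightarrow> 'a measure) \<Rightarrow> real \<Rightarrow> nat \<Rightarrow> (nat \<Rightarrow> real) \<Rightarrow> (nat \<Rightarrow> 'a \<Rightarrow> real) \<Rightarrow> bool" where
  "simple_integrand \<F> T n \<tau> \<xi> \<longleftrightarrow> \<tau> 0 = 0 \<and> \<tau> n = T \<and>
     (\<forall>i<n. \<tau> i \<le> \<tau> (Suc i) \<and> \<xi> i \<in> borel_measurable (\<F> (\<tau> i)))"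

definition simple_value ::
    "nat \<Rightarrow> (nat \<Rightarrow> real) \<Rightarrow> (nat \<Rightarrow> 'a \<Rightarrow> real) \<Rightarrow> real \<Rightarrow> 'a \<Rightarrow> real" where
  "simple_value n \<tau> \<xi> s \<omega> = (\<Sum>i<n. \<xi> i \<omega> * indicator {\<tau> i<..\<tau> (Suc i)} s)"

definition simple_integral ::
    "nat \<Rightarrow> (nat \<Rightarrow> real) \<Rightarrow> (nat \<Rightarrow> 'a \<Rightarrow> real) \<Rightarrow> (real \<Rightarrow> 'a \<Rightarrow> real) \<Rightarrow> 'a \<Rightarrow> real" where
  "simple_integral n \<tau> \<xi> Y \<omega> = (\<Sum>i<n. \<xi> i \<omega> * (Y (\<tau> (Suc i)) \<omega> - Y (\<tau> i) \<omega>))"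

text \<open>The integral of a left-continuous adapted \<open>H\<close> against a semimartingale \<open>Y\<close> over \<open>[0,T]\<close>, as
  the continuous extension of the elementary integral from simple processes with uniform
  convergence in probability to random variables with convergence in probability.\<close>

definition is_stochastic_integral ::
    "'a measure \<Rightarrow> (real \<Rightarrow> 'a measure) \<Rightarrow> (real \<Rightarrow> 'a \<Rightarrow> real) \<Rightarrow> (real \<Rightarrow> 'a \<Rightarrow> real) \<Rightarrow> real \<Rightarrow>
     ('a \<Rightarrow> real) \<Rightarrow> bool" where
  "is_stochastic_integral M \<F> H Y T Z \<longleftrightarrow> Z \<in> borel_measurable M \<and>
     (\<forall>n \<tau> \<xi>.
        (\<forall>k. simple_integrand \<F> T (n k) (\<tau> k) (\<xi> k)) \<longrightarrow>
        (\<forall>\<epsilon>>0. (\<lambda>k. measure M {\<omega>\<in>space M.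
            \<exists>s\<in>{0<..T}. \<bar>simple_value (n k) (\<tau> k) (\<xi> k) s \<omega> - H s \<omega>\<bar> > \<epsilon>}) \<longlonglongrightarrow> 0) \<longrightarrow>
        (\<forall>\<epsilon>>0. (\<lambda>k. measure M {\<omega>\<in>space M.
            \<bar>simple_integral (n k) (\<tau> k) (\<xi> k) Y \<omega> - Z \<omega>\<bar> > \<epsilon>}) \<longlonglongrightarrow> 0))"

definition stochastic_integral ::
    "'a measure \<Rightarrow> (real \<Rightarrow> 'a measure) \<Rightarrow> (real \<Rightarrow> 'a \<Rightarrow> real) \<Rightarrow> (real \<Rightarrow> 'a \<Rightarrow> real) \<Rightarrow> real \<Rightarrow>
     'a \<Rightarrow> real" where
  "stochastic_integral M \<F> H Y T = (SOME Z. is_stochastic_integral M \<F> H Y T Z)"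

section \<open>The least squares estimator and its asymptotic variance\<close>

definition lse ::
    "'a measure \<Rightarrow> (real \<Rightarrow> 'a measure) \<Rightarrow> (real \<Rightarrow> real) \<Rightarrow> (real \<Rightarrow> 'a \<Rightarrow> real) \<Rightarrow>
     (real \<Rightarrow> 'a \<Rightarrow> real) \<Rightarrow> (real \<Rightarrow> 'a \<Rightarrow> real) \<Rightarrow> real \<Rightarrow> 'a \<Rightarrow> real" where
  "lse M \<F> f X L R T \<omega> =
     stochastic_integral M \<F> (\<lambda>t \<omega>. f (X t \<omega>)) (\<lambda>t \<omega>. X t \<omega> - L t \<omega> + R t \<omega>) T \<omega> /
     (LINT t:{0..T}|lborel. (f (X t \<omega>))\<^sup>2)"

text \<open>The density of the invariant probability measure of the reflected diffusion with drift
  \<open>\<theta> f\<close>.  The exponent is positive: the density solves the zero-flux equation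
  \<open>(\<sigma>\<^sup>2/2) p' = \<theta> f p\<close> on \<open>[l,u]\<close>.  (The opposite sign, sometimes printed, gives the derivative
  of the scale function instead of the speed density.)\<close>

definition invariant_density ::
    "real \<Rightarrow> real \<Rightarrow> real \<Rightarrow> real \<Rightarrow> (real \<Rightarrow> real) \<Rightarrow> real \<Rightarrow> real" where
  "invariant_density l u \<theta> \<sigma> f y =
     exp (2 * \<theta> / \<sigma>\<^sup>2 * (LINT r:{l..y}|lborel. f r)) /
     (LINT z:{l..u}|lborel. exp (2 * \<theta> / \<sigma>\<^sup>2 * (LINT r:{l..z}|lborel. f r)))"

text \<open>Convergence in distribution of real random variables indexed by \<open>T \<rightarrow> \<infinity>\<close>: the definition of
  \<^const>\<open>weak_conv_m\<close> with \<open>at_top\<close> on the reals in place of \<open>sequentially\<close>.\<close>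

definition weak_conv_m_at_top :: "(real \<Rightarrow> real measure) \<Rightarrow> real measure \<Rightarrow> bool" where
  "weak_conv_m_at_top \<mu> \<nu> \<longleftrightarrow>
     (\<forall>x. isCont (cdf \<nu>) x \<longrightarrow> ((\<lambda>T. cdf (\<mu> T) x) \<longlongrightarrow> cdf \<nu> x) at_top)"

end

theory Submission
  imports Defs
begin

text \<open>
  Substituting the equation of \<open>X\<close> gives \<open>\<surd>T (\<theta>\<^sub>T - \<theta>\<^sub>0) = \<sigma> (N\<^sub>T/\<surd>T) / (V\<^sub>T/T)\<close> with \<open>N\<^sub>T = \<integral>f(X) dW\<close> and
  \<open>V\<^sub>T = \<integral>f\<^sup>2(X) dt\<close>.  Let \<open>h\<close> solve the Poisson equation \<open>\<theta>\<^sub>0 f h' + \<sigma>\<^sup>2/2 h'' = f\<^sup>2 - F\<close> with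
  \<open>h'(l) = h'(u) = 0\<close>.  Ito's formula then has no boundary terms and
  \<open>V\<^sub>T - F T = h(X\<^sub>T) - h(X\<^sub>0) - \<sigma> \<integral>h'(X) dW\<close>, whose martingale part is of order \<open>\<surd>T\<close> in \<open>L\<^sup>2\<close>; so
  \<open>V\<^sub>T/T \<rightarrow> F\<close> in probability.  Finally \<open>E exp(i\<kappa>N\<^sub>T + \<kappa>\<^sup>2 V\<^sub>T/2) = 1\<close> with \<open>\<kappa> = t/\<surd>T\<close>, where \<open>V\<^sub>T/T\<close> may
  be replaced by \<open>F\<close>, gives \<open>E exp(i t N\<^sub>T/\<surd>T) \<rightarrow> exp(-t\<^sup>2 F/2)\<close>.  Convergence in probability is
  measured by the Ky Fan functional \<open>E min(1, |A|)\<close>, and all stochastic integrals are limits along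
  the dyadic grids.
\<close>

section \<open>Dyadic grids and pathwise calculus\<close>

text \<open>The numerator of the estimator is a \<open>SOME\<close>, so nothing is known about it
  until a random variable is exhibited that is the limit for every admissible sequence of simple
  integrands, not only for a convenient one. This forces a comparison of arbitrary partitions with
  the dyadic ones. Dyadic grids are chosen because the second moments of their quadratic variation
  errors are geometric in \<open>k\<close>: the errors tend to 0 almost surely along the whole
  sequence, and Ito's formula can be proved path by path, with no probability left in it. As
  \<open>f\<close> is only Lipschitz, the solution \<open>h\<close> of the Poisson equation has a
  Lipschitz second derivative and in general nothing better; the Taylor estimate is made for exactly
  this regularity. The start \<open>x\<close> is arbitrary, so ergodicity is not read off from
  stationarity; the Poisson equation gives a rate of order 1 / sqrt T from any start. The
  exponential identity takes the place of a martingale central limit theorem; \<open>f (X t)\<close>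
  is bounded, so the exponentials of V_T / T are bounded uniformly in T.\<close>

definition grid :: "real \<Rightarrow> nat \<Rightarrow> nat \<Rightarrow> real" where
  "grid T k i = T * real i / 2 ^ k"

lemma grid_0 [simp]: "grid T k 0 = 0"
  by (simp add: grid_def)

lemma grid_last [simp]: "grid T k (2 ^ k) = T"
  by (simp add: grid_def)

lemma grid_step: "grid T k (Suc i) - grid T k i = T / 2 ^ k"
  by (simp add: grid_def field_simps)

lemma grid_mono: "0 \<le> T \<Longrightarrow> i \<le> j \<Longrightarrow> grid T k i \<le> grid T k j"
  by (simp add: grid_def divide_right_mono mult_left_mono)

lemma grid_nonneg: "0 \<le> T \<Longrightarrow> 0 \<le> grid T k i"
  by (simp add: grid_def)

lemma grid_le: "0 \<le> T \<Longrightarrow> i \<le> 2 ^ k \<Longrightarrow> grid T k i \<le> T"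
  using grid_mono[of T i "2 ^ k" k] by simp

lemma grid_in: "0 \<le> T \<Longrightarrow> i \<le> 2 ^ k \<Longrightarrow> grid T k i \<in> {0..T}"
  by (simp add: grid_le grid_nonneg)

lemma grid_cell_in:
  "0 \<le> T \<Longrightarrow> i < 2 ^ k \<Longrightarrow> s \<in> {grid T k i..grid T k (Suc i)} \<Longrightarrow> s \<in> {0..T}"
  using grid_nonneg[of T k i] grid_le[of T "Suc i" k] by auto

lemma grid_disjoint:
  "0 \<le> T \<Longrightarrow> i \<noteq> j \<Longrightarrow> grid T k (Suc i) \<le> grid T k j \<or> grid T k (Suc j) \<le> grid T k i"
  using grid_mono[of T "Suc i" j k] grid_mono[of T "Suc j" i k] by (cases "i < j") auto

lemma grid_less: "0 < T \<Longrightarrow> grid T k i < grid T k (Suc i)"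
  by (simp add: grid_def divide_strict_right_mono)

text \<open>Uniform continuity on a compact interval. One \<open>k\<close> serves all cells, and the
  cells are closed, so that increments over a cell are covered too.\<close>

lemma grid_oscillation:
  fixes \<phi> :: "real \<Rightarrow> real"
  assumes T: "0 \<le> T" and cont: "continuous_on {0..T} \<phi>" and \<epsilon>: "\<epsilon> > 0"
  shows "\<forall>\<^sub>F k in sequentially. \<forall>i<2^k. \<forall>s\<in>{grid T k i..grid T k (Suc i)}.
           \<bar>\<phi> s - \<phi> (grid T k i)\<bar> \<le> \<epsilon>"
proof -
  have "uniformly_continuous_on {0..T} \<phi>"
    using cont by (intro compact_uniformly_continuous) auto
  then obtain d where d: "d > 0"
    "\<And>s t. s \<in> {0..T} \<Longrightarrow> t \<in> {0..T} \<Longrightarrow> dist t s < d \<Longrightarrow> dist (\<phi> t) (\<phi> s) < \<epsilon>"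
    using \<epsilon> unfolding uniformly_continuous_on_def by metis
  have "(\<lambda>k. T / 2 ^ k) \<longlonglongrightarrow> 0" by (rule LIMSEQ_divide_realpow_zero) simp
  then have "\<forall>\<^sub>F k in sequentially. T / 2 ^ k < d"
    using d(1) by (rule order_tendstoD)
  then show ?thesis
  proof eventually_elim
    case (elim k)
    show ?case
    proof (intro allI impI ballI)
      fix i s assume i: "i < (2::nat) ^ k" and s: "s \<in> {grid T k i..grid T k (Suc i)}"
      have "dist s (grid T k i) < d"
        using s grid_step[of T k i] elim by (auto simp: dist_real_def)
      then show "\<bar>\<phi> s - \<phi> (grid T k i)\<bar> \<le> \<epsilon>"
        using d(2)[OF grid_in[of T i k] grid_cell_in[OF T i s]] T i
        by (auto simp: dist_real_def)
    qed
  qed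
qed

lemma grid_telescope: "(\<Sum>i<2^k. \<phi> (grid T k (Suc i)) - \<phi> (grid T k i)) = \<phi> T - (\<phi> 0 :: real)"
  by (subst sum_lessThan_telescope) simp

text \<open>Not restricted to grids: the simple integrands in the definition of the stochastic
  integral bring their own breakpoints, and neighbouring ones may coincide.\<close>

lemma partition_integral:
  fixes \<phi> :: "real \<Rightarrow> real"
  assumes mono: "\<And>i. i < n \<Longrightarrow> \<tau> i \<le> \<tau> (Suc i)" and int: "\<phi> integrable_on {\<tau> 0..\<tau> n}"
  shows "(\<Sum>i<n. integral {\<tau> i..\<tau> (Suc i)} \<phi>) = integral {\<tau> 0..\<tau> n} \<phi>"
proof -
  have le: "\<tau> i \<le> \<tau> j" if "i \<le> j" "j \<le> n" for i j
    using that by (induction j rule: dec_induct) (auto intro: order_trans[OF _ mono])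
  have "(\<Sum>i<k. integral {\<tau> i..\<tau> (Suc i)} \<phi>) = integral {\<tau> 0..\<tau> k} \<phi>" if "k \<le> n" for k
    using that
  proof (induction k)
    case (Suc k)
    have "integral {\<tau> 0..\<tau> k} \<phi> + integral {\<tau> k..\<tau> (Suc k)} \<phi> = integral {\<tau> 0..\<tau> (Suc k)} \<phi>"
      using Suc.prems le[of 0 k] le[of k "Suc k"] le[of "Suc k" n]
      by (intro Henstock_Kurzweil_Integration.integral_combine integrable_on_subinterval[OF int]) auto
    with Suc show ?case by simp
  qed simp
  then show ?thesis by simp
qed

lemma grid_integral:
  fixes \<phi> :: "real \<Rightarrow> real"
  assumes "0 \<le> T" "\<phi> integrable_on {0..T}"
  shows "(\<Sum>i<2^k. integral {grid T k i..grid T k (Suc i)} \<phi>) = integral {0..T} \<phi>"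
  using partition_integral[of "2^k" "grid T k" \<phi>] assms grid_mono[of T _ "Suc _" k] by simp

lemma grid_integral_tendsto:
  fixes c \<phi> :: "real \<Rightarrow> real"
  assumes T: "0 \<le> T" and c: "continuous_on {0..T} c" and \<phi>: "continuous_on {0..T} \<phi>"
  shows "(\<lambda>k. \<Sum>i<2^k. c (grid T k i) * integral {grid T k i..grid T k (Suc i)} \<phi>)
           \<longlonglongrightarrow> integral {0..T} (\<lambda>s. c s * \<phi> s)"
proof -
  have "bounded (\<phi> ` {0..T})"
    using \<phi> by (intro compact_imp_bounded compact_continuous_image) auto
  then obtain B where B: "B > 0" "\<And>s. s \<in> {0..T} \<Longrightarrow> \<bar>\<phi> s\<bar> \<le> B"
    unfolding bounded_pos by auto
  have "\<forall>\<^sub>F k in sequentially. \<bar>(\<Sum>i<2^k. c (grid T k i) * integral {grid T k i..grid T k (Suc i)} \<phi>)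
          - integral {0..T} (\<lambda>s. c s * \<phi> s)\<bar> < \<epsilon>" if \<epsilon>: "\<epsilon> > 0" for \<epsilon>
  proof -
    \<comment> \<open>The total error will be \<open>\<delta> * B * T\<close>; the denominator has
      \<open>T + 1\<close> because \<open>T = 0\<close> is allowed.\<close>
    define \<delta> where "\<delta> = \<epsilon> / (2 * B * (T + 1))"
    have \<delta>: "\<delta> > 0" using \<epsilon> B T by (simp add: \<delta>_def)
    have \<delta>2: "\<delta> * B * T < \<epsilon>"
    proof -
      have "\<delta> * B = \<epsilon> / (2 * (T + 1))" using B(1) by (simp add: \<delta>_def)
      then have "\<delta> * B * T = \<epsilon> * (T / (2 * (T + 1)))" by simp
      also have "\<dots> < \<epsilon> * 1" using \<epsilon> T by (intro mult_strict_left_mono) (auto simp: field_simps)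
      finally show ?thesis by simp
    qed
    from grid_oscillation[OF T c \<delta>] show ?thesis
    proof eventually_elim
      case (elim k)
      let ?I = "\<lambda>i. {grid T k i..grid T k (Suc i)}"
      have sub: "?I i \<subseteq> {0..T}" if "i < 2^k" for i
        using grid_cell_in[OF T that] by blast
      have int: "(\<lambda>s. c s * \<phi> s) integrable_on {0..T}"
        by (intro integrable_continuous_interval continuous_intros c \<phi>)
      have "\<bar>c (grid T k i) * integral (?I i) \<phi> - integral (?I i) (\<lambda>s. c s * \<phi> s)\<bar> \<le> \<delta> * B * (T / 2^k)"
        if i: "i < 2^k" for i
      proof -
        have ci: "continuous_on (?I i) c" "continuous_on (?I i) \<phi>"
          using continuous_on_subset[OF c sub[OF i]] continuous_on_subset[OF \<phi> sub[OF i]] by auto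
        have "c (grid T k i) * integral (?I i) \<phi> - integral (?I i) (\<lambda>s. c s * \<phi> s)
            = integral (?I i) (\<lambda>s. (c (grid T k i) - c s) * \<phi> s)"
          using ci
          by (simp add: left_diff_distrib Henstock_Kurzweil_Integration.integral_diff
              integrable_continuous_interval continuous_on_mult)
        also have "norm \<dots> \<le> \<delta> * B * (grid T k (Suc i) - grid T k i)"
        proof (rule integral_bound)
          fix s assume s: "s \<in> ?I i"
          have "\<bar>c (grid T k i) - c s\<bar> \<le> \<delta>" using elim i s by (metis abs_minus_commute)
          moreover have "\<bar>\<phi> s\<bar> \<le> B" using B(2) sub[OF i] s by blast
          ultimately show "norm ((c (grid T k i) - c s) * \<phi> s) \<le> \<delta> * B"
            using \<delta> by (auto simp: abs_mult intro!: mult_mono)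
        qed (use T ci in \<open>auto intro!: grid_mono continuous_intros\<close>)
        finally show ?thesis by (simp add: grid_step)
      qed
      then have "\<bar>\<Sum>i<2^k. c (grid T k i) * integral (?I i) \<phi> - integral (?I i) (\<lambda>s. c s * \<phi> s)\<bar>
                \<le> (\<Sum>i<(2::nat)^k. \<delta> * B * (T / 2^k))"
        by (intro order_trans[OF sum_abs] sum_mono) simp
      also have "\<dots> = \<delta> * B * T" by simp
      finally show ?case using \<delta>2
        by (simp add: sum_subtractf grid_integral[OF T int])
    qed
  qed
  then show ?thesis
    by (intro tendstoI) (simp add: dist_real_def)
qed

lemma grid_Riemann_tendsto:
  fixes c :: "real \<Rightarrow> real"
  assumes T: "0 \<le> T" and c: "continuous_on {0..T} c"
  shows "(\<lambda>k. \<Sum>i<2^k. c (grid T k i) * (grid T k (Suc i) - grid T k i)) \<longlonglongrightarrow> integral {0..T} c"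
  using grid_integral_tendsto[OF T c continuous_on_const[of _ 1]] grid_mono[OF T, of _ "Suc _"]
  by simp

lemma LINT_eq_integral:
  fixes \<phi> :: "real \<Rightarrow> real"
  assumes "continuous_on {a..b} \<phi>"
  shows "(LINT s:{a..b}|lborel. \<phi> s) = integral {a..b} \<phi>"
  by (rule set_borel_integral_eq_integral(2)[OF borel_integrable_atLeastAtMost'[OF assms]])

section \<open>Ito's formula along a single reflected path\<close>

lemma Taylor_cubic_remainder:
  fixes h p q :: "real \<Rightarrow> real"
  assumes h: "\<And>y. (h has_real_derivative p y) (at y)" and p: "\<And>y. (p has_real_derivative q y) (at y)"
    and q: "\<And>x y. x \<in> {l..u} \<Longrightarrow> y \<in> {l..u} \<Longrightarrow> \<bar>q x - q y\<bar> \<le> K * \<bar>x - y\<bar>"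
    and K: "0 \<le> K" and xy: "x \<in> {l..u}" "y \<in> {l..u}"
  shows "\<bar>h y - h x - p x * (y - x) - q x * (y - x)\<^sup>2 / 2\<bar> \<le> K * \<bar>y - x\<bar> * (y - x)\<^sup>2"
proof (cases "x = y")
  case False
  \<comment> \<open>The list of derivatives expected by Taylor's theorem; at order 2 only the
    entries 0, 1 and 2 are consulted.\<close>
  define D where "D = (\<lambda>m::nat. if m = 0 then h else if m = 1 then p else q)"
  have "\<exists>t. (if y < x then y < t \<and> t < x else x < t \<and> t < y) \<and>
      h y = (\<Sum>m<2. D m x / fact m * (y - x) ^ m) + D 2 t / fact 2 * (y - x) ^ 2"
    by (rule Taylor[where a = l and b = u and diff = D])
       (use xy False h p in \<open>auto simp: D_def less_Suc_eq numeral_2_eq_2\<close>)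
  then obtain t where t: "if y < x then y < t \<and> t < x else x < t \<and> t < y"
    "h y = h x + p x * (y - x) + q t / 2 * (y - x)\<^sup>2"
    by (auto simp: D_def numeral_2_eq_2)
  \<comment> \<open>The intermediate point stays in \<open>{l..u}\<close>, where alone
    \<open>q\<close> is known to be Lipschitz, and is no farther from \<open>x\<close> than
    \<open>y\<close> is.\<close>
  have tl: "t \<in> {l..u}" "\<bar>t - x\<bar> \<le> \<bar>y - x\<bar>" using t(1) xy by (auto split: if_splits)
  have "\<bar>q t - q x\<bar> \<le> K * \<bar>y - x\<bar>"
    using q[OF tl(1) xy(1)] tl(2) K by (meson mult_left_mono order_trans)
  then have "\<bar>q t - q x\<bar> * (y - x)\<^sup>2 \<le> K * \<bar>y - x\<bar> * (y - x)\<^sup>2"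
    by (intro mult_right_mono) auto
  moreover have "h y - h x - p x * (y - x) - q x * (y - x)\<^sup>2 / 2 = (q t - q x) * (y - x)\<^sup>2 / 2"
    using t(2) by (simp add: field_simps)
  moreover have "\<bar>(q t - q x) * (y - x)\<^sup>2 / 2\<bar> \<le> \<bar>q t - q x\<bar> * (y - x)\<^sup>2"
    by (simp add: abs_mult)
  ultimately show ?thesis by linarith
qed simp

text \<open>On a cell in which the regulator grows, the path visits the barrier, where \<open>p\<close> vanishes.\<close>

lemma regulator_sum_tendsto_0:
  fixes p X L :: "real \<Rightarrow> real"
  assumes T: "0 \<le> T" and X: "continuous_on {0..T} X" and p: "continuous_on UNIV p"
    and mono: "mono_on {0..T} L"
    and flat: "\<And>a b. 0 \<le> a \<Longrightarrow> a \<le> b \<Longrightarrow> b \<le> T \<Longrightarrow> (\<forall>s\<in>{a<..b}. X s \<noteq> z) \<Longrightarrow> L b = L a"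
    and pz: "p z = 0"
  shows "(\<lambda>k. \<Sum>i<2^k. p (X (grid T k i)) * (L (grid T k (Suc i)) - L (grid T k i))) \<longlonglongrightarrow> 0"
proof -
  have V: "0 \<le> L T - L 0" using mono T by (auto simp: mono_on_def)
  have "\<forall>\<^sub>F k in sequentially. \<bar>\<Sum>i<2^k. p (X (grid T k i)) * (L (grid T k (Suc i)) - L (grid T k i))\<bar> < \<epsilon>"
    if \<epsilon>: "\<epsilon> > 0" for \<epsilon>
  proof -
    define \<delta> where "\<delta> = \<epsilon> / (L T - L 0 + 1)"
    have \<delta>: "\<delta> > 0" using \<epsilon> V by (simp add: \<delta>_def)
    have \<delta>2: "\<delta> * (L T - L 0) < \<epsilon>" using \<epsilon> V by (simp add: \<delta>_def field_simps)
    have "continuous_on {0..T} (\<lambda>s. p (X s))"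
      using continuous_on_compose2[OF p X] by auto
    from grid_oscillation[OF T this \<delta>] show ?thesis
    proof eventually_elim
      case (elim k)
      have "\<bar>p (X (grid T k i)) * (L (grid T k (Suc i)) - L (grid T k i))\<bar>
              \<le> \<delta> * (L (grid T k (Suc i)) - L (grid T k i))" if i: "i < 2^k" for i
      proof (cases "\<forall>s\<in>{grid T k i<..grid T k (Suc i)}. X s \<noteq> z")
        case True
        have "L (grid T k (Suc i)) = L (grid T k i)"
          by (rule flat) (use T i True in \<open>auto intro: grid_nonneg grid_mono grid_le\<close>)
        then show ?thesis by simp
      next
        case False
        then obtain s where s: "s \<in> {grid T k i<..grid T k (Suc i)}" "X s = z" by auto
        have "\<bar>p (X s) - p (X (grid T k i))\<bar> \<le> \<delta>" using elim i s(1) by auto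
        then have "\<bar>p (X (grid T k i))\<bar> \<le> \<delta>" using s pz by simp
        moreover have "0 \<le> L (grid T k (Suc i)) - L (grid T k i)"
          using mono grid_in[OF T, of i k] grid_in[OF T, of "Suc i" k] grid_mono[OF T, of i "Suc i" k] i
          by (auto simp: mono_on_def)
        ultimately show ?thesis by (simp add: abs_mult mult_right_mono)
      qed
      then have "\<bar>\<Sum>i<2^k. p (X (grid T k i)) * (L (grid T k (Suc i)) - L (grid T k i))\<bar>
          \<le> (\<Sum>i<2^k. \<delta> * (L (grid T k (Suc i)) - L (grid T k i)))"
        by (intro order_trans[OF sum_abs] sum_mono) simp
      also have "\<dots> = \<delta> * (L T - L 0)"
        by (simp only: sum_distrib_left[symmetric] grid_telescope)
      finally show ?case using \<delta>2 by linarith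
    qed
  qed
  then show ?thesis by (intro tendstoI) (simp add: dist_real_def)
qed

text \<open>Randomness enters only through \<open>QV\<close> and \<open>QVq\<close>; everything else
  is Taylor's formula on each cell. The squares of the increments of \<open>X\<close> may be traded
  for those of \<open>\<sigma> * W\<close>, since the two paths differ by one of bounded variation,
  and the regulators grow only where \<open>p\<close> vanishes. The conclusion is a limit of sums
  and mentions no stochastic integral, so it holds along the full dyadic sequence.\<close>

lemma deterministic_Ito:
  fixes X W L R \<phi> h p q :: "real \<Rightarrow> real"
  assumes T: "0 \<le> T" and cont: "continuous_on {0..T} X" "continuous_on {0..T} W"
      "continuous_on {0..T} \<phi>"
    and monoL: "mono_on {0..T} L" and monoR: "mono_on {0..T} R"
    and X: "\<And>t. t \<in> {0..T} \<Longrightarrow> X t = X0 + integral {0..t} \<phi> + \<sigma> * W t + L t - R t"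
    and Xlu: "\<And>t. t \<in> {0..T} \<Longrightarrow> X t \<in> {l..u}"
    and flatL: "\<And>a b. 0 \<le> a \<Longrightarrow> a \<le> b \<Longrightarrow> b \<le> T \<Longrightarrow> (\<forall>s\<in>{a<..b}. X s \<noteq> l) \<Longrightarrow> L b = L a"
    and flatR: "\<And>a b. 0 \<le> a \<Longrightarrow> a \<le> b \<Longrightarrow> b \<le> T \<Longrightarrow> (\<forall>s\<in>{a<..b}. X s \<noteq> u) \<Longrightarrow> R b = R a"
    and h: "\<And>y. (h has_real_derivative p y) (at y)" and p: "\<And>y. (p has_real_derivative q y) (at y)"
    and q: "\<And>x y. x \<in> {l..u} \<Longrightarrow> y \<in> {l..u} \<Longrightarrow> \<bar>q x - q y\<bar> \<le> K * \<bar>x - y\<bar>" and K: "0 \<le> K"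
    and qcont: "continuous_on UNIV q"
    and pl: "p l = 0" and pu: "p u = 0"
    and QV: "(\<lambda>k. \<Sum>i<2^k. (W (grid T k (Suc i)) - W (grid T k i))\<^sup>2 - T / 2^k) \<longlonglongrightarrow> 0"
    and QVq: "(\<lambda>k. \<Sum>i<2^k. q (X (grid T k i)) * ((W (grid T k (Suc i)) - W (grid T k i))\<^sup>2 - T / 2^k)) \<longlonglongrightarrow> 0"
  shows "(\<lambda>k. \<Sum>i<2^k. p (X (grid T k i)) * (\<sigma> * (W (grid T k (Suc i)) - W (grid T k i))))
           \<longlonglongrightarrow> h (X T) - h (X 0) - integral {0..T} (\<lambda>s. p (X s) * \<phi> s + \<sigma>\<^sup>2 / 2 * q (X s))"
proof -
  define \<Delta> where "\<Delta> = (\<lambda>(Y::real\<Rightarrow>real) k i. Y (grid T k (Suc i)) - Y (grid T k i))"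
  define x where "x = (\<lambda>k i. X (grid T k i))"
  define A where "A = (\<lambda>k i. integral {grid T k i..grid T k (Suc i)} \<phi>)"
  define D where "D = (\<lambda>k i. (\<Delta> X k i)\<^sup>2 - \<sigma>\<^sup>2 * (\<Delta> W k i)\<^sup>2)"
  have pcont: "continuous_on UNIV p"
    using p by (auto intro!: DERIV_continuous_on)
  have contpX: "continuous_on {0..T} (\<lambda>s. p (X s))"
    using continuous_on_compose2[OF pcont cont(1)] by simp
  have contqX: "continuous_on {0..T} (\<lambda>s. q (X s))"
    using continuous_on_compose2[OF qcont cont(1)] by simp
  have \<phi>int: "\<phi> integrable_on {0..T}" by (rule integrable_continuous_interval[OF cont(3)])
  obtain B where B: "B > 0" "\<And>s. s \<in> {0..T} \<Longrightarrow> \<bar>\<phi> s\<bar> \<le> B"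
    using compact_imp_bounded[OF compact_continuous_image[OF cont(3)]] unfolding bounded_pos by auto
  obtain Cq where Cq: "Cq > 0" "\<And>s. s \<in> {0..T} \<Longrightarrow> \<bar>q (X s)\<bar> \<le> Cq"
    using compact_imp_bounded[OF compact_continuous_image[OF contqX]] unfolding bounded_pos by auto
  have g01: "grid T k i \<in> {0..T}" "grid T k (Suc i) \<in> {0..T}" "grid T k i \<le> grid T k (Suc i)" if "i < 2^k" for k i
    using that grid_in[OF T, of i k] grid_in[OF T, of "Suc i" k] grid_mono[OF T, of i "Suc i" k] by auto
  have incr: "\<Delta> X k i = A k i + \<sigma> * \<Delta> W k i + \<Delta> L k i - \<Delta> R k i" if i: "i < 2^k" for k i
  proof -
    have "integral {0..grid T k i} \<phi> + A k i = integral {0..grid T k (Suc i)} \<phi>"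
      unfolding A_def using g01[OF i]
      by (intro Henstock_Kurzweil_Integration.integral_combine integrable_on_subinterval[OF \<phi>int]) auto
    then show ?thesis
      unfolding \<Delta>_def X[OF g01(1)[OF i]] X[OF g01(2)[OF i]] by (simp add: algebra_simps)
  qed
  have Abound: "\<bar>A k i\<bar> \<le> B * (T / 2^k)" if i: "i < 2^k" for k i
  proof -
    have "norm (A k i) \<le> B * (grid T k (Suc i) - grid T k i)" unfolding A_def
    proof (rule integral_bound)
      show "continuous_on {grid T k i..grid T k (Suc i)} \<phi>"
        using continuous_on_subset[OF cont(3)] grid_cell_in[OF T i] by blast
    qed (use g01[OF i] B(2) grid_cell_in[OF T i] in auto)
    then show ?thesis by (simp add: grid_step)
  qed
  have \<Delta>L: "0 \<le> \<Delta> L k i" "0 \<le> \<Delta> R k i" if "i < 2^k" for k i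
    using monoL monoR g01[OF that] by (auto simp: \<Delta>_def mono_on_def)
  \<comment> \<open>A bound for the total variation of \<open>X - \<sigma> W\<close> on
    \<open>{0..T}\<close>: drift plus both regulators.\<close>
  define V where "V = B * T + (L T - L 0) + (R T - R 0)"
  have V0: "0 \<le> V" using B T monoL monoR by (auto simp: V_def mono_on_def intro!: add_nonneg_nonneg)
  have TV: "(\<Sum>i<2^k. \<bar>\<Delta> X k i - \<sigma> * \<Delta> W k i\<bar>) \<le> V" for k
  proof -
    have "(\<Sum>i<2^k. \<bar>\<Delta> X k i - \<sigma> * \<Delta> W k i\<bar>) \<le> (\<Sum>i<2^k. B * (T / 2^k) + \<Delta> L k i + \<Delta> R k i)"
      using incr Abound \<Delta>L by (intro sum_mono) (smt (verit) lessThan_iff)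
    also have "\<dots> = V"
      by (simp add: sum.distrib V_def \<Delta>_def grid_telescope)
    finally show ?thesis .
  qed
  \<comment> \<open>\<open>D\<close> is a difference of squares. The factor with
    \<open>X + \<sigma> W\<close> is uniformly small by continuity, the factor with
    \<open>X - \<sigma> W\<close> sums to at most \<open>V\<close>.\<close>
  have S_D: "(\<lambda>k. \<Sum>i<2^k. c (grid T k i) * D k i) \<longlonglongrightarrow> 0"
    if c: "C > 0" "\<And>s. s \<in> {0..T} \<Longrightarrow> \<bar>c s\<bar> \<le> C" for c C
  proof -
    have "\<forall>\<^sub>F k in sequentially. \<bar>\<Sum>i<2^k. c (grid T k i) * D k i\<bar> < \<epsilon>" if \<epsilon>: "\<epsilon> > 0" for \<epsilon>
    proof -
      define \<delta> where "\<delta> = \<epsilon> / (C * (V + 1))"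
      have \<delta>: "\<delta> > 0" using \<epsilon> V0 c by (simp add: \<delta>_def)
      have "C * \<delta> = \<epsilon> / (V + 1)" using c(1) by (simp add: \<delta>_def)
      then have \<delta>2: "C * \<delta> * V < \<epsilon>" using \<epsilon> V0 by (simp only:) (simp add: field_simps)
      have "continuous_on {0..T} (\<lambda>s. X s + \<sigma> * W s)" by (intro continuous_intros cont)
      from grid_oscillation[OF T this \<delta>] show ?thesis
      proof eventually_elim
        case (elim k)
        have "\<bar>c (grid T k i) * D k i\<bar> \<le> C * \<delta> * \<bar>\<Delta> X k i - \<sigma> * \<Delta> W k i\<bar>" if i: "i < 2^k" for i
        proof -
          have "\<bar>\<Delta> X k i + \<sigma> * \<Delta> W k i\<bar> \<le> \<delta>"
            using elim i g01(3)[OF i] by (auto simp: \<Delta>_def algebra_simps)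
          moreover have "D k i = (\<Delta> X k i + \<sigma> * \<Delta> W k i) * (\<Delta> X k i - \<sigma> * \<Delta> W k i)"
            by (simp add: D_def power2_eq_square algebra_simps)
          ultimately have "\<bar>D k i\<bar> \<le> \<delta> * \<bar>\<Delta> X k i - \<sigma> * \<Delta> W k i\<bar>"
            by (simp add: abs_mult mult_right_mono)
          then have "\<bar>c (grid T k i)\<bar> * \<bar>D k i\<bar> \<le> C * (\<delta> * \<bar>\<Delta> X k i - \<sigma> * \<Delta> W k i\<bar>)"
            using c(1) c(2)[OF g01(1)[OF i]] by (intro mult_mono) auto
          then show ?thesis by (simp add: abs_mult mult_ac)
        qed
        then have "\<bar>\<Sum>i<2^k. c (grid T k i) * D k i\<bar> \<le> (\<Sum>i<2^k. C * \<delta> * \<bar>\<Delta> X k i - \<sigma> * \<Delta> W k i\<bar>)"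
          by (intro order_trans[OF sum_abs] sum_mono) simp
        also have "\<dots> = C * \<delta> * (\<Sum>i<2^k. \<bar>\<Delta> X k i - \<sigma> * \<Delta> W k i\<bar>)"
          by (simp add: sum_distrib_left)
        also have "\<dots> \<le> C * \<delta> * V" using c(1) \<delta> by (intro mult_left_mono TV) auto
        finally show ?case using \<delta>2 by simp
      qed
    qed
    then show ?thesis by (intro tendstoI) (simp add: dist_real_def)
  qed
  \<comment> \<open>Only the resulting boundedness of these sums is used below: it absorbs the
    Taylor remainders, each at most \<open>K * \<delta>\<close> times a squared increment.\<close>
  have S_X2: "(\<lambda>k. \<Sum>i<2^k. (\<Delta> X k i)\<^sup>2) \<longlonglongrightarrow> \<sigma>\<^sup>2 * T"
  proof -
    have "(\<lambda>k. \<Sum>i<2^k. 1 * D k i) \<longlonglongrightarrow> 0" by (rule S_D[of 1 "\<lambda>_. 1"]) auto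
    from tendsto_add[OF this tendsto_add[OF tendsto_mult[OF tendsto_const[of "\<sigma>\<^sup>2"] QV] tendsto_const[of "\<sigma>\<^sup>2 * T"]]]
    show ?thesis
      by (simp add: D_def \<Delta>_def sum_subtractf sum_distrib_left algebra_simps)
  qed
  define r where "r = (\<lambda>k i. h (x k (Suc i)) - h (x k i) - p (x k i) * \<Delta> X k i - q (x k i) * (\<Delta> X k i)\<^sup>2 / 2)"
  have S_r: "(\<lambda>k. \<Sum>i<2^k. r k i) \<longlonglongrightarrow> 0"
  proof -
    from convergent_imp_Bseq[OF convergentI[OF S_X2]]
    obtain C where C: "C > 0" "\<And>k. \<bar>\<Sum>i<2^k. (\<Delta> X k i)\<^sup>2\<bar> \<le> C" by (auto simp: Bseq_def)
    have "\<forall>\<^sub>F k in sequentially. \<bar>\<Sum>i<2^k. r k i\<bar> < \<epsilon>" if \<epsilon>: "\<epsilon> > 0" for \<epsilon>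
    proof -
      define \<delta> where "\<delta> = \<epsilon> / (C * (K + 1))"
      have \<delta>: "\<delta> > 0" using \<epsilon> K C by (simp add: \<delta>_def)
      have "\<delta> * C = \<epsilon> / (K + 1)" using C(1) by (simp add: \<delta>_def)
      then have "K * (\<delta> * C) < \<epsilon>" using \<epsilon> K by (simp only:) (simp add: field_simps)
      then have \<delta>2: "K * \<delta> * C < \<epsilon>" by (simp add: mult_ac)
      from grid_oscillation[OF T cont(1) \<delta>] show ?thesis
      proof eventually_elim
        case (elim k)
        have "\<bar>r k i\<bar> \<le> K * \<delta> * (\<Delta> X k i)\<^sup>2" if i: "i < 2^k" for i
        proof -
          have "\<bar>r k i\<bar> \<le> K * \<bar>\<Delta> X k i\<bar> * (\<Delta> X k i)\<^sup>2"
            unfolding r_def x_def \<Delta>_def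
            by (rule Taylor_cubic_remainder[OF h p q K]) (use Xlu g01[OF i] in auto)
          also have "\<dots> \<le> K * \<delta> * (\<Delta> X k i)\<^sup>2"
            using elim i g01(3)[OF i] K by (intro mult_right_mono mult_left_mono) (auto simp: \<Delta>_def)
          finally show ?thesis .
        qed
        then have "\<bar>\<Sum>i<2^k. r k i\<bar> \<le> (\<Sum>i<2^k. K * \<delta> * (\<Delta> X k i)\<^sup>2)"
          by (intro order_trans[OF sum_abs] sum_mono) simp
        also have "\<dots> = K * \<delta> * (\<Sum>i<2^k. (\<Delta> X k i)\<^sup>2)" by (simp add: sum_distrib_left)
        also have "\<dots> \<le> K * \<delta> * C" using K \<delta> C(2)[of k] by (intro mult_left_mono) auto
        finally show ?case using \<delta>2 by simp
      qed
    qed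
    then show ?thesis by (intro tendstoI) (simp add: dist_real_def)
  qed
  have S_A: "(\<lambda>k. \<Sum>i<2^k. p (x k i) * A k i) \<longlonglongrightarrow> integral {0..T} (\<lambda>s. p (X s) * \<phi> s)"
    unfolding A_def x_def by (rule grid_integral_tendsto[OF T contpX cont(3)])
  have S_L: "(\<lambda>k. \<Sum>i<2^k. p (x k i) * \<Delta> L k i) \<longlonglongrightarrow> 0"
    unfolding x_def \<Delta>_def by (rule regulator_sum_tendsto_0[OF T cont(1) pcont monoL flatL pl])
  have S_R: "(\<lambda>k. \<Sum>i<2^k. p (x k i) * \<Delta> R k i) \<longlonglongrightarrow> 0"
    unfolding x_def \<Delta>_def by (rule regulator_sum_tendsto_0[OF T cont(1) pcont monoR flatR pu])
  have S_q: "(\<lambda>k. \<Sum>i<2^k. q (x k i) * (T / 2^k)) \<longlonglongrightarrow> integral {0..T} (\<lambda>s. q (X s))"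
    using grid_Riemann_tendsto[OF T contqX] by (simp add: x_def grid_step)
  have S_qD: "(\<lambda>k. \<Sum>i<2^k. q (x k i) * D k i) \<longlonglongrightarrow> 0"
    unfolding x_def by (rule S_D[OF Cq])
  \<comment> \<open>The telescoped Taylor formula solved for the sum against \<open>W\<close>. The
    second-order term is cut into the part with \<open>D\<close>, the centred squares of the
    increments of \<open>W\<close>, and a Riemann sum, so every summand on the right has a known
    limit.\<close>
  have split: "(\<Sum>i<2^k. p (x k i) * (\<sigma> * \<Delta> W k i)) =
      h (X T) - h (X 0) - (\<Sum>i<2^k. p (x k i) * A k i) - (\<Sum>i<2^k. p (x k i) * \<Delta> L k i)
      + (\<Sum>i<2^k. p (x k i) * \<Delta> R k i) - 1/2 * (\<Sum>i<2^k. q (x k i) * D k i)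
      - \<sigma>\<^sup>2 / 2 * (\<Sum>i<2^k. q (x k i) * ((\<Delta> W k i)\<^sup>2 - T / 2^k))
      - \<sigma>\<^sup>2 / 2 * (\<Sum>i<2^k. q (x k i) * (T / 2^k)) - (\<Sum>i<2^k. r k i)" for k
  proof -
    have "h (X T) - h (X 0) = (\<Sum>i<2^k. h (x k (Suc i)) - h (x k i))"
      using grid_telescope[of "\<lambda>t. h (X t)" T k] by (simp add: x_def)
    also have "\<dots> = (\<Sum>i<2^k. p (x k i) * (\<sigma> * \<Delta> W k i) + p (x k i) * A k i + p (x k i) * \<Delta> L k i
       - p (x k i) * \<Delta> R k i + 1/2 * (q (x k i) * D k i)
       + \<sigma>\<^sup>2 / 2 * (q (x k i) * ((\<Delta> W k i)\<^sup>2 - T / 2^k)) + \<sigma>\<^sup>2 / 2 * (q (x k i) * (T / 2^k)) + r k i)"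
    proof (rule sum.cong[OF refl])
      fix i assume "i \<in> {..<(2::nat)^k}"
      then have i: "i < 2^k" by simp
      have "p (x k i) * \<Delta> X k i = p (x k i) * A k i + p (x k i) * (\<sigma> * \<Delta> W k i) + p (x k i) * \<Delta> L k i - p (x k i) * \<Delta> R k i"
        by (simp add: incr[OF i] algebra_simps)
      moreover have "q (x k i) * (\<Delta> X k i)\<^sup>2 / 2 = 1/2 * (q (x k i) * D k i)
         + \<sigma>\<^sup>2 / 2 * (q (x k i) * ((\<Delta> W k i)\<^sup>2 - T / 2^k)) + \<sigma>\<^sup>2 / 2 * (q (x k i) * (T / 2^k))"
        unfolding D_def by (simp add: field_simps)
      ultimately show "h (x k (Suc i)) - h (x k i) = p (x k i) * (\<sigma> * \<Delta> W k i) + p (x k i) * A k i + p (x k i) * \<Delta> L k i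
       - p (x k i) * \<Delta> R k i + 1/2 * (q (x k i) * D k i)
       + \<sigma>\<^sup>2 / 2 * (q (x k i) * ((\<Delta> W k i)\<^sup>2 - T / 2^k)) + \<sigma>\<^sup>2 / 2 * (q (x k i) * (T / 2^k)) + r k i"
        unfolding r_def by linarith
    qed
    finally show ?thesis by (simp only: sum.distrib sum_subtractf sum_distrib_left)
  qed
  have QVq': "(\<lambda>k. \<Sum>i<2^k. q (x k i) * ((\<Delta> W k i)\<^sup>2 - T / 2^k)) \<longlonglongrightarrow> 0"
    using QVq by (simp add: x_def \<Delta>_def)
  have "(\<lambda>k. \<Sum>i<2^k. p (x k i) * (\<sigma> * \<Delta> W k i)) \<longlonglongrightarrow>
      h (X T) - h (X 0) - integral {0..T} (\<lambda>s. p (X s) * \<phi> s) - 0 + 0 - 1/2 * 0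
      - \<sigma>\<^sup>2 / 2 * 0 - \<sigma>\<^sup>2 / 2 * integral {0..T} (\<lambda>s. q (X s)) - 0"
    unfolding split by (intro tendsto_intros S_A S_L S_R S_qD QVq' S_q S_r)
  moreover have "integral {0..T} (\<lambda>s. p (X s) * \<phi> s + \<sigma>\<^sup>2 / 2 * q (X s)) =
      integral {0..T} (\<lambda>s. p (X s) * \<phi> s) + \<sigma>\<^sup>2 / 2 * integral {0..T} (\<lambda>s. q (X s))"
    by (subst Henstock_Kurzweil_Integration.integral_add)
       (auto intro!: integrable_continuous_interval continuous_intros contpX contqX cont)
  ultimately show ?thesis by (simp add: x_def \<Delta>_def diff_diff_eq add.assoc)
qed

section \<open>Antiderivatives and the Poisson equation\<close>

lemma continuous_imp_antiderivative:
  fixes f :: "real \<Rightarrow> real"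
  assumes "continuous_on UNIV f"
  obtains G where "\<And>y. (G has_real_derivative f y) (at y)" "G l = 0"
proof -
  have "\<exists>G. \<forall>x::real. - \<infinity> < ereal x \<longrightarrow> ereal x < \<infinity> \<longrightarrow> (G has_vector_derivative f x) (at x)"
    by (rule einterval_antiderivative) (use assms in \<open>auto simp: continuous_on_eq_continuous_at\<close>)
  then obtain G where G: "\<And>x. (G has_real_derivative f x) (at x)"
    by (auto simp: has_real_derivative_iff_has_vector_derivative)
  show thesis
    by (rule that[of "\<lambda>y. G y - G l"]) (auto intro!: derivative_eq_intros G)
qed

lemma integral_eq_antiderivative:
  fixes f G :: "real \<Rightarrow> real"
  assumes "\<And>y. (G has_real_derivative f y) (at y)" "a \<le> b"
  shows "integral {a..b} f = G b - G a"
proof (rule integral_unique, rule fundamental_theorem_of_calculus[OF assms(2)])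
  fix x show "(G has_vector_derivative f x) (at x within {a..b})"
    using assms(1)[of x] by (simp add: has_real_derivative_iff_has_vector_derivative has_vector_derivative_at_within)
qed

lemma continuous_interval_bound:
  fixes f :: "real \<Rightarrow> real"
  assumes "continuous_on {l..u} f"
  obtains B where "B > 0" "\<And>y. y \<in> {l..u} \<Longrightarrow> \<bar>f y\<bar> \<le> B"
  using compact_imp_bounded[OF compact_continuous_image[OF assms]] unfolding bounded_pos by auto

text \<open>With \<open>s = exp (2\<theta>/\<sigma>\<^sup>2 \<integral>f)\<close>, the reflected generator \<open>\<theta> f h' + \<sigma>\<^sup>2/2 h''\<close> has Neumann solution
  \<open>h' = (2/\<sigma>\<^sup>2) s\<^sup>-\<^sup>1 \<integral>(g - m) s\<close>, and \<open>h'(u) = 0\<close> forces \<open>m\<close> to be the mean of \<open>g\<close> under \<open>s\<close>.\<close>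

lemma Neumann_Poisson_equation:
  fixes f g :: "real \<Rightarrow> real"
  assumes lu: "l < u" and \<sigma>: "\<sigma> > 0"
    and f: "continuous_on UNIV f" and g: "continuous_on UNIV g"
    and fL: "\<And>x y. \<bar>f x - f y\<bar> \<le> Kf * \<bar>x - y\<bar>"
    and gL: "\<And>x y. x \<in> {l..u} \<Longrightarrow> y \<in> {l..u} \<Longrightarrow> \<bar>g x - g y\<bar> \<le> Kg * \<bar>x - y\<bar>"
    and m: "m = integral {l..u} (\<lambda>y. g y * exp (2 * \<theta> / \<sigma>\<^sup>2 * integral {l..y} f)) /
                integral {l..u} (\<lambda>y. exp (2 * \<theta> / \<sigma>\<^sup>2 * integral {l..y} f))"
  obtains h p q K where
    "\<And>y. (h has_real_derivative p y) (at y)" "\<And>y. (p has_real_derivative q y) (at y)"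
    "continuous_on UNIV q" "0 \<le> K"
    "\<And>x y. x \<in> {l..u} \<Longrightarrow> y \<in> {l..u} \<Longrightarrow> \<bar>q x - q y\<bar> \<le> K * \<bar>x - y\<bar>"
    "p l = 0" "p u = 0" "\<And>y. p y * (\<theta> * f y) + \<sigma>\<^sup>2 / 2 * q y = g y - m"
proof -
  define c where "c = 2 * \<theta> / \<sigma>\<^sup>2"
  \<comment> \<open>Antiderivatives are taken on the whole line, which later gives \<open>h\<close>
    and \<open>p\<close> two-sided derivatives at the barriers.\<close>
  obtain F where F: "\<And>y. (F has_real_derivative f y) (at y)" "F l = 0"
    using continuous_imp_antiderivative[OF f] by blast
  define s where "s = (\<lambda>y. exp (c * F y))"
  have s': "(s has_real_derivative (c * f y * s y)) (at y)" for y
    unfolding s_def by (auto intro!: derivative_eq_intros F)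
  have scont: "continuous_on UNIV s" using s' by (auto intro!: DERIV_continuous_on)
  have spos: "s y > 0" for y by (simp add: s_def)
  have Fint: "integral {l..y} f = F y" if "l \<le> y" for y
    using integral_eq_antiderivative[OF F(1) that] F(2) by simp
  have m': "m = integral {l..u} (\<lambda>y. g y * s y) / integral {l..u} s"
  proof -
    have "integral {l..u} (\<lambda>y. g y * exp (2 * \<theta> / \<sigma>\<^sup>2 * integral {l..y} f)) = integral {l..u} (\<lambda>y. g y * s y)"
      "integral {l..u} (\<lambda>y. exp (2 * \<theta> / \<sigma>\<^sup>2 * integral {l..y} f)) = integral {l..u} s"
      unfolding s_def c_def by (intro Henstock_Kurzweil_Integration.integral_cong; simp add: Fint)+
    then show ?thesis unfolding m by simp
  qed
  have spos': "integral {l..u} s > 0"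
  proof -
    obtain S where S: "\<And>y. (S has_real_derivative s y) (at y)" "S l = 0"
      using continuous_imp_antiderivative[OF scont] by blast
    have "S l < S u"
      by (rule DERIV_pos_imp_increasing[OF lu]) (use S spos in blast)
    then show ?thesis using integral_eq_antiderivative[OF S(1), of l u] lu by simp
  qed
  define k where "k = (\<lambda>y. (g y - m) * s y)"
  have kcont: "continuous_on UNIV k" unfolding k_def by (intro continuous_intros g scont)
  obtain G where G: "\<And>y. (G has_real_derivative k y) (at y)" "G l = 0"
    using continuous_imp_antiderivative[OF kcont] by blast
  have Gu: "G u = 0"
  proof -
    have "G u = integral {l..u} k" using integral_eq_antiderivative[OF G(1), of l u] G(2) lu by simp
    also have "\<dots> = integral {l..u} (\<lambda>y. g y * s y) - m * integral {l..u} s"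
      unfolding k_def left_diff_distrib
      by (subst Henstock_Kurzweil_Integration.integral_diff)
         (auto intro!: integrable_continuous_interval continuous_intros
           continuous_on_subset[OF g] continuous_on_subset[OF scont])
    also have "\<dots> = 0" using spos' by (simp add: m')
    finally show ?thesis .
  qed
  define e where "e = 2 / \<sigma>\<^sup>2"
  have e: "0 \<le> e" "\<sigma>\<^sup>2 / 2 * e = 1" using \<sigma> by (auto simp: e_def)
  define p where "p = (\<lambda>y. e * G y / s y)"
  \<comment> \<open>The quotient rule for \<open>p\<close>, simplified by \<open>s' = c f s\<close>.
    No derivative of \<open>f\<close> occurs, which is why a Lipschitz \<open>f\<close> yields a
    Lipschitz \<open>q\<close>.\<close>
  define q where "q = (\<lambda>y. e * (g y - m) - c * f y * p y)"
  have p': "(p has_real_derivative q y) (at y)" for y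
    unfolding p_def
    by (rule derivative_eq_intros G s' refl)+
       (use spos[of y] in \<open>auto simp: q_def p_def k_def field_simps\<close>)
  have pcont: "continuous_on UNIV p" using p' by (auto intro!: DERIV_continuous_on)
  have qcont: "continuous_on UNIV q" unfolding q_def by (intro continuous_intros f g pcont)
  obtain h where h: "\<And>y. (h has_real_derivative p y) (at y)"
    using continuous_imp_antiderivative[OF pcont] by blast
  obtain Bf where Bf: "Bf > 0" "\<And>y. y \<in> {l..u} \<Longrightarrow> \<bar>f y\<bar> \<le> Bf"
    using continuous_interval_bound[OF continuous_on_subset[OF f]] by blast
  obtain Bp where Bp: "Bp > 0" "\<And>y. y \<in> {l..u} \<Longrightarrow> \<bar>p y\<bar> \<le> Bp"
    using continuous_interval_bound[OF continuous_on_subset[OF pcont]] by blast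
  obtain Bq where Bq: "Bq > 0" "\<And>y. y \<in> {l..u} \<Longrightarrow> \<bar>q y\<bar> \<le> Bq"
    using continuous_interval_bound[OF continuous_on_subset[OF qcont]] by blast
  \<comment> \<open>Mean value inequality: the derivative \<open>q\<close> of \<open>p\<close> is
    bounded by \<open>Bq\<close> on the interval.\<close>
  have pL: "\<bar>p x - p y\<bar> \<le> Bq * \<bar>x - y\<bar>" if "x \<in> {l..u}" "y \<in> {l..u}" for x y
    using field_differentiable_bound[of "{l..u}" p q Bq x y] p' Bq that
    by (auto intro: has_field_derivative_at_within)
  have Kf: "0 \<le> Kf" using fL[of 1 0] by auto
  have Kg: "0 \<le> Kg" using gL[of l u] lu by (smt (verit) atLeastAtMost_iff zero_le_mult_iff)
  define K where "K = e * Kg + \<bar>c\<bar> * (Bf * Bq + Kf * Bp)"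
  have K: "0 \<le> K" using e Kf Kg Bf Bq Bp by (auto simp: K_def intro!: add_nonneg_nonneg mult_nonneg_nonneg)
  have qL: "\<bar>q x - q y\<bar> \<le> K * \<bar>x - y\<bar>" if xy: "x \<in> {l..u}" "y \<in> {l..u}" for x y
  proof -
    have "q x - q y = e * (g x - g y) - c * (f x * (p x - p y) + (f x - f y) * p y)"
      by (simp add: q_def algebra_simps)
    also have "\<bar>\<dots>\<bar> \<le> e * \<bar>g x - g y\<bar> + \<bar>c\<bar> * (\<bar>f x\<bar> * \<bar>p x - p y\<bar> + \<bar>f x - f y\<bar> * \<bar>p y\<bar>)"
    proof -
      have "\<bar>f x * (p x - p y) + (f x - f y) * p y\<bar> \<le> \<bar>f x\<bar> * \<bar>p x - p y\<bar> + \<bar>f x - f y\<bar> * \<bar>p y\<bar>"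
        by (metis abs_mult abs_triangle_ineq)
      then have "\<bar>c * (f x * (p x - p y) + (f x - f y) * p y)\<bar> \<le> \<bar>c\<bar> * (\<bar>f x\<bar> * \<bar>p x - p y\<bar> + \<bar>f x - f y\<bar> * \<bar>p y\<bar>)"
        by (simp add: abs_mult mult_left_mono)
      moreover have "\<bar>e * (g x - g y)\<bar> = e * \<bar>g x - g y\<bar>" using e by (simp add: abs_mult)
      ultimately show ?thesis by linarith
    qed
    also have "\<dots> \<le> e * (Kg * \<bar>x - y\<bar>) + \<bar>c\<bar> * (Bf * (Bq * \<bar>x - y\<bar>) + Kf * \<bar>x - y\<bar> * Bp)"
      using e Kf Bf Bq Bp xy fL gL pL
      by (intro add_mono mult_left_mono mult_mono) auto
    also have "\<dots> = K * \<bar>x - y\<bar>" by (simp add: K_def algebra_simps)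
    finally show ?thesis .
  qed
  show thesis
  proof (rule that[OF h p' qcont K qL])
    show "p y * (\<theta> * f y) + \<sigma>\<^sup>2 / 2 * q y = g y - m" for y
    proof -
      have "p y * (\<theta> * f y) + \<sigma>\<^sup>2 / 2 * q y
          = \<sigma>\<^sup>2 / 2 * e * (g y - m) + p y * f y * (\<theta> - \<sigma>\<^sup>2 / 2 * c)"
        by (simp add: q_def ring_distribs mult_ac)
      also have "\<sigma>\<^sup>2 / 2 * c = \<theta>" using \<sigma> by (simp add: c_def)
      finally show ?thesis by (simp only: e) simp
    qed
  qed (use G Gu in \<open>auto simp: p_def\<close>)
qed

text \<open>Translates the complementarity conditions into a property of the path:
  \<open>{a<..b}\<close> lies inside a set that carries no mass of \<open>dA\<close>. The integrals
  of the indicators are compared, rather than measures of sets, so \<open>P\<close> may be any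
  predicate.\<close>

lemma stieltjes_flat:
  fixes A :: "real \<Rightarrow> real"
  assumes mono: "mono_on {0..} A" and cont: "continuous_on {0..} A"
    and null: "(\<integral>\<^sup>+ t. indicator {t. 0 \<le> t \<and> P t} t \<partial>stieltjes_measure A) = 0"
    and ab: "0 \<le> a" "a \<le> b" and P: "\<And>s. s \<in> {a<..b} \<Longrightarrow> P s"
  shows "A b = A a"
proof -
  let ?A = "\<lambda>t. A (max 0 t)"
  have m: "x \<le> y \<Longrightarrow> ?A x \<le> ?A y" for x y using mono by (auto simp: mono_on_def)
  have c: "continuous_on UNIV ?A"
    by (rule continuous_on_compose2[OF cont]) (auto intro!: continuous_intros)
  have rc: "continuous (at_right x) ?A" for x
    using c by (auto simp: continuous_on_eq_continuous_at intro: continuous_at_imp_continuous_at_within)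
  have "emeasure (stieltjes_measure A) {a<..b} = (\<integral>\<^sup>+ t. indicator {a<..b} t \<partial>stieltjes_measure A)"
    by (simp add: stieltjes_measure_def)
  also have "\<dots> \<le> (\<integral>\<^sup>+ t. indicator {t. 0 \<le> t \<and> P t} t \<partial>stieltjes_measure A)"
    using ab P by (intro nn_integral_mono) (auto simp: indicator_def)
  also have "\<dots> = 0" by (rule null)
  finally have "ennreal (?A b - ?A a) = 0"
    using ab by (simp add: stieltjes_measure_def emeasure_interval_measure_Ioc[OF ab(2) m rc])
  then show ?thesis using m[OF ab(2)] ab by (simp add: ennreal_eq_0_iff)
qed

section \<open>Convergence in probability\<close>

text \<open>Preferred to the probabilities of exceeding each \<epsilon> because it is one number
  obeying a triangle inequality, it admits rates, and it controls differences of characteristic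
  functions directly (\<open>char_diff_le_ky_fan\<close>).\<close>

definition ky_fan :: "'a measure \<Rightarrow> ('a \<Rightarrow> real) \<Rightarrow> real" where
  "ky_fan M A = (\<integral>w. min 1 \<bar>A w\<bar> \<partial>M)"

context prob_space
begin

lemma ky_fan_integrable:
  fixes A :: "'a \<Rightarrow> real"
  shows "A \<in> borel_measurable M \<Longrightarrow> integrable M (\<lambda>w. min 1 \<bar>A w\<bar>)"
  by (rule integrable_const_bound[where B = 1]) auto

lemma ky_fan_nonneg: "0 \<le> ky_fan M A"
  unfolding ky_fan_def by (rule integral_nonneg_AE) auto

lemma ky_fan_mono_AE:
  assumes "A \<in> borel_measurable M" "B \<in> borel_measurable M" "AE w in M. \<bar>A w\<bar> \<le> \<bar>B w\<bar>"
  shows "ky_fan M A \<le> ky_fan M B"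
  unfolding ky_fan_def using assms
  by (intro integral_mono_AE ky_fan_integrable) auto

lemma ky_fan_cong_AE:
  assumes "A \<in> borel_measurable M" "B \<in> borel_measurable M" "AE w in M. A w = B w"
  shows "ky_fan M A = ky_fan M B"
  using assms by (intro antisym ky_fan_mono_AE) auto

lemma ky_fan_add:
  assumes [measurable]: "A \<in> borel_measurable M" "B \<in> borel_measurable M"
  shows "ky_fan M (\<lambda>w. A w + B w) \<le> ky_fan M A + ky_fan M B"
proof -
  have "ky_fan M (\<lambda>w. A w + B w) \<le> (\<integral>w. min 1 \<bar>A w\<bar> + min 1 \<bar>B w\<bar> \<partial>M)"
    unfolding ky_fan_def
    by (intro integral_mono Bochner_Integration.integrable_add ky_fan_integrable) auto
  also have "\<dots> = ky_fan M A + ky_fan M B"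
    unfolding ky_fan_def by (intro Bochner_Integration.integral_add ky_fan_integrable) auto
  finally show ?thesis .
qed

lemma ky_fan_diff:
  assumes [measurable]: "A \<in> borel_measurable M" "B \<in> borel_measurable M"
  shows "ky_fan M (\<lambda>w. A w - B w) \<le> ky_fan M A + ky_fan M B"
  using ky_fan_add[of A "\<lambda>w. - B w"] by (simp add: ky_fan_def)

lemma ky_fan_triangle:
  assumes [measurable]: "A \<in> borel_measurable M" "B \<in> borel_measurable M" "C \<in> borel_measurable M"
  shows "ky_fan M (\<lambda>w. A w - C w) \<le> ky_fan M (\<lambda>w. A w - B w) + ky_fan M (\<lambda>w. B w - C w)"
  using ky_fan_add[of "\<lambda>w. A w - B w" "\<lambda>w. B w - C w"] by simp

lemma ky_fan_AE_tendsto: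
  assumes [measurable]: "\<And>k. A k \<in> borel_measurable M" "Z \<in> borel_measurable M"
    and lim: "AE w in M. (\<lambda>k. A k w) \<longlonglongrightarrow> Z w"
  shows "(\<lambda>k::nat. ky_fan M (\<lambda>w. A k w - Z w)) \<longlonglongrightarrow> 0"
proof -
  have "(\<lambda>k. \<integral>w. min 1 \<bar>A k w - Z w\<bar> \<partial>M) \<longlonglongrightarrow> (\<integral>w. 0 \<partial>M)"
  proof (rule integral_dominated_convergence[where w = "\<lambda>_. 1"])
    show "AE w in M. (\<lambda>k. min 1 \<bar>A k w - Z w\<bar>) \<longlonglongrightarrow> 0"
      using lim
    proof eventually_elim
      case (elim w)
      have "(\<lambda>k. min 1 \<bar>A k w - Z w\<bar>) \<longlonglongrightarrow> min 1 \<bar>Z w - Z w\<bar>"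
        by (intro tendsto_intros elim)
      then show ?case by simp
    qed
  qed auto
  then show ?thesis by (simp add: ky_fan_def)
qed

text \<open>The truncation at 1 destroys homogeneity: the best factor is the maximum of 1 and
  \<open>\<bar>c\<bar>\<close>, for which \<open>1 + \<bar>c\<bar>\<close> is a convenient upper
  bound.\<close>

lemma ky_fan_cmult:
  assumes "A \<in> borel_measurable M"
  shows "ky_fan M (\<lambda>w. c * A w) \<le> (1 + \<bar>c\<bar>) * ky_fan M A"
proof -
  have "min 1 (\<bar>c\<bar> * a) \<le> (1 + \<bar>c\<bar>) * min 1 a" if "0 \<le> a" for a :: real
    using that by (cases "a \<le> 1") (auto simp: algebra_simps min_def)
  then have "ky_fan M (\<lambda>w. c * A w) \<le> (\<integral>w. (1 + \<bar>c\<bar>) * min 1 \<bar>A w\<bar> \<partial>M)"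
    unfolding ky_fan_def using assms
    by (intro integral_mono ky_fan_integrable integrable_mult_right) (auto simp: abs_mult)
  then show ?thesis by (simp add: ky_fan_def)
qed

text \<open>Markov's inequality for the truncated variable, whose threshold is therefore
  \<open>min 1 \<epsilon>\<close>.\<close>

lemma prob_le_ky_fan:
  assumes [measurable]: "A \<in> borel_measurable M" and \<epsilon>: "0 < \<epsilon>"
  shows "prob {w\<in>space M. \<bar>A w\<bar> > \<epsilon>} \<le> ky_fan M A / min 1 \<epsilon>"
proof -
  have "min 1 \<epsilon> * prob {w\<in>space M. \<bar>A w\<bar> > \<epsilon>} = (\<integral>w. min 1 \<epsilon> * indicator {w\<in>space M. \<bar>A w\<bar> > \<epsilon>} w \<partial>M)"
    by simp
  also have "\<dots> \<le> ky_fan M A"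
    unfolding ky_fan_def
  proof (rule integral_mono)
    show "integrable M (\<lambda>w. min 1 \<epsilon> * indicator {w\<in>space M. \<bar>A w\<bar> > \<epsilon>} w)"
      by (rule integrable_const_bound[where B = \<epsilon>]) (use \<epsilon> in \<open>auto simp: indicator_def\<close>)
  qed (auto simp: indicator_def intro: ky_fan_integrable)
  finally show ?thesis using \<epsilon> by (simp add: field_simps min_def split: if_splits)
qed

lemma ky_fan_le_prob:
  assumes [measurable]: "A \<in> borel_measurable M" and \<epsilon>: "0 < \<epsilon>"
  shows "ky_fan M A \<le> \<epsilon> + prob {w\<in>space M. \<bar>A w\<bar> > \<epsilon>}"
proof -
  have "ky_fan M A \<le> (\<integral>w. \<epsilon> + indicator {w\<in>space M. \<bar>A w\<bar> > \<epsilon>} w \<partial>M)"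
    unfolding ky_fan_def using \<epsilon>
    by (intro integral_mono ky_fan_integrable integrable_const_bound[where B = "\<epsilon> + 1"])
       (auto simp: indicator_def)
  also have "\<dots> = \<epsilon> + prob {w\<in>space M. \<bar>A w\<bar> > \<epsilon>}"
    by (subst Bochner_Integration.integral_add)
       (auto simp: prob_space intro!: integrable_const_bound[where B = 1])
  finally show ?thesis .
qed

text \<open>Young's inequality under the expectation. The parameter \<open>\<eta>\<close> stays free
  so that each use can balance the two terms: a second moment of order \<open>\<eta>\<^sup>2\<close>
  gives a bound of order \<open>\<eta>\<close>.\<close>

lemma ky_fan_le_square:
  assumes [measurable]: "A \<in> borel_measurable M" and int: "integrable M (\<lambda>w. (A w)\<^sup>2)" and \<eta>: "0 < \<eta>"
  shows "ky_fan M A \<le> \<eta> / 2 + (\<integral>w. (A w)\<^sup>2 \<partial>M) / (2 * \<eta>)"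
proof -
  have "min 1 \<bar>a\<bar> \<le> \<eta> / 2 + a\<^sup>2 / (2 * \<eta>)" for a :: real
  proof -
    have "0 \<le> (\<eta> - \<bar>a\<bar>)\<^sup>2 / (2 * \<eta>)" using \<eta> by simp
    also have "\<dots> = \<eta> / 2 + a\<^sup>2 / (2 * \<eta>) - \<bar>a\<bar>"
      using \<eta> by (simp add: power2_diff field_simps) (simp add: power2_eq_square algebra_simps)
    finally show ?thesis by linarith
  qed
  then have "ky_fan M A \<le> (\<integral>w. \<eta> / 2 + (A w)\<^sup>2 / (2 * \<eta>) \<partial>M)"
    unfolding ky_fan_def using int by (intro integral_mono ky_fan_integrable) auto
  also have "\<dots> = \<eta> / 2 + (\<integral>w. (A w)\<^sup>2 \<partial>M) / (2 * \<eta>)"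
    using int by (subst Bochner_Integration.integral_add) (auto simp: prob_space)
  finally show ?thesis .
qed

text \<open>On \<open>E\<close> the truncation at 1 is the only control, and it costs exactly the
  probability of \<open>E\<close>.\<close>

lemma ky_fan_off_event:
  assumes [measurable]: "A \<in> borel_measurable M" "B \<in> borel_measurable M" "E \<in> events"
    and le: "AE w in M. w \<notin> E \<longrightarrow> \<bar>A w\<bar> \<le> \<bar>B w\<bar>"
  shows "ky_fan M A \<le> prob E + ky_fan M B"
proof -
  have intE: "integrable M (indicator E :: 'a \<Rightarrow> real)" by (rule integrable_const_bound[where B = 1]) auto
  have "ky_fan M A \<le> (\<integral>w. indicator E w + min 1 \<bar>B w\<bar> \<partial>M)"
    unfolding ky_fan_def
  proof (rule integral_mono_AE)
    show "AE w in M. min 1 \<bar>A w\<bar> \<le> indicator E w + min 1 \<bar>B w\<bar>"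
      using le by eventually_elim (auto simp: indicator_def)
  qed (intro ky_fan_integrable Bochner_Integration.integrable_add intE; measurable)+
  also have "\<dots> = prob E + ky_fan M B"
    unfolding ky_fan_def using intE
    by (subst Bochner_Integration.integral_add) (auto intro: ky_fan_integrable)
  finally show ?thesis .
qed

section \<open>Almost sure convergence and completeness\<close>

lemma AE_summable_of_integral:
  fixes v :: "nat \<Rightarrow> 'a \<Rightarrow> real"
  assumes int: "\<And>k. integrable M (v k)" and nn: "\<And>k w. 0 \<le> v k w"
    and sm: "summable (\<lambda>k. \<integral>w. v k w \<partial>M)"
  shows "AE w in M. summable (\<lambda>k. v k w)"
proof -
  have [measurable]: "v k \<in> borel_measurable M" for k using int by auto
  have "(\<integral>\<^sup>+w. (\<Sum>k. ennreal (v k w)) \<partial>M) = (\<Sum>k. \<integral>\<^sup>+w. ennreal (v k w) \<partial>M)"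
    by (rule nn_integral_suminf) auto
  also have "\<dots> = (\<Sum>k. ennreal (\<integral>w. v k w \<partial>M))"
    by (intro suminf_cong nn_integral_eq_integral int) (auto simp: nn)
  also have "\<dots> = ennreal (\<Sum>k. \<integral>w. v k w \<partial>M)"
    by (rule suminf_ennreal2) (auto intro!: sm integral_nonneg_AE simp: nn)
  finally have "(\<integral>\<^sup>+w. (\<Sum>k. ennreal (v k w)) \<partial>M) \<noteq> \<infinity>" by simp
  then have "AE w in M. (\<Sum>k. ennreal (v k w)) \<noteq> \<infinity>"
    by (intro nn_integral_PInf_AE) auto
  then show ?thesis
    by eventually_elim (auto intro!: summable_suminf_not_top nn)
qed

text \<open>A series of squares with finite expectation is finite almost surely, so its terms tend
  to 0. No subsequence has to be extracted.\<close>

lemma AE_tendsto_0_of_squares: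
  assumes "\<And>k. integrable M (\<lambda>w. (U k w :: real)\<^sup>2)" "\<And>k. (\<integral>w. (U k w)\<^sup>2 \<partial>M) \<le> c k" "summable c"
  shows "AE w in M. (\<lambda>k. U k w) \<longlonglongrightarrow> 0"
proof -
  have "summable (\<lambda>k. \<integral>w. (U k w)\<^sup>2 \<partial>M)"
    by (rule summable_comparison_test'[OF assms(3), of 0]) (use assms(2) in auto)
  then have "AE w in M. summable (\<lambda>k. (U k w)\<^sup>2)"
    by (intro AE_summable_of_integral assms) auto
  then show ?thesis
    by eventually_elim (auto dest!: summable_LIMSEQ_zero)
qed

text \<open>The terms tend to 0, so the truncation is eventually inactive.\<close>

lemma summable_min_1:
  assumes "summable (\<lambda>k. min 1 \<bar>d k :: real\<bar>)"
  shows "summable d"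
proof -
  have "\<forall>\<^sub>F k in sequentially. min 1 \<bar>d k\<bar> < 1"
    using summable_LIMSEQ_zero[OF assms] by (rule order_tendstoD) simp
  then have "\<forall>\<^sub>F k in sequentially. norm (d k) \<le> min 1 \<bar>d k\<bar>"
    by eventually_elim (auto simp: min_def split: if_splits)
  then show ?thesis using assms by (rule summable_comparison_test_ev)
qed

text \<open>Completeness of convergence in probability: along a subsequence whose consecutive
  distances are at most those of a geometric series, the paths are almost surely Cauchy.\<close>

lemma ky_fan_Cauchy:
  fixes A :: "nat \<Rightarrow> 'a \<Rightarrow> real"
  assumes [measurable]: "\<And>k. A k \<in> borel_measurable M"
    and C: "\<And>e. e > 0 \<Longrightarrow> \<exists>N. \<forall>m\<ge>N. \<forall>n\<ge>N. ky_fan M (\<lambda>w. A m w - A n w) < e"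
  obtains Z r where "Z \<in> borel_measurable M" "strict_mono (r::nat\<Rightarrow>nat)"
    "AE w in M. (\<lambda>k. A (r k) w) \<longlonglongrightarrow> Z w"
proof -
  have "\<exists>N. \<forall>k. \<forall>m\<ge>N k. \<forall>n\<ge>N k. ky_fan M (\<lambda>w. A m w - A n w) < (1/2)^k"
    by (rule choice) (use C in auto)
  then obtain N where N: "\<And>k m n. m \<ge> N k \<Longrightarrow> n \<ge> N k \<Longrightarrow> ky_fan M (\<lambda>w. A m w - A n w) < (1/2)^k"
    by blast
  \<comment> \<open>Chosen strictly increasing with \<open>r k \<ge> N k\<close>, so consecutive
    terms are less than \<open>(1/2)^k\<close> apart.\<close>
  define r where "r = rec_nat (N 0) (\<lambda>k m. max (N (Suc k)) (Suc m))"
  have r: "r 0 = N 0" "r (Suc k) = max (N (Suc k)) (Suc (r k))" for k by (auto simp: r_def)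
  have rN: "N k \<le> r k" for k by (cases k) (auto simp: r)
  have rmono: "strict_mono r" by (rule strict_mono_Suc_iff[THEN iffD2]) (auto simp: r)
  have rS: "N k \<le> r (Suc k)" for k using rN[of k] r(2)[of k] by linarith
  have "summable (\<lambda>k. ky_fan M (\<lambda>w. A (r (Suc k)) w - A (r k) w))"
    by (rule summable_comparison_test'[OF summable_geometric[of "1/2::real"], of 0])
       (use N[OF rS rN] ky_fan_nonneg in \<open>auto simp: less_imp_le\<close>)
  then have "AE w in M. summable (\<lambda>k. min 1 \<bar>A (r (Suc k)) w - A (r k) w\<bar>)"
    unfolding ky_fan_def by (intro AE_summable_of_integral ky_fan_integrable) auto
  then have "AE w in M. (\<lambda>k. A (r k) w) \<longlonglongrightarrow> lim (\<lambda>k. A (r k) w)"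
  proof eventually_elim
    case (elim w)
    from summable_min_1[OF this] have "convergent (\<lambda>n. \<Sum>k<n. A (r (Suc k)) w - A (r k) w)"
      by (simp add: summable_iff_convergent)
    then have "convergent (\<lambda>n. (A (r n) w - A (r 0) w) + A (r 0) w)"
      by (intro convergent_add convergent_const) (simp only: sum_lessThan_telescope[of "\<lambda>k. A (r k) w"])
    then show ?case by (simp add: convergent_LIMSEQ_iff)
  qed
  with rmono show thesis by (intro that[of "\<lambda>w. lim (\<lambda>k. A (r k) w)" r]) auto
qed

text \<open>The passage between \<open>is_stochastic_integral\<close>, which speaks of
  probabilities, and the estimates, which speak of \<open>ky_fan\<close>.\<close>

lemma conv_prob_iff_ky_fan:
  assumes [measurable]: "\<And>k. A k \<in> borel_measurable M"
  shows "(\<forall>\<epsilon>>0. (\<lambda>k::nat. prob {w\<in>space M. \<bar>A k w\<bar> > \<epsilon>}) \<longlonglongrightarrow> 0) \<longleftrightarrow> (\<lambda>k. ky_fan M (A k)) \<longlonglongrightarrow> 0"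
proof safe
  fix \<epsilon> :: real assume \<epsilon>: "\<epsilon> > 0" and lim: "(\<lambda>k. ky_fan M (A k)) \<longlonglongrightarrow> 0"
  have "(\<lambda>k. ky_fan M (A k) / min 1 \<epsilon>) \<longlonglongrightarrow> 0" using lim by (rule tendsto_divide_zero)
  then show "(\<lambda>k. prob {w\<in>space M. \<bar>A k w\<bar> > \<epsilon>}) \<longlonglongrightarrow> 0"
    by (rule tendsto_sandwich[OF _ _ tendsto_const, rotated 2])
       (auto intro!: always_eventually prob_le_ky_fan[OF assms \<epsilon>])
next
  assume P: "\<forall>\<epsilon>>0. (\<lambda>k. prob {w\<in>space M. \<bar>A k w\<bar> > \<epsilon>}) \<longlonglongrightarrow> 0"
  show "(\<lambda>k. ky_fan M (A k)) \<longlonglongrightarrow> 0"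
  proof (rule tendstoI)
    fix e :: real assume e: "e > 0"
    have "\<forall>\<^sub>F k in sequentially. prob {w\<in>space M. \<bar>A k w\<bar> > e / 2} < e / 2"
      using P[rule_format, of "e / 2"] e by (intro order_tendstoD(2)[where y = 0]) auto
    then show "\<forall>\<^sub>F k in sequentially. dist (ky_fan M (A k)) 0 < e"
    proof eventually_elim
      case (elim k)
      then show ?case using ky_fan_le_prob[of "A k" "e / 2"] ky_fan_nonneg[of "A k"] e
        by (simp add: dist_real_def)
    qed
  qed
qed

lemma ky_fan_eq_0_imp_AE:
  assumes A: "A \<in> borel_measurable M" and 0: "ky_fan M A = 0"
  shows "AE w in M. A w = 0"
proof -
  have "AE w in M. min 1 \<bar>A w\<bar> = 0"
    using integral_nonneg_eq_0_iff_AE[OF ky_fan_integrable[OF A]] 0 by (simp add: ky_fan_def)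
  then show ?thesis by eventually_elim (auto simp: min_def split: if_splits)
qed

lemma ky_fan_limit_unique:
  assumes [measurable]: "\<And>k. A k \<in> borel_measurable M" "Y \<in> borel_measurable M" "Z \<in> borel_measurable M"
    and Y: "(\<lambda>k::nat. ky_fan M (\<lambda>w. A k w - Y w)) \<longlonglongrightarrow> 0"
    and Z: "(\<lambda>k. ky_fan M (\<lambda>w. A k w - Z w)) \<longlonglongrightarrow> 0"
  shows "AE w in M. Y w = Z w"
proof -
  have "ky_fan M (\<lambda>w. Y w - Z w) \<le> 0"
  proof (rule tendsto_lowerbound)
    show "(\<lambda>k. ky_fan M (\<lambda>w. A k w - Z w) + ky_fan M (\<lambda>w. A k w - Y w)) \<longlonglongrightarrow> 0"
      using tendsto_add[OF Z Y] by simp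
    have "ky_fan M (\<lambda>w. Y w - Z w) \<le> ky_fan M (\<lambda>w. A k w - Z w) + ky_fan M (\<lambda>w. A k w - Y w)" for k
      using ky_fan_diff[of "\<lambda>w. A k w - Z w" "\<lambda>w. A k w - Y w"] by simp
    then show "\<forall>\<^sub>F k in sequentially. ky_fan M (\<lambda>w. Y w - Z w) \<le> ky_fan M (\<lambda>w. A k w - Z w) + ky_fan M (\<lambda>w. A k w - Y w)"
      by simp
  qed simp
  then have "ky_fan M (\<lambda>w. Y w - Z w) = 0" using ky_fan_nonneg[of "\<lambda>w. Y w - Z w"] by simp
  from ky_fan_eq_0_imp_AE[OF _ this] show ?thesis by simp
qed

lemma ky_fan_convergent_imp_Cauchy:
  assumes [measurable]: "\<And>k. A k \<in> borel_measurable M" "Y \<in> borel_measurable M"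
    and lim: "(\<lambda>k::nat. ky_fan M (\<lambda>w. A k w - Y w)) \<longlonglongrightarrow> 0" and e: "e > 0"
  shows "\<exists>N. \<forall>m\<ge>N. \<forall>n\<ge>N. ky_fan M (\<lambda>w. A m w - A n w) < e"
proof -
  have "\<forall>\<^sub>F k in sequentially. ky_fan M (\<lambda>w. A k w - Y w) < e / 2"
    using lim e by (intro order_tendstoD(2)[where y = 0]) auto
  then obtain N where N: "\<And>k. k \<ge> N \<Longrightarrow> ky_fan M (\<lambda>w. A k w - Y w) < e / 2"
    by (auto simp: eventually_sequentially)
  have "ky_fan M (\<lambda>w. A m w - A n w) < e" if "m \<ge> N" "n \<ge> N" for m n
    using ky_fan_diff[of "\<lambda>w. A m w - Y w" "\<lambda>w. A n w - Y w"] N[OF that(1)] N[OF that(2)] by simp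
  then show ?thesis by blast
qed

text \<open>Completeness supplies an almost sure limit along a subsequence, and uniqueness of limits
  in probability identifies it with \<open>Y\<close>.\<close>

lemma ky_fan_AE_subseq:
  assumes [measurable]: "\<And>k. A k \<in> borel_measurable M" "Y \<in> borel_measurable M"
    and lim: "(\<lambda>k::nat. ky_fan M (\<lambda>w. A k w - Y w)) \<longlonglongrightarrow> 0"
  obtains r where "strict_mono (r::nat\<Rightarrow>nat)" "AE w in M. (\<lambda>k. A (r k) w) \<longlonglongrightarrow> Y w"
proof -
  obtain Z r where Zr: "Z \<in> borel_measurable M" "strict_mono (r::nat\<Rightarrow>nat)" "AE w in M. (\<lambda>k. A (r k) w) \<longlonglongrightarrow> Z w"
    by (rule ky_fan_Cauchy[OF assms(1) ky_fan_convergent_imp_Cauchy[OF assms]]) auto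
  have "AE w in M. Y w = Z w"
  proof (rule ky_fan_limit_unique[of "\<lambda>k. A (r k)"])
    show "(\<lambda>k. ky_fan M (\<lambda>w. A (r k) w - Y w)) \<longlonglongrightarrow> 0"
      using LIMSEQ_subseq_LIMSEQ[OF lim Zr(2)] by (simp add: o_def)
    show "(\<lambda>k. ky_fan M (\<lambda>w. A (r k) w - Z w)) \<longlonglongrightarrow> 0"
      using Zr by (intro ky_fan_AE_tendsto) auto
  qed (use Zr in auto)
  with Zr(3) have "AE w in M. (\<lambda>k. A (r k) w) \<longlonglongrightarrow> Y w" by eventually_elim simp
  with Zr(2) show thesis by (rule that)
qed

end

section \<open>Brownian increments\<close>

locale brownian_filtration = prob_space M for M :: "'a measure" +
  fixes \<F> :: "real \<Rightarrow> 'a measure" and W :: "real \<Rightarrow> 'a \<Rightarrow> real"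
  assumes filtered: "filtered_prob_space M \<F>" and bm: "brownian_motion M \<F> W"
begin

lemma subalg: "0 \<le> t \<Longrightarrow> subalgebra M (\<F> t)"
  using filtered by (auto simp: filtered_prob_space_def)

lemma space_\<F>: "0 \<le> t \<Longrightarrow> space (\<F> t) = space M"
  using subalg by (auto simp: subalgebra_def)

lemma measurable_\<F>_M: "0 \<le> t \<Longrightarrow> g \<in> borel_measurable (\<F> t) \<Longrightarrow> g \<in> borel_measurable M"
  using measurable_from_subalg[OF subalg] by blast

lemma measurable_\<F>_mono:
  "0 \<le> s \<Longrightarrow> s \<le> t \<Longrightarrow> g \<in> borel_measurable (\<F> s) \<Longrightarrow> g \<in> borel_measurable (\<F> t)"
  using filtered measurable_from_subalg[of "\<F> t" "\<F> s" g borel] space_\<F>[of s] space_\<F>[of t]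
  by (auto simp: filtered_prob_space_def subalgebra_def)

lemma W_adapted: "0 \<le> t \<Longrightarrow> W t \<in> borel_measurable (\<F> t)"
  using bm by (auto simp: brownian_motion_def adapted_process_def)

lemma W_measurable: "0 \<le> t \<Longrightarrow> W t \<in> borel_measurable M"
  using W_adapted measurable_\<F>_M by blast

lemma W_incr_adapted: "0 \<le> s \<Longrightarrow> s \<le> t \<Longrightarrow> t \<le> v \<Longrightarrow> (\<lambda>w. W t w - W s w) \<in> borel_measurable (\<F> v)"
  using measurable_\<F>_mono[OF _ _ W_adapted] by (intro borel_measurable_diff) auto

lemma W_continuous: "w \<in> space M \<Longrightarrow> continuous_on {0..} (\<lambda>t. W t w)"
  using bm by (auto simp: brownian_motion_def continuous_process_def)

section \<open>Moments of Brownian increments\<close>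

lemma incr_std_normal:
  assumes "0 \<le> s" "s < t"
  shows "distributed M lborel (\<lambda>w. (W t w - W s w) / sqrt (t - s)) std_normal_density"
proof -
  have "distributed M lborel (\<lambda>w. W t w - W s w) (normal_density 0 (sqrt (t - s)))"
    using bm assms by (auto simp: brownian_motion_def)
  then show ?thesis
    using normal_standard_normal_convert[of "sqrt (t - s)" "\<lambda>w. W t w - W s w" 0] assms by simp
qed

lemma incr_integrable_power:
  assumes "0 \<le> s" "s < t"
  shows "integrable M (\<lambda>w. (W t w - W s w) ^ n)"
proof -
  have "integrable M (\<lambda>w. ((W t w - W s w) / sqrt (t - s)) ^ n)"
    using distributed_integrable[OF incr_std_normal[OF assms], of "\<lambda>x. x ^ n"] integrable_std_normal_moment
    by auto
  then have "integrable M (\<lambda>w. sqrt (t - s) ^ n * ((W t w - W s w) / sqrt (t - s)) ^ n)"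
    by (rule integrable_mult_right)
  then show ?thesis using assms by (simp add: power_divide)
qed

lemma incr_moment:
  assumes "0 \<le> s" "s < t"
  shows "expectation (\<lambda>w. (W t w - W s w) ^ n) = sqrt (t - s) ^ n * (\<integral>x. std_normal_density x * x ^ n \<partial>lborel)"
proof -
  have "(\<integral>x. std_normal_density x * x ^ n \<partial>lborel) = expectation (\<lambda>w. ((W t w - W s w) / sqrt (t - s)) ^ n)"
    using distributed_integral[OF incr_std_normal[OF assms], of "\<lambda>x. x ^ n"] by auto
  then show ?thesis using assms by (simp add: power_divide)
qed

lemma incr_mean: "0 \<le> s \<Longrightarrow> s < t \<Longrightarrow> expectation (\<lambda>w. W t w - W s w) = 0"
  using incr_moment[of s t 1] integral_std_normal_moment_odd[of 0] by simp

lemma incr_variance: "0 \<le> s \<Longrightarrow> s < t \<Longrightarrow> expectation (\<lambda>w. (W t w - W s w)\<^sup>2) = t - s"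
  using incr_moment[of s t 2] integral_std_normal_moment_even[of 1] by (simp add: fact_2)

lemma incr_fourth: "0 \<le> s \<Longrightarrow> s < t \<Longrightarrow> expectation (\<lambda>w. (W t w - W s w) ^ 4) = 3 * (t - s)\<^sup>2"
  using incr_moment[of s t 4] integral_std_normal_moment_even[of 2]
    power_mult[of "sqrt (t - s)" 2 2]
  by (simp add: fact_numeral)

section \<open>Independence and orthogonality of increments\<close>

lemma incr_indep_set:
  "0 \<le> s \<Longrightarrow> s < t \<Longrightarrow>
    indep_set (sets (\<F> s)) (sets (vimage_algebra (space M) (\<lambda>w. W t w - W s w) borel))"
  using bm by (auto simp: brownian_motion_def)

lemma incr_indep:
  assumes st: "0 \<le> s" "s < t" and g: "g \<in> measurable (\<F> s) N" and \<psi>: "\<psi> \<in> measurable borel N'"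
  shows "indep_var N g N' (\<lambda>w. \<psi> (W t w - W s w))"
  unfolding indep_var_eq
proof (intro conjI)
  have [measurable]: "(\<lambda>w. W t w - W s w) \<in> borel_measurable M"
    using W_measurable st by (intro borel_measurable_diff) auto
  show g': "random_variable N g" using measurable_from_subalg[OF subalg[OF st(1)] g] .
  show \<psi>': "random_variable N' (\<lambda>w. \<psi> (W t w - W s w))"
    using \<psi> by measurable
  let ?V = "vimage_algebra (space M) (\<lambda>w. W t w - W s w) borel"
  have 1: "sigma_sets (space M) {g -` A \<inter> space M |A. A \<in> sets N} \<subseteq> sets (\<F> s)"
    using measurable_sets[OF g] space_\<F>[OF st(1)]
    by (intro sets.sigma_sets_subset[of _ "\<F> s", simplified space_\<F>[OF st(1)]]) auto
  have 2: "sigma_sets (space M) {(\<lambda>w. \<psi> (W t w - W s w)) -` A \<inter> space M |A. A \<in> sets N'} \<subseteq> sets ?V"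
  proof -
    have "(\<lambda>w. \<psi> (W t w - W s w)) \<in> measurable ?V N'"
      by (rule measurable_compose[OF measurable_vimage_algebra1 \<psi>]) auto
    from measurable_sets[OF this] show ?thesis
      by (intro sets.sigma_sets_subset[of _ ?V, simplified space_vimage_algebra]) auto
  qed
  show "indep_set (sigma_sets (space M) {g -` A \<inter> space M |A. A \<in> sets N})
     (sigma_sets (space M) {(\<lambda>w. \<psi> (W t w - W s w)) -` A \<inter> space M |A. A \<in> sets N'})"
    using incr_indep_set[OF st] 1 2 unfolding indep_sets2_eq by blast
qed

text \<open>Of two disjoint intervals one comes first, and the centred function of the later
  increment is independent of all that is known at its start; hence the mixed products have mean 0.
  The index set is arbitrary and unordered because common refinements are indexed by pairs, and
  \<open>\<psi>\<close> serves both the increment and its centred square.\<close>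

lemma orthogonal_sum:
  fixes D :: "'k \<Rightarrow> 'a \<Rightarrow> real" and \<psi> :: "'k \<Rightarrow> real \<Rightarrow> real" and a b :: "'k \<Rightarrow> real"
  defines "U \<equiv> (\<lambda>k w. \<psi> k (W (b k) w - W (a k) w))"
  assumes K: "finite K"
    and ab: "\<And>k. k \<in> K \<Longrightarrow> 0 \<le> a k" "\<And>k. k \<in> K \<Longrightarrow> a k < b k"
    and disj: "\<And>j k. j \<in> K \<Longrightarrow> k \<in> K \<Longrightarrow> j \<noteq> k \<Longrightarrow> b j \<le> a k \<or> b k \<le> a j"
    and D: "\<And>k. k \<in> K \<Longrightarrow> D k \<in> borel_measurable (\<F> (a k))"
    and DC: "\<And>k w. k \<in> K \<Longrightarrow> w \<in> space M \<Longrightarrow> \<bar>D k w\<bar> \<le> C k"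
    and \<psi>: "\<And>k. k \<in> K \<Longrightarrow> \<psi> k \<in> borel_measurable borel"
    and U2: "\<And>k. k \<in> K \<Longrightarrow> integrable M (\<lambda>w. (U k w)\<^sup>2)"
    and U0: "\<And>k. k \<in> K \<Longrightarrow> expectation (U k) = 0"
    and Uv: "\<And>k. k \<in> K \<Longrightarrow> expectation (\<lambda>w. (U k w)\<^sup>2) \<le> v k"
  shows "integrable M (\<lambda>w. (\<Sum>k\<in>K. D k w * U k w)\<^sup>2)"
    and "expectation (\<lambda>w. (\<Sum>k\<in>K. D k w * U k w)\<^sup>2) \<le> (\<Sum>k\<in>K. (C k)\<^sup>2 * v k)"
proof -
  have DM: "D k \<in> borel_measurable M" if "k \<in> K" for k using measurable_\<F>_M[OF ab(1) D] that by auto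
  have UF: "U k \<in> borel_measurable (\<F> t)" if "k \<in> K" "b k \<le> t" for k t
    unfolding U_def
    by (rule measurable_compose[OF W_incr_adapted \<psi>]) (use ab[OF that(1)] that in auto)
  have UM: "U k \<in> borel_measurable M" if "k \<in> K" for k
    using measurable_\<F>_M[OF _ UF[OF that order_refl]] ab[OF that] by auto
  have U1: "integrable M (U k)" if "k \<in> K" for k
    by (rule square_integrable_imp_integrable[OF UM[OF that] U2[OF that]])
  have C0: "0 \<le> C k" if "k \<in> K" for k
    using DC[OF that] subprob_not_empty by fastforce
  have cross: "integrable M (\<lambda>w. D j w * U j w * (D k w * U k w)) \<and>
      expectation (\<lambda>w. D j w * U j w * (D k w * U k w)) = 0"
    if jk: "j \<in> K" "k \<in> K" "b j \<le> a k" for j k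
  proof -
    \<comment> \<open>Everything in the product that is known at time \<open>a k\<close>. It is
      integrable because the coefficients are bounded, and independence then makes the product with
      \<open>U k\<close> integrable.\<close>
    let ?g = "\<lambda>w. D j w * U j w * D k w"
    have g: "?g \<in> borel_measurable (\<F> (a k))"
      using measurable_\<F>_mono[OF ab(1)[OF jk(1)] _ D[OF jk(1)], of "a k"] ab[OF jk(1)] jk
      by (intro borel_measurable_times UF D) auto
    have gi: "integrable M ?g"
    proof (rule Bochner_Integration.integrable_bound)
      show "integrable M (\<lambda>w. C j * C k * U j w)" using U1[OF jk(1)] by simp
      show "AE w in M. norm (?g w) \<le> norm (C j * C k * U j w)"
      proof (rule AE_I2)
        fix w assume "w \<in> space M"
        then have "\<bar>D j w\<bar> * \<bar>D k w\<bar> \<le> C j * C k"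
          using DC jk C0 by (intro mult_mono) auto
        then have "\<bar>D j w\<bar> * \<bar>D k w\<bar> * \<bar>U j w\<bar> \<le> C j * C k * \<bar>U j w\<bar>"
          by (rule mult_right_mono) simp
        then show "norm (?g w) \<le> norm (C j * C k * U j w)"
          using C0 jk by (simp add: abs_mult mult_ac)
      qed
    qed (use measurable_\<F>_M[OF ab(1)[OF jk(2)] g] in auto)
    have "indep_var borel ?g borel (U k)"
      unfolding U_def by (rule incr_indep[OF ab(1)[OF jk(2)] ab(2)[OF jk(2)] g[unfolded U_def] \<psi>[OF jk(2)]])
    from indep_var_lebesgue_integral[OF this gi U1[OF jk(2)]] indep_var_integrable[OF this gi U1[OF jk(2)]]
    show ?thesis using U0[OF jk(2)] by (simp add: mult_ac)
  qed
  have cross': "integrable M (\<lambda>w. D j w * U j w * (D k w * U k w))"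
      "expectation (\<lambda>w. D j w * U j w * (D k w * U k w)) = 0"
    if "j \<in> K" "k \<in> K" "j \<noteq> k" for j k
    using disj[OF that] cross[OF that(1,2)] cross[OF that(2,1)] by (auto simp: mult_ac)
  have dle: "D k w * U k w * (D k w * U k w) \<le> (C k)\<^sup>2 * (U k w)\<^sup>2"
    if "k \<in> K" "w \<in> space M" for k w
  proof -
    have "(D k w)\<^sup>2 \<le> (C k)\<^sup>2" using DC[OF that] C0[OF that(1)] by (simp add: abs_le_square_iff[symmetric])
    then have "(D k w)\<^sup>2 * (U k w)\<^sup>2 \<le> (C k)\<^sup>2 * (U k w)\<^sup>2" by (rule mult_right_mono) simp
    then show ?thesis by (simp add: power2_eq_square mult_ac)
  qed
  have diag: "integrable M (\<lambda>w. D k w * U k w * (D k w * U k w))" if k: "k \<in> K" for k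
  proof (rule Bochner_Integration.integrable_bound)
    show "integrable M (\<lambda>w. (C k)\<^sup>2 * (U k w)\<^sup>2)" using U2[OF k] by simp
    show "AE w in M. norm (D k w * U k w * (D k w * U k w)) \<le> norm ((C k)\<^sup>2 * (U k w)\<^sup>2)"
    proof (rule AE_I2)
      fix w assume "w \<in> space M"
      from dle[OF k this] show "norm (D k w * U k w * (D k w * U k w)) \<le> norm ((C k)\<^sup>2 * (U k w)\<^sup>2)"
        by (simp only: real_norm_def abs_of_nonneg zero_le_square abs_of_nonneg[OF zero_le_square] mult_nonneg_nonneg zero_le_power2)
    qed
    show "random_variable borel (\<lambda>w. D k w * U k w * (D k w * U k w))"
      using DM[OF k] UM[OF k] by measurable
  qed
  have diag_le: "expectation (\<lambda>w. D k w * U k w * (D k w * U k w)) \<le> (C k)\<^sup>2 * v k" if k: "k \<in> K" for k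
  proof -
    have "expectation (\<lambda>w. D k w * U k w * (D k w * U k w)) \<le> expectation (\<lambda>w. (C k)\<^sup>2 * (U k w)\<^sup>2)"
      by (intro integral_mono diag[OF k] integrable_mult_right U2[OF k] dle[OF k])
    also have "\<dots> \<le> (C k)\<^sup>2 * v k" using Uv[OF k] by (simp add: mult_left_mono)
    finally show ?thesis .
  qed
  have int: "integrable M (\<lambda>w. D j w * U j w * (D k w * U k w))" if "j \<in> K" "k \<in> K" for j k
    using cross'(1) diag that by (cases "j = k") auto
  have sq: "(\<lambda>w. (\<Sum>k\<in>K. D k w * U k w)\<^sup>2) = (\<lambda>w. \<Sum>j\<in>K. \<Sum>k\<in>K. D j w * U j w * (D k w * U k w))"
    by (simp only: power2_eq_square sum_product)
  show "integrable M (\<lambda>w. (\<Sum>k\<in>K. D k w * U k w)\<^sup>2)"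
    unfolding sq by (intro Bochner_Integration.integrable_sum int)
  have "expectation (\<lambda>w. (\<Sum>k\<in>K. D k w * U k w)\<^sup>2)
      = (\<Sum>j\<in>K. \<Sum>k\<in>K. expectation (\<lambda>w. D j w * U j w * (D k w * U k w)))"
    unfolding sq by (simp add: Bochner_Integration.integral_sum Bochner_Integration.integrable_sum int)
  also have "\<dots> = (\<Sum>j\<in>K. \<Sum>k\<in>K. if k = j then expectation (\<lambda>w. D j w * U j w * (D j w * U j w)) else 0)"
    by (intro sum.cong refl) (use cross'(2) in auto)
  also have "\<dots> = (\<Sum>j\<in>K. expectation (\<lambda>w. D j w * U j w * (D j w * U j w)))"
    using K by simp
  also have "\<dots> \<le> (\<Sum>k\<in>K. (C k)\<^sup>2 * v k)" by (intro sum_mono diag_le)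
  finally show "expectation (\<lambda>w. (\<Sum>k\<in>K. D k w * U k w)\<^sup>2) \<le> (\<Sum>k\<in>K. (C k)\<^sup>2 * v k)" .
qed

lemma martingale_sum_bound:
  fixes D :: "'k \<Rightarrow> 'a \<Rightarrow> real"
  assumes K: "finite K"
    and ab: "\<And>k. k \<in> K \<Longrightarrow> 0 \<le> a k" "\<And>k. k \<in> K \<Longrightarrow> a k < b k"
    and disj: "\<And>j k. j \<in> K \<Longrightarrow> k \<in> K \<Longrightarrow> j \<noteq> k \<Longrightarrow> b j \<le> a k \<or> b k \<le> a j"
    and D: "\<And>k. k \<in> K \<Longrightarrow> D k \<in> borel_measurable (\<F> (a k))"
    and DC: "\<And>k w. k \<in> K \<Longrightarrow> w \<in> space M \<Longrightarrow> \<bar>D k w\<bar> \<le> C"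
  shows "integrable M (\<lambda>w. (\<Sum>k\<in>K. D k w * (W (b k) w - W (a k) w))\<^sup>2)"
    and "expectation (\<lambda>w. (\<Sum>k\<in>K. D k w * (W (b k) w - W (a k) w))\<^sup>2) \<le> C\<^sup>2 * (\<Sum>k\<in>K. b k - a k)"
  unfolding sum_distrib_left
  using orthogonal_sum[of K a b D "\<lambda>_. C" "\<lambda>_ x. x" "\<lambda>k. b k - a k"] assms
    incr_integrable_power[of _ _ 2] incr_mean incr_variance by auto

text \<open>The factor 2 is the variance of the square of a standard normal variable,
  \<open>3 - 2 + 1\<close> in terms of its moments.\<close>

lemma quadratic_sum_bound:
  fixes D :: "'k \<Rightarrow> 'a \<Rightarrow> real"
  assumes K: "finite K"
    and ab: "\<And>k. k \<in> K \<Longrightarrow> 0 \<le> a k" "\<And>k. k \<in> K \<Longrightarrow> a k < b k"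
    and disj: "\<And>j k. j \<in> K \<Longrightarrow> k \<in> K \<Longrightarrow> j \<noteq> k \<Longrightarrow> b j \<le> a k \<or> b k \<le> a j"
    and D: "\<And>k. k \<in> K \<Longrightarrow> D k \<in> borel_measurable (\<F> (a k))"
    and DC: "\<And>k w. k \<in> K \<Longrightarrow> w \<in> space M \<Longrightarrow> \<bar>D k w\<bar> \<le> C"
  shows "integrable M (\<lambda>w. (\<Sum>k\<in>K. D k w * ((W (b k) w - W (a k) w)\<^sup>2 - (b k - a k)))\<^sup>2)"
    and "expectation (\<lambda>w. (\<Sum>k\<in>K. D k w * ((W (b k) w - W (a k) w)\<^sup>2 - (b k - a k)))\<^sup>2)
           \<le> C\<^sup>2 * (\<Sum>k\<in>K. 2 * (b k - a k)\<^sup>2)"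
proof -
  have sq: "((W t w - W s w)\<^sup>2 - (t - s))\<^sup>2 = (W t w - W s w)^4 - 2 * (t - s) * (W t w - W s w)\<^sup>2 + (t - s)\<^sup>2"
    for s t w
    by (simp add: power2_diff[of "(W t w - W s w)\<^sup>2"] flip: power_mult)
  have int: "integrable M (\<lambda>w. ((W t w - W s w)\<^sup>2 - (t - s))\<^sup>2)" if "0 \<le> s" "s < t" for s t
    unfolding sq using incr_integrable_power[OF that] by simp
  have e2: "expectation (\<lambda>w. ((W t w - W s w)\<^sup>2 - (t - s))\<^sup>2) = 2 * (t - s)\<^sup>2" if "0 \<le> s" "s < t" for s t
  proof -
    have "expectation (\<lambda>w. ((W t w - W s w)\<^sup>2 - (t - s))\<^sup>2) = 3 * (t - s)\<^sup>2 - 2 * (t - s) * (t - s) + (t - s)\<^sup>2"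
      unfolding sq using incr_integrable_power[OF that] incr_variance[OF that] incr_fourth[OF that]
      by (simp add: prob_space)
    then show ?thesis by (simp add: power2_eq_square)
  qed
  have e1: "expectation (\<lambda>w. (W t w - W s w)\<^sup>2 - (t - s)) = 0" if "0 \<le> s" "s < t" for s t
    using incr_integrable_power[OF that] incr_variance[OF that] by (simp add: prob_space)
  note os = orthogonal_sum[of K a b D "\<lambda>_. C" "\<lambda>k x. x\<^sup>2 - (b k - a k)" "\<lambda>k. 2 * (b k - a k)\<^sup>2",
      OF K ab disj D DC]
  show "integrable M (\<lambda>w. (\<Sum>k\<in>K. D k w * ((W (b k) w - W (a k) w)\<^sup>2 - (b k - a k)))\<^sup>2)"
    by (rule os(1)) (use ab int e1 e2 in auto)
  have "expectation (\<lambda>w. (\<Sum>k\<in>K. D k w * ((W (b k) w - W (a k) w)\<^sup>2 - (b k - a k)))\<^sup>2)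
           \<le> (\<Sum>k\<in>K. C\<^sup>2 * (2 * (b k - a k)\<^sup>2))"
    by (rule os(2)) (use ab int e1 e2 in auto)
  then show "expectation (\<lambda>w. (\<Sum>k\<in>K. D k w * ((W (b k) w - W (a k) w)\<^sup>2 - (b k - a k)))\<^sup>2)
           \<le> C\<^sup>2 * (\<Sum>k\<in>K. 2 * (b k - a k)\<^sup>2)"
    by (simp add: sum_distrib_left)
qed

text \<open>With \<open>2^k\<close> cells, each contributing at most a multiple of
  \<open>(T / 2^k)\<^sup>2\<close>, the second moments are at most of order \<open>(1/2)^k\<close>
  and hence summable. The weights are needed for \<open>q (X t)\<close> in Ito's formula; weight 1
  gives the plain quadratic variation.\<close>

lemma AE_quadratic_variation:
  assumes T: "0 < T"
    and D: "\<And>k i. D k i \<in> borel_measurable (\<F> (grid T k i))"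
    and DC: "\<And>k i w. w \<in> space M \<Longrightarrow> \<bar>D k i w\<bar> \<le> C"
  shows "AE w in M. (\<lambda>k. \<Sum>i<2^k. D k i w * ((W (grid T k (Suc i)) w - W (grid T k i) w)\<^sup>2 - T / 2^k)) \<longlonglongrightarrow> 0"
proof (rule AE_tendsto_0_of_squares[where c = "\<lambda>k. 2 * C\<^sup>2 * T\<^sup>2 * (1/2)^k"])
  fix k
  note b = quadratic_sum_bound[of "{..<(2::nat)^k}" "grid T k" "\<lambda>i. grid T k (Suc i)" "D k" C]
  have b1: "integrable M (\<lambda>w. (\<Sum>i<2^k. D k i w * ((W (grid T k (Suc i)) w - W (grid T k i) w)\<^sup>2 - (grid T k (Suc i) - grid T k i)))\<^sup>2)"
    by (rule b(1)) (use T D DC grid_disjoint[OF less_imp_le[OF T]] in \<open>auto intro!: grid_nonneg grid_less\<close>)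
  then show "integrable M (\<lambda>w. (\<Sum>i<2^k. D k i w * ((W (grid T k (Suc i)) w - W (grid T k i) w)\<^sup>2 - T / 2^k))\<^sup>2)"
    by (simp add: grid_step)
  have "expectation (\<lambda>w. (\<Sum>i<2^k. D k i w * ((W (grid T k (Suc i)) w - W (grid T k i) w)\<^sup>2 - (grid T k (Suc i) - grid T k i)))\<^sup>2)
     \<le> C\<^sup>2 * (\<Sum>i<(2::nat)^k. 2 * (grid T k (Suc i) - grid T k i)\<^sup>2)"
    by (rule b(2)) (use T D DC grid_disjoint[OF less_imp_le[OF T]] in \<open>auto intro!: grid_nonneg grid_less\<close>)
  also have "\<dots> = 2 * C\<^sup>2 * T\<^sup>2 * (1/2)^k"
    by (simp add: grid_step power_divide power2_eq_square)
  finally show "expectation (\<lambda>w. (\<Sum>i<2^k. D k i w * ((W (grid T k (Suc i)) w - W (grid T k i) w)\<^sup>2 - T / 2^k))\<^sup>2)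
     \<le> 2 * C\<^sup>2 * T\<^sup>2 * (1/2)^k" by (simp add: grid_step)
qed (auto intro!: summable_mult summable_geometric)

section \<open>Complex exponential martingales\<close>

lemma incr_char:
  assumes st: "0 \<le> s" "s < t"
  shows "expectation (\<lambda>w. iexp (\<tau> * (W t w - W s w))) = complex_of_real (exp (- (\<tau>\<^sup>2 * (t - s) / 2)))"
proof -
  let ?Z = "\<lambda>w. (W t w - W s w) / sqrt (t - s)"
  have Z[measurable]: "?Z \<in> borel_measurable M" using W_measurable st by (intro borel_measurable_divide borel_measurable_diff) auto
  have "distr M borel ?Z = distr M lborel ?Z" by (rule distr_cong) auto
  also have "\<dots> = std_normal_distribution" by (rule distributed_distr_eq_density[OF incr_std_normal[OF st]])
  finally have "char (distr M borel ?Z) (\<tau> * sqrt (t - s)) = complex_of_real (exp (- ((\<tau> * sqrt (t - s))\<^sup>2) / 2))"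
    by (simp add: char_std_normal_distribution)
  moreover have "char (distr M borel ?Z) (\<tau> * sqrt (t - s)) = expectation (\<lambda>w. iexp (\<tau> * sqrt (t - s) * ?Z w))"
    unfolding char_def by (subst integral_distr) auto
  moreover have "\<tau> * sqrt (t - s) * ?Z w = \<tau> * (W t w - W s w)" for w using st by simp
  moreover have "(\<tau> * sqrt (t - s))\<^sup>2 = \<tau>\<^sup>2 * (t - s)" using st by (simp add: power_mult_distrib)
  ultimately show ?thesis by simp
qed

text \<open>Independence of \<open>\<F> s\<close> and the increment makes the joint law a product, so the increment is
  integrated out first with \<open>w\<close> frozen.\<close>

lemma exponential_step:
  fixes U :: "'a \<Rightarrow> complex" and \<xi> :: "'a \<Rightarrow> real"
  assumes st: "0 \<le> s" "s < t"
    and U: "U \<in> borel_measurable (\<F> s)" and UB: "\<And>w. w \<in> space M \<Longrightarrow> norm (U w) \<le> B"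
    and \<xi>: "\<xi> \<in> borel_measurable (\<F> s)" and \<xi>C: "\<And>w. w \<in> space M \<Longrightarrow> \<bar>\<xi> w\<bar> \<le> C"
  shows "expectation (\<lambda>w. U w * (iexp (\<xi> w * (W t w - W s w)) * complex_of_real (exp ((\<xi> w)\<^sup>2 * (t - s) / 2))))
       = expectation U"
proof -
  let ?\<Delta> = "\<lambda>w. W t w - W s w"
  have \<Delta>[measurable]: "?\<Delta> \<in> borel_measurable M" using W_measurable st by (intro borel_measurable_diff) auto
  have [measurable]: "U \<in> borel_measurable M" "\<xi> \<in> borel_measurable M"
    using measurable_\<F>_M[OF st(1) \<xi>] measurable_from_subalg[OF subalg[OF st(1)] U] by auto
  \<comment> \<open>\<open>indep_var\<close> takes two variables with values in one common type, so
    the increment is padded with a dummy first component.\<close>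
  let ?X = "\<lambda>w. (U w, \<xi> w)" and ?Y = "\<lambda>w. (0 :: complex, ?\<Delta> w)"
  define \<phi> where "\<phi> = (\<lambda>(v :: complex \<times> real, z :: complex \<times> real).
    fst v * (iexp (snd v * snd z) * complex_of_real (exp ((snd v)\<^sup>2 * (t - s) / 2))))"
  have \<phi>[measurable]: "\<phi> \<in> borel_measurable (borel \<Otimes>\<^sub>M borel)"
    unfolding \<phi>_def borel_prod[symmetric] by measurable
  define P where "P = distr M borel ?X"
  define \<nu> where "\<nu> = distr M borel ?Y"
  interpret P: prob_space P unfolding P_def by (rule prob_space_distr) measurable
  interpret \<nu>: prob_space \<nu> unfolding \<nu>_def by (rule prob_space_distr) measurable
  interpret PN: pair_prob_space P \<nu> ..
  have "indep_var borel ?X borel ?Y"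
    using incr_indep[OF st, of ?X borel "\<lambda>x. (0 :: complex, x)" borel] U \<xi> by simp
  then have PN: "P \<Otimes>\<^sub>M \<nu> = distr M (borel \<Otimes>\<^sub>M borel) (\<lambda>w. (?X w, ?Y w))"
    unfolding indep_var_distribution_eq P_def \<nu>_def by simp
  have \<phi>i: "integrable (P \<Otimes>\<^sub>M \<nu>) \<phi>"
    unfolding PN
  proof (subst integrable_distr_eq)
    show "integrable M (\<lambda>w. \<phi> (?X w, ?Y w))"
    proof (rule integrable_const_bound[where B = "B * exp (C\<^sup>2 * (t - s) / 2)"])
      show "AE w in M. norm (\<phi> (?X w, ?Y w)) \<le> B * exp (C\<^sup>2 * (t - s) / 2)"
      proof (rule AE_I2)
        fix w assume w: "w \<in> space M"
        have "(\<xi> w)\<^sup>2 \<le> C\<^sup>2" using \<xi>C[OF w] by (metis abs_ge_zero power2_abs power_mono)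
        then have "exp ((\<xi> w)\<^sup>2 * (t - s) / 2) \<le> exp (C\<^sup>2 * (t - s) / 2)"
          using st by (simp add: mult_right_mono)
        then show "norm (\<phi> (?X w, ?Y w)) \<le> B * exp (C\<^sup>2 * (t - s) / 2)"
          using UB[OF w] order_trans[OF norm_ge_zero UB[OF w]]
          by (auto simp: \<phi>_def norm_mult intro!: mult_mono)
      qed
    qed measurable
  qed measurable
  have "expectation (\<lambda>w. U w * (iexp (\<xi> w * (W t w - W s w)) * complex_of_real (exp ((\<xi> w)\<^sup>2 * (t - s) / 2))))
      = integral\<^sup>L (P \<Otimes>\<^sub>M \<nu>) \<phi>"
    unfolding PN by (subst integral_distr[OF _ \<phi>], measurable) (simp add: \<phi>_def)
  also have "\<dots> = (\<integral>v. (\<integral>z. \<phi> (v, z) \<partial>\<nu>) \<partial>P)"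
    using PN.integral_fst'[OF \<phi>i] by simp
  also have "\<dots> = (\<integral>v. fst v \<partial>P)"
  proof (rule Bochner_Integration.integral_cong[OF refl])
    fix v :: "complex \<times> real"
    \<comment> \<open>For frozen \<open>v\<close> this is the normal characteristic function, the
      reciprocal of the real exponential in \<open>\<phi>\<close>.\<close>
    have "(\<integral>z. iexp (snd v * snd z) \<partial>\<nu>) = complex_of_real (exp (- ((snd v)\<^sup>2 * (t - s) / 2)))"
    proof -
      have [measurable]: "(\<lambda>z :: complex \<times> real. iexp (snd v * snd z)) \<in> borel_measurable borel"
        by (intro borel_measurable_continuous_onI continuous_intros)
      show ?thesis
        unfolding \<nu>_def by (subst integral_distr, measurable) (use incr_char[OF st, of "snd v"] in simp)
    qed
    then show "(\<integral>z. \<phi> (v, z) \<partial>\<nu>) = fst v"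
      by (simp add: \<phi>_def exp_minus flip: of_real_mult)
  qed
  also have "\<dots> = expectation U" unfolding P_def
    by (subst integral_distr) (auto intro!: borel_measurable_continuous_onI continuous_intros)
  finally show ?thesis .
qed

text \<open>Given the information at its starting time, the last factor has mean 1 and can be
  removed. The number \<open>n\<close> of factors is not tied to \<open>2^k\<close>, which makes the
  induction possible; the earlier factors are bounded because the coefficients are.\<close>

lemma exponential_sum:
  fixes \<xi> :: "nat \<Rightarrow> 'a \<Rightarrow> real"
  assumes T: "0 < T" and \<xi>: "\<And>i. \<xi> i \<in> borel_measurable (\<F> (grid T k i))"
    and \<xi>C: "\<And>i w. w \<in> space M \<Longrightarrow> \<bar>\<xi> i w\<bar> \<le> C"
  shows "expectation (\<lambda>w. iexp (\<Sum>i<n. \<xi> i w * (W (grid T k (Suc i)) w - W (grid T k i) w)) *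
           complex_of_real (exp (\<Sum>i<n. (\<xi> i w)\<^sup>2 * (grid T k (Suc i) - grid T k i) / 2))) = 1"
proof (induction n)
  case (Suc n)
  let ?d = "\<lambda>i w. W (grid T k (Suc i)) w - W (grid T k i) w"
  let ?U = "\<lambda>w. iexp (\<Sum>i<n. \<xi> i w * ?d i w) *
           complex_of_real (exp (\<Sum>i<n. (\<xi> i w)\<^sup>2 * (grid T k (Suc i) - grid T k i) / 2))"
  have T0: "0 \<le> T" using T by simp
  have [measurable]: "\<xi> i \<in> borel_measurable (\<F> (grid T k n))" if "i < n" for i
    using measurable_\<F>_mono[OF grid_nonneg[OF T0] grid_mono[OF T0] \<xi>] that by auto
  have [measurable]: "?d i \<in> borel_measurable (\<F> (grid T k n))" if "i < n" for i
    by (rule W_incr_adapted) (use T0 that in \<open>auto intro!: grid_nonneg grid_mono\<close>)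
  have U: "?U \<in> borel_measurable (\<F> (grid T k n))"
    by measurable
  have UB: "norm (?U w) \<le> exp (\<Sum>i<n. C\<^sup>2 * (grid T k (Suc i) - grid T k i) / 2)" if "w \<in> space M" for w
  proof -
    have "(\<xi> i w)\<^sup>2 \<le> C\<^sup>2" for i using \<xi>C[OF that, of i] by (metis abs_ge_zero power2_abs power_mono)
    then show ?thesis
      using grid_mono[OF T0, of _ "Suc _" k]
      by (auto simp: norm_mult intro!: sum_mono divide_right_mono mult_right_mono)
  qed
  have "expectation (\<lambda>w. ?U w * (iexp (\<xi> n w * ?d n w) *
      complex_of_real (exp ((\<xi> n w)\<^sup>2 * (grid T k (Suc n) - grid T k n) / 2)))) = expectation ?U"
    by (rule exponential_step[OF grid_nonneg[OF T0] grid_less[OF T] U UB \<xi> \<xi>C])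
  then show ?case using Suc.IH by (simp add: distrib_left exp_add mult_ac)
qed (simp add: prob_space)

end

section \<open>The stochastic integral\<close>

lemma telescope_refine:
  fixes \<phi> :: "real \<Rightarrow> real" and \<upsilon> :: "nat \<Rightarrow> real"
  assumes pq: "p \<le> q" and ends: "\<upsilon> 0 \<le> p" "q \<le> \<upsilon> m" and mono: "\<And>j. j < m \<Longrightarrow> \<upsilon> j \<le> \<upsilon> (Suc j)"
  shows "(\<Sum>j<m. if max p (\<upsilon> j) < min q (\<upsilon> (Suc j)) then \<phi> (min q (\<upsilon> (Suc j))) - \<phi> (max p (\<upsilon> j)) else 0)
       = \<phi> q - \<phi> p"
proof -
  \<comment> \<open>The points of \<open>\<upsilon>\<close> clamped to \<open>{p..q}\<close>. A cell
    meeting the interval in a point or not at all has both ends clamped to the same value, so the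
    sum telescopes.\<close>
  let ?c = "\<lambda>j. max p (min (\<upsilon> j) q)"
  have "(if max p (\<upsilon> j) < min q (\<upsilon> (Suc j)) then \<phi> (min q (\<upsilon> (Suc j))) - \<phi> (max p (\<upsilon> j)) else 0)
      = \<phi> (?c (Suc j)) - \<phi> (?c j)" if "j < m" for j
  proof (cases "max p (\<upsilon> j) < min q (\<upsilon> (Suc j))")
    case True
    then have "?c (Suc j) = min q (\<upsilon> (Suc j))" "?c j = max p (\<upsilon> j)" by auto
    then show ?thesis using True by simp
  next
    case False
    then have eq: "?c (Suc j) = ?c j" using mono[OF that] pq by linarith
    show ?thesis by (simp only: False if_False eq diff_self)
  qed
  then have "(\<Sum>j<m. if max p (\<upsilon> j) < min q (\<upsilon> (Suc j)) then \<phi> (min q (\<upsilon> (Suc j))) - \<phi> (max p (\<upsilon> j)) else 0)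
      = (\<Sum>j<m. \<phi> (?c (Suc j)) - \<phi> (?c j))" by (intro sum.cong) auto
  also have "\<dots> = \<phi> (?c m) - \<phi> (?c 0)" by (rule sum_lessThan_telescope)
  also have "\<dots> = \<phi> q - \<phi> p" using pq ends by (simp add: max_def min_def)
  finally show ?thesis .
qed

lemma simple_integrand_mono:
  assumes "simple_integrand \<F> T n \<tau> \<xi>" "i \<le> j" "j \<le> n"
  shows "\<tau> i \<le> \<tau> j"
  using assms(2,3)
proof (induction j rule: dec_induct)
  case (step j)
  then have "\<tau> i \<le> \<tau> j" by simp
  also have "\<tau> j \<le> \<tau> (Suc j)" using assms(1) step.prems by (simp add: simple_integrand_def)
  finally show ?case .
qed simp

lemma simple_integrand_bounds:
  assumes "simple_integrand \<F> T n \<tau> \<xi>" "i \<le> n"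
  shows "0 \<le> \<tau> i" "\<tau> i \<le> T"
  using simple_integrand_mono[OF assms(1), of 0 i] simple_integrand_mono[OF assms(1), of i n] assms
  by (auto simp: simple_integrand_def)

lemma simple_value_eq:
  assumes S: "simple_integrand \<F> T n \<tau> \<xi>" and i: "i < n" and s: "s \<in> {\<tau> i<..\<tau> (Suc i)}"
  shows "simple_value n \<tau> \<xi> s w = \<xi> i w"
proof -
  have "indicator {\<tau> j<..\<tau> (Suc j)} s = (if j = i then 1 else 0 :: real)" if j: "j < n" for j
    using s j i simple_integrand_mono[OF S, of "Suc j" i] simple_integrand_mono[OF S, of "Suc i" j]
    by (cases j i rule: linorder_cases) (auto simp: indicator_def)
  then have "simple_value n \<tau> \<xi> s w = (\<Sum>j<n. if j = i then \<xi> i w else 0)"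
    unfolding simple_value_def by (intro sum.cong) auto
  then show ?thesis using i by simp
qed

lemma simple_integrand_cell:
  assumes S: "simple_integrand \<F> T n \<tau> \<xi>" and s: "0 < s" "s \<le> T"
  obtains i where "i < n" "s \<in> {\<tau> i<..\<tau> (Suc i)}"
proof -
  define j where "j = (LEAST j. s \<le> \<tau> j)"
  have sn: "s \<le> \<tau> n" and s0: "\<not> s \<le> \<tau> 0" using S s by (auto simp: simple_integrand_def)
  have j: "s \<le> \<tau> j" unfolding j_def by (rule LeastI[of _ n]) (rule sn)
  have jn: "j \<le> n" unfolding j_def by (rule Least_le) (rule sn)
  from j s0 obtain i where i: "j = Suc i" by (cases j) auto
  have "\<not> s \<le> \<tau> i" using not_less_Least[of i "\<lambda>j. s \<le> \<tau> j"] i by (simp add: j_def)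
  then show thesis using that[of i] i j jn by auto
qed

text \<open>Its instances are continuous functions of \<open>X\<close>, bounded because the state
  space is compact. Boundedness keeps second moments and exponentials finite, so no localisation by
  stopping times is needed.\<close>

locale bounded_integrand = brownian_filtration M \<F> W for M :: "'a measure" and \<F> W +
  fixes H :: "real \<Rightarrow> 'a \<Rightarrow> real" and C :: real
  assumes H_adapted: "\<And>t. 0 \<le> t \<Longrightarrow> H t \<in> borel_measurable (\<F> t)"
    and H_continuous: "\<And>w. w \<in> space M \<Longrightarrow> continuous_on {0..} (\<lambda>t. H t w)"
    and H_bounded: "\<And>t w. 0 \<le> t \<Longrightarrow> w \<in> space M \<Longrightarrow> \<bar>H t w\<bar> \<le> C"
begin

lemma H_measurable: "0 \<le> t \<Longrightarrow> H t \<in> borel_measurable M"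
  using H_adapted measurable_\<F>_M by blast

text \<open>The event in the hypothesis of \<open>is_stochastic_integral\<close>, so that this
  hypothesis can be used by mere unfolding.\<close>

definition bad :: "real \<Rightarrow> nat \<Rightarrow> (nat \<Rightarrow> real) \<Rightarrow> (nat \<Rightarrow> 'a \<Rightarrow> real) \<Rightarrow> real \<Rightarrow> 'a set" where
  "bad T n \<tau> \<xi> \<epsilon> = {w\<in>space M. \<exists>s\<in>{0<..T}. \<bar>simple_value n \<tau> \<xi> s w - H s w\<bar> > \<epsilon>}"

text \<open>Both processes are left-continuous, so rational times suffice.\<close>

lemma bad_event:
  assumes S: "simple_integrand \<F> T n \<tau> \<xi>"
  shows "bad T n \<tau> \<xi> \<epsilon> \<in> events"
proof -
  have "bad T n \<tau> \<xi> \<epsilon> = (\<Union>s\<in>\<rat>\<inter>{0<..T}. {w\<in>space M. \<bar>simple_value n \<tau> \<xi> s w - H s w\<bar> > \<epsilon>})"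
  proof (intro equalityI subsetI)
    fix w assume "w \<in> bad T n \<tau> \<xi> \<epsilon>"
    then obtain s where w: "w \<in> space M" and s: "0 < s" "s \<le> T" "\<bar>simple_value n \<tau> \<xi> s w - H s w\<bar> > \<epsilon>"
      by (auto simp: bad_def)
    obtain i where i: "i < n" "s \<in> {\<tau> i<..\<tau> (Suc i)}" by (rule simple_integrand_cell[OF S s(1,2)])
    have \<tau>0: "0 \<le> \<tau> i" using simple_integrand_bounds[OF S, of i] i by simp
    have "isCont (\<lambda>t. H t w) s"
      using H_continuous[OF w] s(1) by (intro continuous_on_interior[of "{0..}"]) auto
    then have "isCont (\<lambda>t. \<bar>\<xi> i w - H t w\<bar>) s" by (intro continuous_intros)
    moreover have "\<epsilon> < \<bar>\<xi> i w - H s w\<bar>" using s(3) simple_value_eq[OF S i] by simp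
    ultimately have "\<forall>\<^sub>F t in at s. \<epsilon> < \<bar>\<xi> i w - H t w\<bar>"
      by (intro order_tendstoD) (auto simp: isCont_def)
    then obtain d where d: "d > 0" "\<And>t. t \<noteq> s \<Longrightarrow> dist t s < d \<Longrightarrow> \<epsilon> < \<bar>\<xi> i w - H t w\<bar>"
      by (auto simp: eventually_at)
    have "max (\<tau> i) (s - d) < s" using i d by auto
    then obtain t where t: "t \<in> \<rat>" "max (\<tau> i) (s - d) < t" "t < s"
      using Rats_dense_in_real by blast
    have "\<bar>simple_value n \<tau> \<xi> t w - H t w\<bar> > \<epsilon>"
      using d(2)[of t] t i simple_value_eq[OF S i(1), of t] by (auto simp: dist_real_def)
    then show "w \<in> (\<Union>s\<in>\<rat>\<inter>{0<..T}. {w\<in>space M. \<bar>simple_value n \<tau> \<xi> s w - H s w\<bar> > \<epsilon>})"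
      using w t \<tau>0 s by (auto intro!: bexI[of _ t])
  qed (auto simp: bad_def)
  also have "\<dots> \<in> events"
  proof (rule sets.countable_UN'')
    show "countable (\<rat> \<inter> {0<..T})" by (simp add: countable_rat)
    fix s assume "s \<in> \<rat> \<inter> {0<..T}"
    then have [measurable]: "H s \<in> borel_measurable M" using H_measurable by auto
    have [measurable]: "\<xi> i \<in> borel_measurable M" if "i < n" for i
      using S that simple_integrand_bounds[OF S, of i] measurable_\<F>_M[of "\<tau> i"]
      by (auto simp: simple_integrand_def)
    have [measurable]: "simple_value n \<tau> \<xi> s \<in> borel_measurable M"
      unfolding simple_value_def[abs_def] by measurable
    show "{w\<in>space M. \<bar>simple_value n \<tau> \<xi> s w - H s w\<bar> > \<epsilon>} \<in> events" by measurable
  qed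
  finally show ?thesis .
qed

lemma simple_integral_measurable:
  assumes S: "simple_integrand \<F> T n \<tau> \<xi>" and Y: "\<And>t. 0 \<le> t \<Longrightarrow> Y t \<in> borel_measurable M"
  shows "simple_integral n \<tau> \<xi> Y \<in> borel_measurable M"
proof -
  have "\<xi> i \<in> borel_measurable M" "Y (\<tau> i) \<in> borel_measurable M" "Y (\<tau> (Suc i)) \<in> borel_measurable M" if "i < n" for i
    using S that simple_integrand_bounds[OF S, of i] simple_integrand_bounds[OF S, of "Suc i"] measurable_\<F>_M[of "\<tau> i"] Y
    by (auto simp: simple_integrand_def)
  then show ?thesis unfolding simple_integral_def[abs_def]
    by (intro borel_measurable_sum borel_measurable_times borel_measurable_diff) auto
qed

text \<open>Both sums are rewritten over the common refinement; there the coefficients differ by at most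
  \<open>2\<epsilon>\<close> off the two bad events, and may be truncated at \<open>2\<epsilon>\<close>.\<close>

lemma simple_integral_compare:
  assumes S1: "simple_integrand \<F> T n \<tau> \<xi>" and S2: "simple_integrand \<F> T m \<upsilon> \<eta>" and \<epsilon>: "\<epsilon> > 0"
  shows "ky_fan M (\<lambda>w. simple_integral n \<tau> \<xi> W w - simple_integral m \<upsilon> \<eta> W w)
     \<le> prob (bad T n \<tau> \<xi> \<epsilon>) + prob (bad T m \<upsilon> \<eta> \<epsilon>) + \<epsilon> * (1 + 2 * T)"
proof -
  define a where "a = (\<lambda>(i, j). max (\<tau> i) (\<upsilon> j))"
  define b where "b = (\<lambda>(i, j). min (\<tau> (Suc i)) (\<upsilon> (Suc j)))"
  \<comment> \<open>Only the nondegenerate intersections of a cell of \<open>\<tau>\<close> with a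
    cell of \<open>\<upsilon>\<close>, as \<open>martingale_sum_bound\<close> asks for intervals of
    positive length.\<close>
  define K where "K = {k \<in> {..<n} \<times> {..<m}. a k < b k}"
  have K: "finite K" unfolding K_def by simp
  note mono1 = simple_integrand_mono[OF S1] and mono2 = simple_integrand_mono[OF S2]
  have ends: "\<tau> 0 = 0" "\<tau> n = T" "\<upsilon> 0 = 0" "\<upsilon> m = T" using S1 S2 by (auto simp: simple_integrand_def)
  have refine: "(\<Sum>i<n. c i * (\<phi> (\<tau> (Suc i)) - \<phi> (\<tau> i))) = (\<Sum>k\<in>K. c (fst k) * (\<phi> (b k) - \<phi> (a k)))"
    "(\<Sum>j<m. c j * (\<phi> (\<upsilon> (Suc j)) - \<phi> (\<upsilon> j))) = (\<Sum>k\<in>K. c (snd k) * (\<phi> (b k) - \<phi> (a k)))"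
    for c and \<phi> :: "real \<Rightarrow> real"
  proof -
    have KS: "(\<Sum>k\<in>K. g k) = (\<Sum>i<n. \<Sum>j<m. if a (i, j) < b (i, j) then g (i, j) else 0)" for g :: "nat \<times> nat \<Rightarrow> real"
      unfolding K_def by (subst sum.cartesian_product, subst sum.inter_filter) (auto intro!: sum.cong)
    have KS': "(\<Sum>k\<in>K. g k) = (\<Sum>j<m. \<Sum>i<n. if a (i, j) < b (i, j) then g (i, j) else 0)" for g :: "nat \<times> nat \<Rightarrow> real"
      unfolding KS by (rule sum.swap)
    show "(\<Sum>i<n. c i * (\<phi> (\<tau> (Suc i)) - \<phi> (\<tau> i))) = (\<Sum>k\<in>K. c (fst k) * (\<phi> (b k) - \<phi> (a k)))"
      unfolding KS
    proof (intro sum.cong refl)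
      fix i assume i: "i \<in> {..<n}"
      have "\<phi> (\<tau> (Suc i)) - \<phi> (\<tau> i) = (\<Sum>j<m. if a (i, j) < b (i, j) then \<phi> (b (i, j)) - \<phi> (a (i, j)) else 0)"
        unfolding a_def b_def prod.case
        by (rule telescope_refine[symmetric]) (use i mono1 mono2 ends simple_integrand_bounds[OF S1] in auto)
      then show "c i * (\<phi> (\<tau> (Suc i)) - \<phi> (\<tau> i)) =
          (\<Sum>j<m. if a (i, j) < b (i, j) then c (fst (i, j)) * (\<phi> (b (i, j)) - \<phi> (a (i, j))) else 0)"
        by (simp add: sum_distrib_left if_distrib[of "\<lambda>x. c i * x"] cong: if_cong)
    qed
    show "(\<Sum>j<m. c j * (\<phi> (\<upsilon> (Suc j)) - \<phi> (\<upsilon> j))) = (\<Sum>k\<in>K. c (snd k) * (\<phi> (b k) - \<phi> (a k)))"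
      unfolding KS'
    proof (intro sum.cong refl)
      fix j assume j: "j \<in> {..<m}"
      have "\<phi> (\<upsilon> (Suc j)) - \<phi> (\<upsilon> j) = (\<Sum>i<n. if a (i, j) < b (i, j) then \<phi> (b (i, j)) - \<phi> (a (i, j)) else 0)"
        unfolding a_def b_def prod.case max.commute[of "\<tau> _"] min.commute[of "\<tau> _"]
        by (rule telescope_refine[symmetric]) (use j mono1 mono2 ends simple_integrand_bounds[OF S2] in auto)
      then show "c j * (\<phi> (\<upsilon> (Suc j)) - \<phi> (\<upsilon> j)) =
          (\<Sum>i<n. if a (i, j) < b (i, j) then c (snd (i, j)) * (\<phi> (b (i, j)) - \<phi> (a (i, j))) else 0)"
        by (simp add: sum_distrib_left if_distrib[of "\<lambda>x. c j * x"] cong: if_cong)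
    qed
  qed
  define D where "D = (\<lambda>k w. max (- (2 * \<epsilon>)) (min (2 * \<epsilon>) (\<xi> (fst k) w - \<eta> (snd k) w)))"
  let ?S = "\<lambda>w. \<Sum>k\<in>K. D k w * (W (b k) w - W (a k) w)"
  have a0: "0 \<le> a k" if "k \<in> K" for k
    using that simple_integrand_bounds[OF S1, of "fst k"] by (auto simp: K_def a_def split: prod.splits)
  have DF: "D k \<in> borel_measurable (\<F> (a k))" if "k \<in> K" for k
  proof -
    obtain i j where k: "k = (i, j)" "i < n" "j < m" using \<open>k \<in> K\<close> by (auto simp: K_def)
    have "\<xi> i \<in> borel_measurable (\<F> (a k))" "\<eta> j \<in> borel_measurable (\<F> (a k))"
      using S1 S2 k simple_integrand_bounds[OF S1, of i] simple_integrand_bounds[OF S2, of j]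
      by (auto simp: simple_integrand_def a_def intro: measurable_\<F>_mono[of "\<tau> i"] measurable_\<F>_mono[of "\<upsilon> j"])
    then show ?thesis unfolding D_def k by simp
  qed
  have disj: "b k \<le> a k' \<or> b k' \<le> a k" if kk: "k \<in> K" "k' \<in> K" "k \<noteq> k'" for k k'
  proof -
    obtain i j i' j' where k: "k = (i, j)" "i < n" "j < m" and k': "k' = (i', j')" "i' < n" "j' < m"
      using kk by (auto simp: K_def)
    consider "i < i'" | "i' < i" | "j < j'" | "j' < j" using kk(3) k k' by (cases i i' rule: linorder_cases; cases j j' rule: linorder_cases) auto
    then show ?thesis
    proof cases
      case 1 then show ?thesis using mono1[of "Suc i" i'] k k' by (auto simp: a_def b_def)
    next
      case 2 then show ?thesis using mono1[of "Suc i'" i] k k' by (auto simp: a_def b_def)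
    next
      case 3 then show ?thesis using mono2[of "Suc j" j'] k k' by (auto simp: a_def b_def)
    next
      case 4 then show ?thesis using mono2[of "Suc j'" j] k k' by (auto simp: a_def b_def)
    qed
  qed
  have DC: "\<bar>D k w\<bar> \<le> 2 * \<epsilon>" for k w using \<epsilon> by (auto simp: D_def)
  have ab: "a k < b k" if "k \<in> K" for k using that by (simp add: K_def)
  note msb = martingale_sum_bound[of K a b D "2 * \<epsilon>", OF K a0 ab disj DF DC]
  have "(\<Sum>k\<in>K. b k - a k) = T" using refine(1)[of "\<lambda>_. 1" "\<lambda>x. x"] ends
    by (simp add: sum_lessThan_telescope)
  with msb have S: "integrable M (\<lambda>w. (?S w)\<^sup>2)" "expectation (\<lambda>w. (?S w)\<^sup>2) \<le> (2 * \<epsilon>)\<^sup>2 * T"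
    by auto
  have SM: "?S \<in> borel_measurable M"
    using measurable_\<F>_M[OF a0 DF] W_measurable[OF a0] W_measurable[OF order_trans[OF a0 less_imp_le[OF ab]]]
    by (intro borel_measurable_sum borel_measurable_times borel_measurable_diff) auto
  have "ky_fan M (\<lambda>w. simple_integral n \<tau> \<xi> W w - simple_integral m \<upsilon> \<eta> W w)
      \<le> prob (bad T n \<tau> \<xi> \<epsilon> \<union> bad T m \<upsilon> \<eta> \<epsilon>) + ky_fan M ?S"
  proof (rule ky_fan_off_event[OF _ _ _ AE_I2[OF impI]])
    fix w assume w: "w \<in> space M" "w \<notin> bad T n \<tau> \<xi> \<epsilon> \<union> bad T m \<upsilon> \<eta> \<epsilon>"
    have "D k w = \<xi> (fst k) w - \<eta> (snd k) w" if "k \<in> K" for k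
    proof -
      obtain i j where k: "k = (i, j)" "i < n" "j < m" using \<open>k \<in> K\<close> by (auto simp: K_def)
      \<comment> \<open>The right end of the intersection belongs to both half-open cells, so one
        time reads off both coefficients.\<close>
      have s: "b k \<in> {\<tau> i<..\<tau> (Suc i)}" "b k \<in> {\<upsilon> j<..\<upsilon> (Suc j)}" "b k \<in> {0<..T}"
        using ab[OF that] a0[OF that] k simple_integrand_bounds[OF S1, of "Suc i"] by (auto simp: a_def b_def)
      have "\<bar>simple_value n \<tau> \<xi> (b k) w - H (b k) w\<bar> \<le> \<epsilon>" "\<bar>simple_value m \<upsilon> \<eta> (b k) w - H (b k) w\<bar> \<le> \<epsilon>"
        using w s(3) by (auto simp: bad_def not_less)
      then have "\<bar>\<xi> i w - \<eta> j w\<bar> \<le> 2 * \<epsilon>"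
        using simple_value_eq[OF S1 k(2) s(1)] simple_value_eq[OF S2 k(3) s(2)] by auto
      then show ?thesis by (auto simp: D_def k)
    qed
    then have "?S w = (\<Sum>k\<in>K. (\<xi> (fst k) w - \<eta> (snd k) w) * (W (b k) w - W (a k) w))"
      by (intro sum.cong) auto
    also have "\<dots> = simple_integral n \<tau> \<xi> W w - simple_integral m \<upsilon> \<eta> W w"
      unfolding simple_integral_def refine(1)[of "\<lambda>i. \<xi> i w" "\<lambda>t. W t w"] refine(2)[of "\<lambda>i. \<eta> i w" "\<lambda>t. W t w"]
      by (simp add: left_diff_distrib sum_subtractf)
    finally show "\<bar>simple_integral n \<tau> \<xi> W w - simple_integral m \<upsilon> \<eta> W w\<bar> \<le> \<bar>?S w\<bar>" by simp
  qed (use SM bad_event[OF S1] bad_event[OF S2] simple_integral_measurable[OF S1 W_measurable]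
        simple_integral_measurable[OF S2 W_measurable] in auto)
  also have "prob (bad T n \<tau> \<xi> \<epsilon> \<union> bad T m \<upsilon> \<eta> \<epsilon>) \<le> prob (bad T n \<tau> \<xi> \<epsilon>) + prob (bad T m \<upsilon> \<eta> \<epsilon>)"
    by (rule measure_Un_le[OF bad_event[OF S1] bad_event[OF S2]])
  \<comment> \<open>The second moment is at most \<open>4 * \<epsilon>\<^sup>2 * T\<close>, so
    \<open>\<eta> = \<epsilon>\<close> makes both terms linear in \<open>\<epsilon>\<close>.\<close>
  also have "ky_fan M ?S \<le> \<epsilon> / 2 + expectation (\<lambda>w. (?S w)\<^sup>2) / (2 * \<epsilon>)"
    by (rule ky_fan_le_square[OF SM S(1) \<epsilon>])
  also have "\<dots> \<le> \<epsilon> / 2 + (2 * \<epsilon>)\<^sup>2 * T / (2 * \<epsilon>)"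
    using S(2) \<epsilon> by (intro add_left_mono divide_right_mono) auto
  also have "\<dots> \<le> \<epsilon> * (1 + 2 * T)" using \<epsilon> by (simp add: power2_eq_square algebra_simps)
  finally show ?thesis by simp
qed

section \<open>The Ito integral as a dyadic limit\<close>

definition grid_integral_W :: "real \<Rightarrow> nat \<Rightarrow> 'a \<Rightarrow> real" where
  "grid_integral_W T k = simple_integral (2 ^ k) (grid T k) (\<lambda>i. H (grid T k i)) W"

lemma grid_simple_integrand: "0 \<le> T \<Longrightarrow> simple_integrand \<F> T (2 ^ k) (grid T k) (\<lambda>i. H (grid T k i))"
  by (auto simp: simple_integrand_def intro: grid_mono H_adapted grid_nonneg)

lemma grid_integral_W_measurable: "0 \<le> T \<Longrightarrow> grid_integral_W T k \<in> borel_measurable M"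
  unfolding grid_integral_W_def
  by (rule simple_integral_measurable[OF grid_simple_integrand]) (simp_all add: W_measurable)

lemma grid_integral_W_eq:
  "grid_integral_W T k w = (\<Sum>i<2^k. H (grid T k i) w * (W (grid T k (Suc i)) w - W (grid T k i) w))"
  by (simp add: grid_integral_W_def simple_integral_def)

text \<open>Each path, being continuous, leaves the bad event for all large \<open>k\<close>;
  dominated convergence of the indicators does the rest.\<close>

lemma prob_bad_grid_tendsto_0:
  assumes T: "0 \<le> T" and \<epsilon>: "\<epsilon> > 0"
  shows "(\<lambda>k. prob (bad T (2 ^ k) (grid T k) (\<lambda>i. H (grid T k i)) \<epsilon>)) \<longlonglongrightarrow> 0"
proof -
  let ?B = "\<lambda>k. bad T (2 ^ k) (grid T k) (\<lambda>i. H (grid T k i)) \<epsilon>"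
  have [measurable]: "?B k \<in> events" for k by (rule bad_event[OF grid_simple_integrand[OF T]])
  have "(\<lambda>k. \<integral>w. indicator (?B k) w \<partial>M) \<longlonglongrightarrow> (\<integral>w. 0 \<partial>M :: real)"
  proof (rule integral_dominated_convergence[where w = "\<lambda>_. 1"])
    show "AE w in M. (\<lambda>k. indicator (?B k) w :: real) \<longlonglongrightarrow> 0"
    proof (rule AE_I2)
      fix w assume w: "w \<in> space M"
      have "continuous_on {0..T} (\<lambda>t. H t w)" by (rule continuous_on_subset[OF H_continuous[OF w]]) auto
      from grid_oscillation[OF T this \<epsilon>]
      have "\<forall>\<^sub>F k in sequentially. indicator (?B k) w = (0 :: real)"
      proof eventually_elim
        case (elim k)
        have "w \<notin> ?B k"
        proof
          assume "w \<in> ?B k"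
          then obtain s where s: "0 < s" "s \<le> T" "\<bar>simple_value (2^k) (grid T k) (\<lambda>i. H (grid T k i)) s w - H s w\<bar> > \<epsilon>"
            by (auto simp: bad_def)
          obtain i where i: "i < 2^k" "s \<in> {grid T k i<..grid T k (Suc i)}"
            by (rule simple_integrand_cell[OF grid_simple_integrand[OF T] s(1,2)])
          have "\<bar>H s w - H (grid T k i) w\<bar> \<le> \<epsilon>" using elim i by auto
          then show False using s(3) simple_value_eq[OF grid_simple_integrand[OF T] i] by auto
        qed
        then show ?case by simp
      qed
      then show "(\<lambda>k. indicator (?B k) w :: real) \<longlonglongrightarrow> 0" by (rule tendsto_eventually)
    qed
  qed auto
  then show ?thesis by simp
qed

lemma grid_integral_W_limit:
  assumes T: "0 \<le> T"
  obtains Z where "Z \<in> borel_measurable M" "(\<lambda>k. ky_fan M (\<lambda>w. grid_integral_W T k w - Z w)) \<longlonglongrightarrow> 0"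
proof -
  note [measurable] = grid_integral_W_measurable[OF T]
  let ?p = "\<lambda>\<epsilon> k. prob (bad T (2 ^ k) (grid T k) (\<lambda>i. H (grid T k i)) \<epsilon>)"
  have C: "\<exists>N. \<forall>m\<ge>N. \<forall>n\<ge>N. ky_fan M (\<lambda>w. grid_integral_W T m w - grid_integral_W T n w) < e" if e: "e > 0" for e
  proof -
    define d where "d = 1 + 2 * T"
    have d: "d > 0" using T by (simp add: d_def)
    \<comment> \<open>Two bad events below \<open>e / 4\<close> each and a term equal to
      \<open>e / 4\<close> together stay below \<open>e\<close>.\<close>
    define \<epsilon> where "\<epsilon> = e / (4 * d)"
    have \<epsilon>: "\<epsilon> > 0" "\<epsilon> * (1 + 2 * T) = e / 4" using e d by (auto simp: \<epsilon>_def d_def[symmetric])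
    have "\<forall>\<^sub>F k in sequentially. ?p \<epsilon> k < e / 4"
      using prob_bad_grid_tendsto_0[OF T \<epsilon>(1)] e by (intro order_tendstoD(2)[where y = 0]) auto
    then obtain N where N: "\<And>k. k \<ge> N \<Longrightarrow> ?p \<epsilon> k < e / 4" by (auto simp: eventually_sequentially)
    have "ky_fan M (\<lambda>w. grid_integral_W T m w - grid_integral_W T n w) < e" if "m \<ge> N" "n \<ge> N" for m n
      using simple_integral_compare[OF grid_simple_integrand[OF T, of m] grid_simple_integrand[OF T, of n] \<epsilon>(1)]
        N[OF that(1)] N[OF that(2)] \<epsilon>(2) e unfolding grid_integral_W_def by linarith
    then show ?thesis by blast
  qed
  obtain Z r where Zr: "Z \<in> borel_measurable M" "strict_mono (r::nat\<Rightarrow>nat)" "AE w in M. (\<lambda>k. grid_integral_W T (r k) w) \<longlonglongrightarrow> Z w"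
    by (rule ky_fan_Cauchy[of "grid_integral_W T"]) (use C in auto)
  note [measurable] = Zr(1)
  have sub: "(\<lambda>k. ky_fan M (\<lambda>w. grid_integral_W T (r k) w - Z w)) \<longlonglongrightarrow> 0"
    using Zr by (intro ky_fan_AE_tendsto) auto
  have "(\<lambda>k. ky_fan M (\<lambda>w. grid_integral_W T k w - Z w)) \<longlonglongrightarrow> 0"
  proof (rule tendstoI)
    fix e :: real assume e: "e > 0"
    obtain N where N: "\<And>m n. m \<ge> N \<Longrightarrow> n \<ge> N \<Longrightarrow> ky_fan M (\<lambda>w. grid_integral_W T m w - grid_integral_W T n w) < e / 2"
      using C[of "e / 2"] e by auto
    have "\<forall>\<^sub>F k in sequentially. ky_fan M (\<lambda>w. grid_integral_W T (r k) w - Z w) < e / 2"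
      using sub e by (intro order_tendstoD(2)[where y = 0]) auto
    then obtain K where K: "\<And>k. k \<ge> K \<Longrightarrow> ky_fan M (\<lambda>w. grid_integral_W T (r k) w - Z w) < e / 2"
      by (auto simp: eventually_sequentially)
    have "ky_fan M (\<lambda>w. grid_integral_W T k w - Z w) < e" if "k \<ge> N" for k
    proof -
      let ?m = "max N K"
      have "r ?m \<ge> N" using seq_suble[OF Zr(2), of ?m] by linarith
      then show ?thesis
        using ky_fan_triangle[of "grid_integral_W T k" "grid_integral_W T (r ?m)" Z] N[OF that, of "r ?m"] K[of ?m] by auto
    qed
    then show "\<forall>\<^sub>F k in sequentially. dist (ky_fan M (\<lambda>w. grid_integral_W T k w - Z w)) 0 < e"
      using ky_fan_nonneg by (auto simp: eventually_sequentially dist_real_def)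
  qed
  with Zr(1) show thesis by (rule that)
qed

text \<open>Determined up to null sets, which is all that the statements about it see.\<close>

definition Ito :: "real \<Rightarrow> 'a \<Rightarrow> real" where
  "Ito T = (SOME Z. Z \<in> borel_measurable M \<and> (\<lambda>k. ky_fan M (\<lambda>w. grid_integral_W T k w - Z w)) \<longlonglongrightarrow> 0)"

lemma Ito_spec:
  assumes "0 \<le> T"
  shows "Ito T \<in> borel_measurable M" "(\<lambda>k. ky_fan M (\<lambda>w. grid_integral_W T k w - Ito T w)) \<longlonglongrightarrow> 0"
proof -
  have "\<exists>Z. Z \<in> borel_measurable M \<and> (\<lambda>k. ky_fan M (\<lambda>w. grid_integral_W T k w - Z w)) \<longlonglongrightarrow> 0"
    using grid_integral_W_limit[OF assms] by blast
  from someI_ex[OF this, folded Ito_def]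
  show "Ito T \<in> borel_measurable M" "(\<lambda>k. ky_fan M (\<lambda>w. grid_integral_W T k w - Ito T w)) \<longlonglongrightarrow> 0"
    by (rule conjunct1, rule conjunct2)
qed

text \<open>Frees the integral from the dyadic grids: any admissible sequence is compared with them,
  index by index, through \<open>simple_integral_compare\<close>.\<close>

lemma simple_integral_tendsto_Ito:
  assumes T: "0 \<le> T" and S: "\<And>k::nat. simple_integrand \<F> T (n k) (\<tau> k) (\<xi> k)"
    and bad: "\<And>\<epsilon>. \<epsilon> > 0 \<Longrightarrow> (\<lambda>k. prob (bad T (n k) (\<tau> k) (\<xi> k) \<epsilon>)) \<longlonglongrightarrow> 0"
  shows "(\<lambda>k. ky_fan M (\<lambda>w. simple_integral (n k) (\<tau> k) (\<xi> k) W w - Ito T w)) \<longlonglongrightarrow> 0"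
proof (rule tendstoI)
  fix e :: real assume e: "e > 0"
  note [measurable] = grid_integral_W_measurable[OF T] Ito_spec(1)[OF T]
  have [measurable]: "simple_integral (n k) (\<tau> k) (\<xi> k) W \<in> borel_measurable M" for k
    by (rule simple_integral_measurable[OF S]) (rule W_measurable)
  define d where "d = 1 + 2 * T"
  have d: "d > 0" using T by (simp add: d_def)
  define \<epsilon> where "\<epsilon> = e / (4 * d)"
  have \<epsilon>: "\<epsilon> > 0" "\<epsilon> * (1 + 2 * T) = e / 4" using e d by (auto simp: \<epsilon>_def d_def[symmetric])
  have "\<forall>\<^sub>F k in sequentially. prob (bad T (2 ^ k) (grid T k) (\<lambda>i. H (grid T k i)) \<epsilon>) < e / 4"
    using prob_bad_grid_tendsto_0[OF T \<epsilon>(1)] e by (intro order_tendstoD(2)[where y = 0]) auto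
  moreover have "\<forall>\<^sub>F k in sequentially. ky_fan M (\<lambda>w. grid_integral_W T k w - Ito T w) < e / 4"
    using Ito_spec(2)[OF T] e by (intro order_tendstoD(2)[where y = 0]) auto
  moreover have "\<forall>\<^sub>F k in sequentially. prob (bad T (n k) (\<tau> k) (\<xi> k) \<epsilon>) < e / 4"
    using bad[OF \<epsilon>(1)] e by (intro order_tendstoD(2)[where y = 0]) auto
  ultimately show "\<forall>\<^sub>F k in sequentially. dist (ky_fan M (\<lambda>w. simple_integral (n k) (\<tau> k) (\<xi> k) W w - Ito T w)) 0 < e"
  proof eventually_elim
    case (elim k)
    have "ky_fan M (\<lambda>w. simple_integral (n k) (\<tau> k) (\<xi> k) W w - grid_integral_W T k w) < 3 * e / 4"
      using simple_integral_compare[OF S[of k] grid_simple_integrand[OF T, of k] \<epsilon>(1)] \<epsilon>(2) elim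
      unfolding grid_integral_W_def by linarith
    then show ?case
      using ky_fan_triangle[of "simple_integral (n k) (\<tau> k) (\<xi> k) W" "grid_integral_W T k" "Ito T"] elim ky_fan_nonneg
      by (auto simp: dist_real_def)
  qed
qed

lemma Ito_AE_subseq:
  assumes "0 \<le> T"
  obtains r where "strict_mono (r::nat\<Rightarrow>nat)" "AE w in M. (\<lambda>k. grid_integral_W T (r k) w) \<longlonglongrightarrow> Ito T w"
  by (rule ky_fan_AE_subseq[OF grid_integral_W_measurable[OF assms] Ito_spec[OF assms]])

lemma grid_integral_W_square:
  assumes T: "0 < T"
  shows "integrable M (\<lambda>w. (grid_integral_W T k w)\<^sup>2)" "expectation (\<lambda>w. (grid_integral_W T k w)\<^sup>2) \<le> C\<^sup>2 * T"
proof -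
  note b = martingale_sum_bound[of "{..<(2::nat)^k}" "grid T k" "\<lambda>i. grid T k (Suc i)" "\<lambda>i. H (grid T k i)" C]
  have T0: "0 \<le> T" using T by simp
  show "integrable M (\<lambda>w. (grid_integral_W T k w)\<^sup>2)"
    unfolding grid_integral_W_eq by (rule b(1)) (use grid_disjoint[OF T0] in \<open>auto intro!: grid_nonneg grid_less T T0 H_adapted H_bounded\<close>)
  have "expectation (\<lambda>w. (grid_integral_W T k w)\<^sup>2) \<le> C\<^sup>2 * (\<Sum>i<(2::nat)^k. grid T k (Suc i) - grid T k i)"
    unfolding grid_integral_W_eq by (rule b(2)) (use grid_disjoint[OF T0] in \<open>auto intro!: grid_nonneg grid_less T T0 H_adapted H_bounded\<close>)
  also have "(\<Sum>i<(2::nat)^k. grid T k (Suc i) - grid T k i) = T" by (simp add: grid_step)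
  finally show "expectation (\<lambda>w. (grid_integral_W T k w)\<^sup>2) \<le> C\<^sup>2 * T" .
qed

text \<open>Fatou's lemma along an almost surely convergent subsequence. The upper bound of the
  isometry is enough throughout.\<close>

lemma Ito_square:
  assumes T: "0 < T"
  shows "integrable M (\<lambda>w. (Ito T w)\<^sup>2)" "expectation (\<lambda>w. (Ito T w)\<^sup>2) \<le> C\<^sup>2 * T"
proof -
  note [measurable] = grid_integral_W_measurable[OF less_imp_le[OF T]] Ito_spec(1)[OF less_imp_le[OF T]]
  obtain r :: "nat \<Rightarrow> nat" where r: "AE w in M. (\<lambda>k. grid_integral_W T (r k) w) \<longlonglongrightarrow> Ito T w"
    by (rule Ito_AE_subseq[OF less_imp_le[OF T]])
  have "(\<integral>\<^sup>+w. ennreal ((Ito T w)\<^sup>2) \<partial>M) = (\<integral>\<^sup>+w. liminf (\<lambda>k. ennreal ((grid_integral_W T (r k) w)\<^sup>2)) \<partial>M)"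
    using r by (intro nn_integral_cong_AE, eventually_elim) (auto intro!: lim_imp_Liminf[symmetric] tendsto_intros)
  also have "\<dots> \<le> liminf (\<lambda>k. \<integral>\<^sup>+w. ennreal ((grid_integral_W T (r k) w)\<^sup>2) \<partial>M)"
    by (rule nn_integral_liminf) measurable
  also have "\<dots> \<le> liminf (\<lambda>k. ennreal (C\<^sup>2 * T))"
    using grid_integral_W_square[OF T]
    by (intro Liminf_mono always_eventually allI) (simp add: nn_integral_eq_integral ennreal_leI)
  also have "\<dots> = ennreal (C\<^sup>2 * T)" by (simp add: Liminf_const)
  finally have le: "(\<integral>\<^sup>+w. ennreal ((Ito T w)\<^sup>2) \<partial>M) \<le> ennreal (C\<^sup>2 * T)" .
  show int: "integrable M (\<lambda>w. (Ito T w)\<^sup>2)"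
    by (rule integrableI_bounded) (use le in \<open>auto intro: le_less_trans\<close>)
  show "expectation (\<lambda>w. (Ito T w)\<^sup>2) \<le> C\<^sup>2 * T"
    using le T by (simp add: nn_integral_eq_integral[OF int] ennreal_le_iff)
qed

text \<open>The discrete identities pass to the limit by dominated convergence: the Riemann sums of
  the squared integrand never exceed \<open>C\<^sup>2 * T\<close>, and the oscillating factor has
  modulus 1.\<close>

lemma Ito_exponential:
  assumes T: "0 < T"
  shows "expectation (\<lambda>w. iexp (\<kappa> * Ito T w) * complex_of_real (exp (\<kappa>\<^sup>2 / 2 * integral {0..T} (\<lambda>t. (H t w)\<^sup>2)))) = 1"
proof -
  have T0: "0 \<le> T" using T by simp
  note [measurable] = grid_integral_W_measurable[OF T0] Ito_spec(1)[OF T0]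
  obtain r :: "nat \<Rightarrow> nat" where r: "strict_mono r" "AE w in M. (\<lambda>k. grid_integral_W T (r k) w) \<longlonglongrightarrow> Ito T w"
    by (rule Ito_AE_subseq[OF T0])
  define V where "V = (\<lambda>k w. \<Sum>i<2^k. (H (grid T k i) w)\<^sup>2 * (grid T k (Suc i) - grid T k i))"
  have [measurable]: "H (grid T k i) \<in> borel_measurable M" for k i
    by (rule H_measurable[OF grid_nonneg[OF T0]])
  have [measurable]: "V k \<in> borel_measurable M" for k unfolding V_def by measurable
  have Vlim: "(\<lambda>k. V k w) \<longlonglongrightarrow> integral {0..T} (\<lambda>t. (H t w)\<^sup>2)" if "w \<in> space M" for w
    unfolding V_def
    by (rule grid_Riemann_tendsto[OF T0]) (intro continuous_intros continuous_on_subset[OF H_continuous[OF that]], auto)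
  have [measurable]: "(\<lambda>w. integral {0..T} (\<lambda>t. (H t w)\<^sup>2)) \<in> borel_measurable M"
    by (rule borel_measurable_LIMSEQ_real[OF Vlim]) auto
  let ?E = "\<lambda>k w. iexp (\<kappa> * grid_integral_W T k w) * complex_of_real (exp (\<kappa>\<^sup>2 / 2 * V k w))"
  have E1: "expectation (?E k) = 1" for k
  proof -
    have "expectation (\<lambda>w. iexp (\<Sum>i<2^k. (\<kappa> * H (grid T k i) w) * (W (grid T k (Suc i)) w - W (grid T k i) w)) *
           complex_of_real (exp (\<Sum>i<2^k. (\<kappa> * H (grid T k i) w)\<^sup>2 * (grid T k (Suc i) - grid T k i) / 2))) = 1"
      by (rule exponential_sum[OF T, where C = "\<bar>\<kappa>\<bar> * C"])
         (auto simp: abs_mult intro!: mult_left_mono H_bounded borel_measurable_times[OF borel_measurable_const H_adapted] grid_nonneg T0)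
    moreover have "(\<Sum>i<2^k. (\<kappa> * H (grid T k i) w) * (W (grid T k (Suc i)) w - W (grid T k i) w)) = \<kappa> * grid_integral_W T k w" for w
      by (simp add: grid_integral_W_eq sum_distrib_left mult_ac)
    moreover have "(\<Sum>i<2^k. (\<kappa> * H (grid T k i) w)\<^sup>2 * (grid T k (Suc i) - grid T k i) / 2) = \<kappa>\<^sup>2 / 2 * V k w" for w
      by (simp add: V_def sum_distrib_left power_mult_distrib mult_ac)
    ultimately show ?thesis by simp
  qed
  have VB: "V k w \<le> C\<^sup>2 * T" if "w \<in> space M" for k w
  proof -
    have "(H (grid T k i) w)\<^sup>2 \<le> C\<^sup>2" for i
      using H_bounded[OF grid_nonneg[OF T0] that, of k i] by (metis abs_ge_zero power2_abs power_mono)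
    then have "V k w \<le> (\<Sum>i<(2::nat)^k. C\<^sup>2 * (grid T k (Suc i) - grid T k i))"
      unfolding V_def using grid_mono[OF T0, of _ "Suc _" k] by (intro sum_mono mult_right_mono) auto
    also have "\<dots> = C\<^sup>2 * T" by (simp add: grid_step)
    finally show ?thesis .
  qed
  have "(\<lambda>k. expectation (?E (r k))) \<longlonglongrightarrow> expectation (\<lambda>w. iexp (\<kappa> * Ito T w) * complex_of_real (exp (\<kappa>\<^sup>2 / 2 * integral {0..T} (\<lambda>t. (H t w)\<^sup>2))))"
  proof (rule integral_dominated_convergence[where w = "\<lambda>_. exp (\<kappa>\<^sup>2 / 2 * (C\<^sup>2 * T))"])
    show "AE w in M. (\<lambda>k. ?E (r k) w) \<longlonglongrightarrow> iexp (\<kappa> * Ito T w) * complex_of_real (exp (\<kappa>\<^sup>2 / 2 * integral {0..T} (\<lambda>t. (H t w)\<^sup>2)))"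
      using r(2) AE_space
    proof eventually_elim
      case (elim w)
      have "(\<lambda>k. V (r k) w) \<longlonglongrightarrow> integral {0..T} (\<lambda>t. (H t w)\<^sup>2)"
        using LIMSEQ_subseq_LIMSEQ[OF Vlim[OF elim(2)] r(1)] by (simp add: o_def)
      then show ?case by (intro tendsto_intros elim)
    qed
    show "AE w in M. norm (?E (r k) w) \<le> exp (\<kappa>\<^sup>2 / 2 * (C\<^sup>2 * T))" for k
      using AE_space by eventually_elim (use VB[of _ "r k"] in \<open>auto simp: norm_mult intro!: mult_left_mono\<close>)
  qed auto
  from this[unfolded E1] show ?thesis by (rule LIMSEQ_unique[OF _ tendsto_const])
qed

end

section \<open>The reflected diffusion\<close>

text \<open>The pathwise integral is a limit of Riemann sums, each a finite combination of
  \<open>H\<close> at fixed times.\<close>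

lemma (in bounded_integrand) integral_measurable:
  assumes T: "0 \<le> T"
  shows "(\<lambda>w. integral {0..T} (\<lambda>t. H t w)) \<in> borel_measurable M"
proof (rule borel_measurable_LIMSEQ_real)
  show "(\<lambda>k. \<Sum>i<2^k. H (grid T k i) w * (grid T k (Suc i) - grid T k i)) \<longlonglongrightarrow> integral {0..T} (\<lambda>t. H t w)"
    if "w \<in> space M" for w
    by (rule grid_Riemann_tendsto[OF T]) (rule continuous_on_subset[OF H_continuous[OF that]], auto)
  show "(\<lambda>w. \<Sum>i<2^k. H (grid T k i) w * (grid T k (Suc i) - grid T k i)) \<in> borel_measurable M" for k
    using H_measurable[OF grid_nonneg[OF T]] by measurable
qed

text \<open>Here \<open>f\<close> is merely continuous and bounded on \<open>{l..u}\<close>; the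
  Lipschitz condition is brought in only by \<open>ergodic_bound\<close>.\<close>

locale reflected_diffusion = brownian_filtration M \<F> W for M :: "'a measure" and \<F> W +
  fixes f :: "real \<Rightarrow> real" and \<theta> \<sigma> l u x B :: real and X L R :: "real \<Rightarrow> 'a \<Rightarrow> real"
  assumes lu: "l < u" and \<sigma>: "0 < \<sigma>"
    and sol: "reflected_sde_solution M \<F> W (\<lambda>y. \<theta> * f y) \<sigma> l u x X L R"
    and f_cont: "continuous_on {l..u} f" and f_bound: "\<And>y. y \<in> {l..u} \<Longrightarrow> \<bar>f y\<bar> \<le> B"
begin

lemma X_adapted: "0 \<le> t \<Longrightarrow> X t \<in> borel_measurable (\<F> t)"
  and X_range: "w \<in> space M \<Longrightarrow> 0 \<le> t \<Longrightarrow> X t w \<in> {l..u}"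
  and X_continuous: "w \<in> space M \<Longrightarrow> continuous_on {0..} (\<lambda>t. X t w)"
  and L_adapted: "0 \<le> t \<Longrightarrow> L t \<in> borel_measurable (\<F> t)"
  and L_continuous: "w \<in> space M \<Longrightarrow> continuous_on {0..} (\<lambda>t. L t w)"
  and L_mono: "w \<in> space M \<Longrightarrow> mono_on {0..} (\<lambda>t. L t w)"
  and R_adapted: "0 \<le> t \<Longrightarrow> R t \<in> borel_measurable (\<F> t)"
  and R_continuous: "w \<in> space M \<Longrightarrow> continuous_on {0..} (\<lambda>t. R t w)"
  and R_mono: "w \<in> space M \<Longrightarrow> mono_on {0..} (\<lambda>t. R t w)"
  using sol unfolding reflected_sde_solution_def regulator_def adapted_process_def continuous_process_def
  by blast+

lemma continuous_path:
  assumes "continuous_on {l..u} g" "w \<in> space M"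
  shows "continuous_on {0..} (\<lambda>t. g (X t w))"
  by (rule continuous_on_compose2[OF assms(1) X_continuous[OF assms(2)]]) (use X_range[OF assms(2)] in auto)

lemma bounded_integrand_path:
  assumes g: "continuous_on {l..u} g" and C: "\<And>y. y \<in> {l..u} \<Longrightarrow> \<bar>g y\<bar> \<le> C"
  shows "bounded_integrand M \<F> W (\<lambda>t w. g (X t w)) C"
proof
  fix t :: real assume t: "0 \<le> t"
  \<comment> \<open>\<open>g\<close> is controlled only on \<open>{l..u}\<close>, so measurability
    is obtained by viewing \<open>X t\<close> as a map into the restricted space.\<close>
  have "X t \<in> measurable (\<F> t) (restrict_space borel {l..u})"
    by (rule measurable_restrict_space2) (use X_adapted[OF t] X_range t space_\<F>[OF t] in auto)
  moreover have "g \<in> borel_measurable (restrict_space borel {l..u})"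
    by (rule borel_measurable_continuous_on_restrict[OF g])
  ultimately show "(\<lambda>w. g (X t w)) \<in> borel_measurable (\<F> t)" by (rule measurable_compose)
next
  show "continuous_on {0..} (\<lambda>t. g (X t w))" if "w \<in> space M" for w
    by (rule continuous_path[OF g that])
  show "\<bar>g (X t w)\<bar> \<le> C" if "0 \<le> t" "w \<in> space M" for t w
    using C X_range[OF that(2,1)] by blast
qed

sublocale f: bounded_integrand M \<F> W "\<lambda>t w. f (X t w)" B
  by (rule bounded_integrand_path[OF f_cont f_bound])

lemma AE_sde:
  "AE w in M. \<forall>t\<ge>0. X t w = x + integral {0..t} (\<lambda>s. \<theta> * f (X s w)) + \<sigma> * W t w + L t w - R t w"
proof -
  have "AE w in M. \<forall>t\<ge>0. X t w = x + (LINT s:{0..t}|lborel. \<theta> * f (X s w)) + \<sigma> * W t w + L t w - R t w"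
    using sol by (auto simp: reflected_sde_solution_def)
  with AE_space show ?thesis
  proof eventually_elim
    case (elim w)
    have "(LINT s:{0..t}|lborel. \<theta> * f (X s w)) = integral {0..t} (\<lambda>s. \<theta> * f (X s w))" for t
      by (intro LINT_eq_integral continuous_intros continuous_on_subset[OF f.H_continuous[OF elim(1)]]) auto
    with elim(2) show ?case by simp
  qed
qed

text \<open>One null set serves all intervals at once, as the argument along a single path
  requires.\<close>

lemma AE_flat_L: "AE w in M. \<forall>a b. 0 \<le> a \<longrightarrow> a \<le> b \<longrightarrow> (\<forall>s\<in>{a<..b}. X s w \<noteq> l) \<longrightarrow> L b w = L a w"
proof -
  have "AE w in M. (\<integral>\<^sup>+ t. indicator {t. 0 \<le> t \<and> X t w > l} t \<partial>stieltjes_measure (\<lambda>t. L t w)) = 0"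
    using sol by (auto simp: reflected_sde_solution_def)
  with AE_space show ?thesis
  proof eventually_elim
    case (elim w)
    show ?case
    proof (intro allI impI)
      fix a b :: real assume ab: "0 \<le> a" "a \<le> b" and ne: "\<forall>s\<in>{a<..b}. X s w \<noteq> l"
      show "L b w = L a w"
        by (rule stieltjes_flat[OF L_mono[OF elim(1)] L_continuous[OF elim(1)] elim(2) ab])
           (use ne ab X_range[OF elim(1)] in \<open>force simp: less_le\<close>)
    qed
  qed
qed

lemma AE_flat_R: "AE w in M. \<forall>a b. 0 \<le> a \<longrightarrow> a \<le> b \<longrightarrow> (\<forall>s\<in>{a<..b}. X s w \<noteq> u) \<longrightarrow> R b w = R a w"
proof -
  have "AE w in M. (\<integral>\<^sup>+ t. indicator {t. 0 \<le> t \<and> X t w < u} t \<partial>stieltjes_measure (\<lambda>t. R t w)) = 0"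
    using sol by (auto simp: reflected_sde_solution_def)
  with AE_space show ?thesis
  proof eventually_elim
    case (elim w)
    show ?case
    proof (intro allI impI)
      fix a b :: real assume ab: "0 \<le> a" "a \<le> b" and ne: "\<forall>s\<in>{a<..b}. X s w \<noteq> u"
      show "R b w = R a w"
        by (rule stieltjes_flat[OF R_mono[OF elim(1)] R_continuous[OF elim(1)] elim(2) ab])
           (use ne ab X_range[OF elim(1)] in \<open>force simp: less_le\<close>)
    qed
  qed
qed

text \<open>For \<open>h\<close> with \<open>h' = p\<close>, \<open>p l = p u = 0\<close>, Ito's formula has no boundary terms.\<close>

lemma Ito_formula_Neumann:
  assumes T: "0 < T"
    and h: "\<And>y. (h has_real_derivative p y) (at y)" and p: "\<And>y. (p has_real_derivative q y) (at y)"
    and q: "\<And>x y. x \<in> {l..u} \<Longrightarrow> y \<in> {l..u} \<Longrightarrow> \<bar>q x - q y\<bar> \<le> K * \<bar>x - y\<bar>" and K: "0 \<le> K"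
    and qcont: "continuous_on UNIV q" and pl: "p l = 0" and pu: "p u = 0"
    and Cp: "\<And>y. y \<in> {l..u} \<Longrightarrow> \<bar>p y\<bar> \<le> Cp"
  shows "AE w in M. \<sigma> * bounded_integrand.Ito M W (\<lambda>t w. p (X t w)) T w =
    h (X T w) - h (X 0 w) - integral {0..T} (\<lambda>s. p (X s w) * (\<theta> * f (X s w)) + \<sigma>\<^sup>2 / 2 * q (X s w))"
proof -
  have T0: "0 \<le> T" using T by simp
  have pc: "continuous_on {l..u} p" by (rule DERIV_continuous_on, rule has_field_derivative_at_within, rule p)
  have qc: "continuous_on {l..u} q" using continuous_on_subset[OF qcont] by auto
  obtain Cq where "Cq > 0" and Cq: "\<And>y. y \<in> {l..u} \<Longrightarrow> \<bar>q y\<bar> \<le> Cq"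
    using continuous_interval_bound[OF qc] by blast
  interpret p: bounded_integrand M \<F> W "\<lambda>t w. p (X t w)" Cp
    by (rule bounded_integrand_path[OF pc Cp])
  interpret q: bounded_integrand M \<F> W "\<lambda>t w. q (X t w)" Cq
    by (rule bounded_integrand_path[OF qc Cq])
  obtain r :: "nat \<Rightarrow> nat" where r: "strict_mono r" "AE w in M. (\<lambda>k. p.grid_integral_W T (r k) w) \<longlonglongrightarrow> p.Ito T w"
    by (rule p.Ito_AE_subseq[OF T0])
  have QV: "AE w in M. (\<lambda>k. \<Sum>i<2^k. 1 * ((W (grid T k (Suc i)) w - W (grid T k i) w)\<^sup>2 - T / 2^k)) \<longlonglongrightarrow> 0"
    by (rule AE_quadratic_variation[OF T, where C = 1]) auto
  have QVq: "AE w in M. (\<lambda>k. \<Sum>i<2^k. q (X (grid T k i) w) * ((W (grid T k (Suc i)) w - W (grid T k i) w)\<^sup>2 - T / 2^k)) \<longlonglongrightarrow> 0"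
    by (rule AE_quadratic_variation[OF T]) (auto intro!: q.H_adapted q.H_bounded grid_nonneg T0)
  from r(2) QV QVq AE_sde AE_flat_L AE_flat_R AE_space show ?thesis
  proof eventually_elim
    case (elim w)
    have "(\<lambda>k. \<Sum>i<2^k. p (X (grid T k i) w) * (\<sigma> * (W (grid T k (Suc i)) w - W (grid T k i) w)))
      \<longlonglongrightarrow> h (X T w) - h (X 0 w) - integral {0..T} (\<lambda>s. p (X s w) * (\<theta> * f (X s w)) + \<sigma>\<^sup>2 / 2 * q (X s w))"
    proof (rule deterministic_Ito[where L = "\<lambda>t. L t w" and R = "\<lambda>t. R t w" and l = l and u = u and K = K and ?X0.0 = x])
      show "continuous_on {0..T} (\<lambda>t. X t w)" "continuous_on {0..T} (\<lambda>t. W t w)"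
        "continuous_on {0..T} (\<lambda>s. \<theta> * f (X s w))"
        using elim(7) by (auto intro!: continuous_intros continuous_on_subset[OF X_continuous]
            continuous_on_subset[OF W_continuous] continuous_on_subset[OF f.H_continuous])
      show "mono_on {0..T} (\<lambda>t. L t w)" "mono_on {0..T} (\<lambda>t. R t w)"
        using L_mono[OF elim(7)] R_mono[OF elim(7)] by (auto simp: mono_on_def)
      show "X t w = x + integral {0..t} (\<lambda>s. \<theta> * f (X s w)) + \<sigma> * W t w + L t w - R t w" if "t \<in> {0..T}" for t
        using elim(4) that by simp
      show "X t w \<in> {l..u}" if "t \<in> {0..T}" for t using X_range[OF elim(7)] that by simp
      show "L b w = L a w" if "0 \<le> a" "a \<le> b" "b \<le> T" "\<forall>s\<in>{a<..b}. X s w \<noteq> l" for a b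
        using elim(5) that by blast
      show "R b w = R a w" if "0 \<le> a" "a \<le> b" "b \<le> T" "\<forall>s\<in>{a<..b}. X s w \<noteq> u" for a b
        using elim(6) that by blast
      show "(\<lambda>k. \<Sum>i<2 ^ k. (W (grid T k (Suc i)) w - W (grid T k i) w)\<^sup>2 - T / 2 ^ k) \<longlonglongrightarrow> 0"
        using elim(2) by (simp only: mult_1_left)
    qed (rule T0 h p q K qcont pl pu elim(3) | assumption)+
    then have "(\<lambda>k. \<sigma> * p.grid_integral_W T k w)
      \<longlonglongrightarrow> h (X T w) - h (X 0 w) - integral {0..T} (\<lambda>s. p (X s w) * (\<theta> * f (X s w)) + \<sigma>\<^sup>2 / 2 * q (X s w))"
      by (simp add: p.grid_integral_W_eq sum_distrib_left mult_ac)
    \<comment> \<open>The sums converge along all dyadic levels by the pathwise formula, and to the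
      Ito integral along \<open>r\<close>; the two limits agree.\<close>
    from LIMSEQ_subseq_LIMSEQ[OF this r(1)] tendsto_mult[OF tendsto_const elim(1), of \<sigma>]
    show ?case by (auto simp: o_def intro: LIMSEQ_unique)
  qed
qed

text \<open>After division by \<open>T\<close> the martingale part has second moment of order
  \<open>1 / T\<close>, and \<open>ky_fan_le_square\<close> with \<open>\<eta> = 1 / sqrt T\<close>
  turns this into the stated rate. The constant \<open>m\<close> is the one for which the Poisson
  equation is solvable.\<close>

lemma ergodic_bound:
  assumes fL: "\<And>x y. x \<in> {l..u} \<Longrightarrow> y \<in> {l..u} \<Longrightarrow> \<bar>f x - f y\<bar> \<le> Kf * \<bar>x - y\<bar>"
    and gL: "\<And>x y. x \<in> {l..u} \<Longrightarrow> y \<in> {l..u} \<Longrightarrow> \<bar>g x - g y\<bar> \<le> Kg * \<bar>x - y\<bar>"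
    and m: "m = integral {l..u} (\<lambda>y. g y * exp (2 * \<theta> / \<sigma>\<^sup>2 * integral {l..y} f)) /
                integral {l..u} (\<lambda>y. exp (2 * \<theta> / \<sigma>\<^sup>2 * integral {l..y} f))"
  shows "\<exists>K\<ge>0. \<forall>T\<ge>1. ky_fan M (\<lambda>w. integral {0..T} (\<lambda>t. g (X t w)) / T - m) \<le> K / sqrt T"
proof -
  \<comment> \<open>Clamping to \<open>{l..u}\<close> extends \<open>f\<close> and \<open>g\<close>
    continuously to the line, \<open>f\<close> with its Lipschitz constant, without changing them
    where \<open>X\<close> lives; nothing is known of them outside.\<close>
  define cl where "cl = (\<lambda>y. max l (min u y))"
  have cl: "cl y \<in> {l..u}" for y using lu by (auto simp: cl_def)
  have cl_id: "cl y = y" if "y \<in> {l..u}" for y using that by (auto simp: cl_def)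
  have clL: "\<bar>cl y - cl z\<bar> \<le> \<bar>y - z\<bar>" for y z by (auto simp: cl_def)
  have clc: "continuous_on UNIV cl" unfolding cl_def by (intro continuous_intros)
  have Kf: "0 \<le> Kf" using fL[of l u] lu by (smt (verit) atLeastAtMost_iff zero_le_mult_iff)
  have Kg: "0 \<le> Kg" using gL[of l u] lu by (smt (verit) atLeastAtMost_iff zero_le_mult_iff)
  have gc: "continuous_on {l..u} g"
    by (rule lipschitz_on_continuous_on[of Kg], rule lipschitz_onI) (use gL Kg in \<open>auto simp: dist_real_def\<close>)
  have intf: "integral {l..y} (\<lambda>z. f (cl z)) = integral {l..y} f" if "y \<in> {l..u}" for y
    by (rule Henstock_Kurzweil_Integration.integral_cong) (use that cl_id in auto)
  have m': "m = integral {l..u} (\<lambda>y. g (cl y) * exp (2 * \<theta> / \<sigma>\<^sup>2 * integral {l..y} (\<lambda>z. f (cl z)))) /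
                integral {l..u} (\<lambda>y. exp (2 * \<theta> / \<sigma>\<^sup>2 * integral {l..y} (\<lambda>z. f (cl z))))"
    unfolding m by (intro arg_cong2[where f = "(/)"] Henstock_Kurzweil_Integration.integral_cong) (simp_all add: intf cl_id)
  obtain h p q K where hpq:
    "\<And>y. (h has_real_derivative p y) (at y)" "\<And>y. (p has_real_derivative q y) (at y)"
    "continuous_on UNIV q" "0 \<le> K"
    "\<And>x y. x \<in> {l..u} \<Longrightarrow> y \<in> {l..u} \<Longrightarrow> \<bar>q x - q y\<bar> \<le> K * \<bar>x - y\<bar>"
    "p l = 0" "p u = 0" "\<And>y. p y * (\<theta> * f (cl y)) + \<sigma>\<^sup>2 / 2 * q y = g (cl y) - m"
  proof (rule Neumann_Poisson_equation[OF lu \<sigma> _ _ _ _ m'])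
    show "continuous_on UNIV (\<lambda>y. f (cl y))" "continuous_on UNIV (\<lambda>y. g (cl y))"
      by (auto intro!: continuous_on_compose2[OF f_cont clc] continuous_on_compose2[OF gc clc] simp: cl[simplified])
    show "\<bar>f (cl y) - f (cl z)\<bar> \<le> Kf * \<bar>y - z\<bar>" for y z
      using fL[OF cl cl, of y z] mult_left_mono[OF clL[of y z] Kf] by linarith
    show "\<bar>g (cl y) - g (cl z)\<bar> \<le> Kg * \<bar>y - z\<bar>" if "y \<in> {l..u}" "z \<in> {l..u}" for y z
      using gL[OF that] cl_id that by simp
  qed blast
  have pc: "continuous_on {l..u} p" by (rule DERIV_continuous_on, rule has_field_derivative_at_within, rule hpq(2))
  have hc: "continuous_on {l..u} h" by (rule DERIV_continuous_on, rule has_field_derivative_at_within, rule hpq(1))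
  obtain Cp where "Cp > 0" and Cp: "\<And>y. y \<in> {l..u} \<Longrightarrow> \<bar>p y\<bar> \<le> Cp" using continuous_interval_bound[OF pc] by blast
  obtain Ch where Ch: "Ch > 0" "\<And>y. y \<in> {l..u} \<Longrightarrow> \<bar>h y\<bar> \<le> Ch" using continuous_interval_bound[OF hc] by blast
  obtain Cg where "Cg > 0" and Cg: "\<And>y. y \<in> {l..u} \<Longrightarrow> \<bar>g y\<bar> \<le> Cg" using continuous_interval_bound[OF gc] by blast
  interpret p: bounded_integrand M \<F> W "\<lambda>t w. p (X t w)" Cp
    by (rule bounded_integrand_path[OF pc Cp])
  interpret g: bounded_integrand M \<F> W "\<lambda>t w. g (X t w)" Cg
    by (rule bounded_integrand_path[OF gc Cg])
  interpret h: bounded_integrand M \<F> W "\<lambda>t w. h (X t w)" Ch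
    by (rule bounded_integrand_path[OF hc Ch(2)])
  \<comment> \<open>The first term bounds the difference of two values of \<open>h\<close>, the
    second comes from Young's inequality for the martingale part.\<close>
  define K' where "K' = 2 * Ch + (1 + \<sigma>\<^sup>2 * Cp\<^sup>2) / 2"
  have "ky_fan M (\<lambda>w. integral {0..T} (\<lambda>t. g (X t w)) / T - m) \<le> K' / sqrt T" if T: "1 \<le> T" for T
  proof -
    have T0: "0 < T" "0 \<le> T" using T by auto
    note [measurable] = g.integral_measurable[OF T0(2)] p.Ito_spec(1)[OF T0(2)] h.H_measurable[OF T0(2)] h.H_measurable[of 0, simplified]
    have "AE w in M. \<sigma> * p.Ito T w =
      h (X T w) - h (X 0 w) - integral {0..T} (\<lambda>s. p (X s w) * (\<theta> * f (X s w)) + \<sigma>\<^sup>2 / 2 * q (X s w))"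
      by (rule Ito_formula_Neumann[OF T0(1) hpq(1,2,5,4,3,6,7) Cp])
    then have "AE w in M. integral {0..T} (\<lambda>t. g (X t w)) / T - m = (h (X T w) - h (X 0 w)) / T - \<sigma> / T * p.Ito T w"
      using AE_space
    proof eventually_elim
      case (elim w)
      have "integral {0..T} (\<lambda>s. p (X s w) * (\<theta> * f (X s w)) + \<sigma>\<^sup>2 / 2 * q (X s w)) = integral {0..T} (\<lambda>s. g (X s w) - m)"
      proof (rule Henstock_Kurzweil_Integration.integral_cong)
        fix s assume "s \<in> {0..T}"
        then have "X s w \<in> {l..u}" using X_range[OF elim(2)] by auto
        from cl_id[OF this] show "p (X s w) * (\<theta> * f (X s w)) + \<sigma>\<^sup>2 / 2 * q (X s w) = g (X s w) - m"
          using hpq(8)[of "X s w"] by simp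
      qed
      also have "\<dots> = integral {0..T} (\<lambda>s. g (X s w)) - integral {0..T} (\<lambda>s. m)"
        using continuous_on_subset[OF g.H_continuous[OF elim(2)], of "{0..T}"]
        by (intro Henstock_Kurzweil_Integration.integral_diff integrable_continuous_interval) auto
      finally have "\<sigma> * p.Ito T w = h (X T w) - h (X 0 w) - (integral {0..T} (\<lambda>s. g (X s w)) - m * T)"
        using elim(1) T0 by simp
      then have "integral {0..T} (\<lambda>s. g (X s w)) - m * T = h (X T w) - h (X 0 w) - \<sigma> * p.Ito T w" by simp
      moreover have "integral {0..T} (\<lambda>t. g (X t w)) / T - m = (integral {0..T} (\<lambda>s. g (X s w)) - m * T) / T"
        using T0 by (simp add: diff_divide_distrib)
      ultimately show ?case by (simp add: diff_divide_distrib)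
    qed
    then have "ky_fan M (\<lambda>w. integral {0..T} (\<lambda>t. g (X t w)) / T - m)
        = ky_fan M (\<lambda>w. (h (X T w) - h (X 0 w)) / T - \<sigma> / T * p.Ito T w)"
      by (intro ky_fan_cong_AE) auto
    also have "\<dots> \<le> ky_fan M (\<lambda>w. (h (X T w) - h (X 0 w)) / T) + ky_fan M (\<lambda>w. \<sigma> / T * p.Ito T w)"
      by (rule ky_fan_diff) auto
    also have "ky_fan M (\<lambda>w. (h (X T w) - h (X 0 w)) / T) \<le> 2 * Ch / sqrt T"
    proof -
      \<comment> \<open>The place where \<open>T \<ge> 1\<close> matters: a term of order
        \<open>1 / T\<close> is absorbed into \<open>1 / sqrt T\<close>.\<close>
      have sT: "sqrt T \<le> T" using T real_sqrt_le_mono[of T "T\<^sup>2"] by (simp add: power2_eq_square)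
      have "ky_fan M (\<lambda>w. (h (X T w) - h (X 0 w)) / T) \<le> (\<integral>w. 2 * Ch / T \<partial>M)"
        unfolding ky_fan_def
      proof (rule integral_mono[OF ky_fan_integrable])
        fix w assume "w \<in> space M"
        then have "\<bar>h (X T w)\<bar> \<le> Ch" "\<bar>h (X 0 w)\<bar> \<le> Ch" using Ch(2) X_range T0(2) by auto
        then have "\<bar>h (X T w) - h (X 0 w)\<bar> \<le> 2 * Ch" by linarith
        then have "\<bar>h (X T w) - h (X 0 w)\<bar> / T \<le> 2 * Ch / T" using T0 by (intro divide_right_mono) auto
        then show "min 1 \<bar>(h (X T w) - h (X 0 w)) / T\<bar> \<le> 2 * Ch / T" using T0 by (simp add: abs_divide)
      qed auto
      also have "\<dots> = 2 * Ch / T" by (simp add: prob_space)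
      also have "\<dots> \<le> 2 * Ch / sqrt T" using sT Ch(1) T0 by (intro divide_left_mono) auto
      finally show ?thesis .
    qed
    also have "ky_fan M (\<lambda>w. \<sigma> / T * p.Ito T w) \<le> (1 + \<sigma>\<^sup>2 * Cp\<^sup>2) / 2 / sqrt T"
    proof -
      have sq: "integrable M (\<lambda>w. (\<sigma> / T * p.Ito T w)\<^sup>2)"
        unfolding power_mult_distrib using p.Ito_square(1)[OF T0(1)] by simp
      have "expectation (\<lambda>w. (\<sigma> / T * p.Ito T w)\<^sup>2) \<le> (\<sigma> / T)\<^sup>2 * (Cp\<^sup>2 * T)"
        unfolding power_mult_distrib using p.Ito_square[OF T0(1)] by (simp add: mult_left_mono)
      also have "\<dots> = \<sigma>\<^sup>2 * Cp\<^sup>2 / T" using T0 by (simp add: power2_eq_square)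
      finally have e: "expectation (\<lambda>w. (\<sigma> / T * p.Ito T w)\<^sup>2) \<le> \<sigma>\<^sup>2 * Cp\<^sup>2 / T" .
      have "ky_fan M (\<lambda>w. \<sigma> / T * p.Ito T w)
          \<le> (1 / sqrt T) / 2 + expectation (\<lambda>w. (\<sigma> / T * p.Ito T w)\<^sup>2) / (2 * (1 / sqrt T))"
        using T0 by (intro ky_fan_le_square sq) auto
      also have "\<dots> \<le> (1 / sqrt T) / 2 + (\<sigma>\<^sup>2 * Cp\<^sup>2 / T) / (2 * (1 / sqrt T))"
        using e T0 by (intro add_left_mono divide_right_mono) auto
      also have "\<dots> = (1 + \<sigma>\<^sup>2 * Cp\<^sup>2) / 2 / sqrt T"
      proof -
        have "(c / (r * r)) / (2 * (1 / r)) = c / 2 / r" if "r > 0" for c r :: real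
          using that by (simp add: field_simps)
        from this[of "sqrt T" "\<sigma>\<^sup>2 * Cp\<^sup>2"] T0
        have "(\<sigma>\<^sup>2 * Cp\<^sup>2 / T) / (2 * (1 / sqrt T)) = \<sigma>\<^sup>2 * Cp\<^sup>2 / 2 / sqrt T" by simp
        then show ?thesis by (simp add: add_divide_distrib)
      qed
      finally show ?thesis .
    qed
    finally show ?thesis by (simp add: K'_def add_divide_distrib)
  qed
  moreover have "0 \<le> K'" using Ch by (simp add: K'_def)
  ultimately show ?thesis by blast
qed

section \<open>The numerator of the estimator\<close>

definition Y :: "real \<Rightarrow> 'a \<Rightarrow> real" where "Y = (\<lambda>t w. X t w - L t w + R t w)"

lemma Y_measurable: "0 \<le> t \<Longrightarrow> Y t \<in> borel_measurable M"
  unfolding Y_def using X_adapted L_adapted R_adapted measurable_\<F>_M[of t]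
  by (intro borel_measurable_add borel_measurable_diff) auto

lemma f_square_integrand: "bounded_integrand M \<F> W (\<lambda>t w. (f (X t w))\<^sup>2) (B\<^sup>2)"
proof (rule bounded_integrand_path)
  show "continuous_on {l..u} (\<lambda>y. (f y)\<^sup>2)" by (intro continuous_intros f_cont)
  show "\<bar>(f y)\<^sup>2\<bar> \<le> B\<^sup>2" if "y \<in> {l..u}" for y
    using f_bound[OF that] by (metis abs_ge_zero power2_abs power_mono abs_power2)
qed

text \<open>The candidate suggested by the equation: \<open>Y\<close> has the regulators removed, so
  its differential is \<open>\<theta> f dt + \<sigma> dW\<close>.\<close>

definition fY_integral :: "real \<Rightarrow> 'a \<Rightarrow> real" where
  "fY_integral T w = \<theta> * integral {0..T} (\<lambda>t. (f (X t w))\<^sup>2) + \<sigma> * f.Ito T w"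

lemma fY_integral_measurable: "0 \<le> T \<Longrightarrow> fY_integral T \<in> borel_measurable M"
  unfolding fY_integral_def[abs_def]
  using bounded_integrand.integral_measurable[OF f_square_integrand] f.Ito_spec(1) by measurable

text \<open>Off the bad event the coefficient of every cell of positive length is within
  \<open>\<epsilon>\<close> of \<open>f (X s w)\<close> there, so replacing one by the other under
  the integral costs at most \<open>\<epsilon>\<close> times the bound
  \<open>\<bar>\<theta>\<bar> * B\<close> per unit of time.\<close>

lemma drift_sum_bound:
  assumes S: "simple_integrand \<F> T n \<tau> \<xi>" and w: "w \<in> space M" "w \<notin> f.bad T n \<tau> \<xi> \<epsilon>" and T: "0 \<le> T" and \<epsilon>: "\<epsilon> > 0"
  shows "\<bar>(\<Sum>i<n. \<xi> i w * integral {\<tau> i..\<tau> (Suc i)} (\<lambda>s. \<theta> * f (X s w))) - \<theta> * integral {0..T} (\<lambda>s. (f (X s w))\<^sup>2)\<bar>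
    \<le> \<epsilon> * (\<bar>\<theta>\<bar> * B * T)"
proof -
  let ?I = "\<lambda>i. {\<tau> i..\<tau> (Suc i)}" and ?\<psi> = "\<lambda>s. \<theta> * f (X s w)"
  have ends: "\<tau> 0 = 0" "\<tau> n = T" and mono: "\<And>i. i < n \<Longrightarrow> \<tau> i \<le> \<tau> (Suc i)"
    using S by (auto simp: simple_integrand_def)
  have fc: "continuous_on S (\<lambda>s. f (X s w))" if "S \<subseteq> {0..}" for S
    using continuous_on_subset[OF f.H_continuous[OF w(1)] that] .
  have sub: "?I i \<subseteq> {0..}" if "i < n" for i using simple_integrand_bounds[OF S, of i] that by auto
  have "B \<ge> 0" using f_bound[of l] lu by force
  have cell: "\<bar>\<xi> i w * integral (?I i) ?\<psi> - integral (?I i) (\<lambda>s. f (X s w) * ?\<psi> s)\<bar> \<le> \<epsilon> * (\<bar>\<theta>\<bar> * B) * (\<tau> (Suc i) - \<tau> i)"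
    if i: "i < n" for i
  proof (cases "\<tau> i = \<tau> (Suc i)")
    case False
    then have lt: "\<tau> i < \<tau> (Suc i)" using mono[OF i] by simp
    \<comment> \<open>The bad event speaks of half-open cells; continuity of the path carries the
      estimate to the left end.\<close>
    have close: "\<bar>\<xi> i w - f (X s w)\<bar> \<le> \<epsilon>" if s: "s \<in> ?I i" for s
    proof (rule continuous_le_on_closure[where x = s and f = "\<lambda>s. \<bar>\<xi> i w - f (X s w)\<bar>"])
      show "continuous_on (closure {\<tau> i<..\<tau> (Suc i)}) (\<lambda>s. \<bar>\<xi> i w - f (X s w)\<bar>)"
        using lt sub[OF i] by (intro continuous_intros fc) (auto simp: closure_greaterThanAtMost)
      show "s \<in> closure {\<tau> i<..\<tau> (Suc i)}" using lt s by (auto simp: closure_greaterThanAtMost)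
      fix t assume t: "t \<in> {\<tau> i<..\<tau> (Suc i)}"
      then have "t \<in> {0<..T}" using simple_integrand_bounds[OF S, of i] simple_integrand_bounds[OF S, of "Suc i"] i by auto
      then have "\<bar>simple_value n \<tau> \<xi> t w - f (X t w)\<bar> \<le> \<epsilon>"
        using w by (auto simp: f.bad_def not_less)
      then show "\<bar>\<xi> i w - f (X t w)\<bar> \<le> \<epsilon>" by (simp only: simple_value_eq[OF S i t])
    qed
    have "\<xi> i w * integral (?I i) ?\<psi> - integral (?I i) (\<lambda>s. f (X s w) * ?\<psi> s) = integral (?I i) (\<lambda>s. (\<xi> i w - f (X s w)) * ?\<psi> s)"
      using fc[OF sub[OF i]]
      by (simp add: left_diff_distrib Henstock_Kurzweil_Integration.integral_diff integrable_continuous_interval continuous_on_mult continuous_on_const)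
    also have "norm \<dots> \<le> \<epsilon> * (\<bar>\<theta>\<bar> * B) * (\<tau> (Suc i) - \<tau> i)"
    proof (rule integral_bound)
      fix s assume s: "s \<in> ?I i"
      have "\<bar>f (X s w)\<bar> \<le> B" using f.H_bounded[OF _ w(1)] sub[OF i] s by auto
      then show "norm ((\<xi> i w - f (X s w)) * ?\<psi> s) \<le> \<epsilon> * (\<bar>\<theta>\<bar> * B)"
        using close[OF s] \<epsilon> by (auto simp: abs_mult intro!: mult_mono)
    qed (use lt in \<open>auto intro!: continuous_intros fc[OF sub[OF i]]\<close>)
    finally show ?thesis by simp
  qed simp
  have int2: "(\<lambda>s. f (X s w) * ?\<psi> s) integrable_on {\<tau> 0..\<tau> n}"
    unfolding ends by (intro integrable_continuous_interval continuous_intros fc) auto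
  have "\<theta> * integral {0..T} (\<lambda>s. (f (X s w))\<^sup>2) = integral {0..T} (\<lambda>s. f (X s w) * ?\<psi> s)"
    by (simp add: power2_eq_square mult_ac flip: integral_mult_right)
  also have "\<dots> = (\<Sum>i<n. integral (?I i) (\<lambda>s. f (X s w) * ?\<psi> s))"
    using partition_integral[of n \<tau>, OF mono int2] ends by simp
  finally have "\<bar>(\<Sum>i<n. \<xi> i w * integral (?I i) ?\<psi>) - \<theta> * integral {0..T} (\<lambda>s. (f (X s w))\<^sup>2)\<bar>
     = \<bar>\<Sum>i<n. \<xi> i w * integral (?I i) ?\<psi> - integral (?I i) (\<lambda>s. f (X s w) * ?\<psi> s)\<bar>"
    by (simp add: sum_subtractf)
  also have "\<dots> \<le> (\<Sum>i<n. \<epsilon> * (\<bar>\<theta>\<bar> * B) * (\<tau> (Suc i) - \<tau> i))"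
    by (intro order_trans[OF sum_abs] sum_mono cell) simp
  also have "\<dots> = \<epsilon> * (\<bar>\<theta>\<bar> * B) * (\<tau> n - \<tau> 0)"
    by (simp add: sum_lessThan_telescope flip: sum_distrib_left)
  finally show ?thesis by (simp add: ends mult_ac)
qed

text \<open>The exceptional set is that of the equation itself, which is why the quantifier over all
  simple integrands may stand inside.\<close>

lemma AE_simple_integral_Y:
  "AE w in M. \<forall>n \<tau> \<xi>. simple_integrand \<F> T n \<tau> \<xi> \<longrightarrow> simple_integral n \<tau> \<xi> Y w =
     (\<Sum>i<n. \<xi> i w * integral {\<tau> i..\<tau> (Suc i)} (\<lambda>s. \<theta> * f (X s w))) + \<sigma> * simple_integral n \<tau> \<xi> W w"
  using AE_sde AE_space
proof eventually_elim
  case (elim w)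
  show ?case
  proof (intro allI impI)
    fix n \<tau> \<xi> assume S: "simple_integrand \<F> T n \<tau> (\<xi> :: nat \<Rightarrow> 'a \<Rightarrow> real)"
    have "Y (\<tau> (Suc i)) w - Y (\<tau> i) w = integral {\<tau> i..\<tau> (Suc i)} (\<lambda>s. \<theta> * f (X s w)) + \<sigma> * (W (\<tau> (Suc i)) w - W (\<tau> i) w)"
      if i: "i < n" for i
    proof -
      have b: "0 \<le> \<tau> i" "\<tau> i \<le> \<tau> (Suc i)"
        using simple_integrand_bounds[OF S, of i] S i by (auto simp: simple_integrand_def)
      have "integral {0..\<tau> i} (\<lambda>s. \<theta> * f (X s w)) + integral {\<tau> i..\<tau> (Suc i)} (\<lambda>s. \<theta> * f (X s w)) = integral {0..\<tau> (Suc i)} (\<lambda>s. \<theta> * f (X s w))"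
        by (intro Henstock_Kurzweil_Integration.integral_combine b integrable_continuous_interval
            continuous_intros continuous_on_subset[OF f.H_continuous[OF elim(2)]]) auto
      then show ?thesis using elim(1)[rule_format, of "\<tau> i"] elim(1)[rule_format, of "\<tau> (Suc i)"] b
        by (simp add: Y_def algebra_simps)
    qed
    note eq = this
    show "simple_integral n \<tau> \<xi> Y w =
     (\<Sum>i<n. \<xi> i w * integral {\<tau> i..\<tau> (Suc i)} (\<lambda>s. \<theta> * f (X s w))) + \<sigma> * simple_integral n \<tau> \<xi> W w"
      unfolding simple_integral_def sum_distrib_left sum.distrib[symmetric]
    proof (intro sum.cong refl)
      fix i assume i: "i \<in> {..<n}"
      show "\<xi> i w * (Y (\<tau> (Suc i)) w - Y (\<tau> i) w) = \<xi> i w * integral {\<tau> i..\<tau> (Suc i)} (\<lambda>s. \<theta> * f (X s w))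
          + \<sigma> * (\<xi> i w * (W (\<tau> (Suc i)) w - W (\<tau> i) w))"
        by (subst eq) (use i in \<open>auto simp: ring_distribs mult_ac\<close>)
    qed
  qed
qed

lemma simple_integral_Y_tendsto:
  assumes T: "0 \<le> T" and S: "\<And>k::nat. simple_integrand \<F> T (n k) (\<tau> k) (\<xi> k)"
    and bad: "\<And>\<epsilon>. \<epsilon> > 0 \<Longrightarrow> (\<lambda>k. prob (f.bad T (n k) (\<tau> k) (\<xi> k) \<epsilon>)) \<longlonglongrightarrow> 0"
  shows "(\<lambda>k. ky_fan M (\<lambda>w. simple_integral (n k) (\<tau> k) (\<xi> k) Y w - fY_integral T w)) \<longlonglongrightarrow> 0"
proof (rule tendstoI)
  fix e :: real assume e: "e > 0"
  have SYM[measurable]: "simple_integral (n k) (\<tau> k) (\<xi> k) Y \<in> borel_measurable M" for k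
    by (rule f.simple_integral_measurable[OF S]) (rule Y_measurable)
  have SWM[measurable]: "simple_integral (n k) (\<tau> k) (\<xi> k) W \<in> borel_measurable M" for k
    by (rule f.simple_integral_measurable[OF S]) (rule W_measurable)
  note [measurable] = fY_integral_measurable[OF T] f.Ito_spec(1)[OF T]
  let ?D = "\<lambda>k w. simple_integral (n k) (\<tau> k) (\<xi> k) W w - f.Ito T w"
  \<comment> \<open>The error of the drift part alone, after the martingale error has been taken
    off.\<close>
  let ?E = "\<lambda>k w. simple_integral (n k) (\<tau> k) (\<xi> k) Y w - fY_integral T w - \<sigma> * ?D k w"
  have B0: "0 \<le> B" using f_bound[of l] lu by force
  define c where "c = \<bar>\<theta>\<bar> * B * T"
  have c: "0 \<le> c" using B0 T by (simp add: c_def)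
  define d where "d = c + 1"
  have d: "d > 0" using c by (simp add: d_def)
  define \<epsilon> where "\<epsilon> = e / (3 * d)"
  have \<epsilon>: "\<epsilon> > 0" using e d by (simp add: \<epsilon>_def)
  have \<epsilon>c: "\<epsilon> * c < e / 3"
  proof -
    have "\<epsilon> * d = e / 3" using d by (simp add: \<epsilon>_def)
    then show ?thesis using \<epsilon> by (simp add: d_def distrib_left)
  qed
  have E: "ky_fan M (?E k) \<le> prob (f.bad T (n k) (\<tau> k) (\<xi> k) \<epsilon>) + \<epsilon> * c" for k
  proof -
    have "ky_fan M (?E k) \<le> prob (f.bad T (n k) (\<tau> k) (\<xi> k) \<epsilon>) + ky_fan M (\<lambda>_. \<epsilon> * c)"
    proof (rule ky_fan_off_event)
      show "AE w in M. w \<notin> f.bad T (n k) (\<tau> k) (\<xi> k) \<epsilon> \<longrightarrow> \<bar>?E k w\<bar> \<le> \<bar>\<epsilon> * c\<bar>"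
        using AE_simple_integral_Y[of T] AE_space
      proof eventually_elim
        case (elim w)
        have "?E k w = (\<Sum>i<n k. \<xi> k i w * integral {\<tau> k i..\<tau> k (Suc i)} (\<lambda>s. \<theta> * f (X s w))) - \<theta> * integral {0..T} (\<lambda>s. (f (X s w))\<^sup>2)"
          using elim(1)[rule_format, OF S[of k]] by (simp add: fY_integral_def algebra_simps)
        then show ?case
          using drift_sum_bound[OF S[of k] elim(2) _ T \<epsilon>] by (auto simp: c_def)
      qed
    qed (use f.bad_event[OF S] in auto)
    also have "ky_fan M (\<lambda>_. \<epsilon> * c) \<le> \<epsilon> * c" using \<epsilon> c by (simp add: ky_fan_def prob_space)
    finally show ?thesis by simp
  qed
  have "\<forall>\<^sub>F k in sequentially. prob (f.bad T (n k) (\<tau> k) (\<xi> k) \<epsilon>) < e / 3"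
    using bad[OF \<epsilon>] e by (intro order_tendstoD(2)[where y = 0]) auto
  moreover have "(\<lambda>k. (1 + \<bar>\<sigma>\<bar>) * ky_fan M (?D k)) \<longlonglongrightarrow> 0"
    using tendsto_mult_right_zero[OF f.simple_integral_tendsto_Ito[OF T S bad]] by blast
  then have "\<forall>\<^sub>F k in sequentially. (1 + \<bar>\<sigma>\<bar>) * ky_fan M (?D k) < e / 3"
    using e by (intro order_tendstoD(2)[where y = 0]) auto
  ultimately show "\<forall>\<^sub>F k in sequentially. dist (ky_fan M (\<lambda>w. simple_integral (n k) (\<tau> k) (\<xi> k) Y w - fY_integral T w)) 0 < e"
  proof eventually_elim
    case (elim k)
    have "ky_fan M (\<lambda>w. simple_integral (n k) (\<tau> k) (\<xi> k) Y w - fY_integral T w) \<le> ky_fan M (?E k) + ky_fan M (\<lambda>w. \<sigma> * ?D k w)"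
      using ky_fan_add[of "?E k" "\<lambda>w. \<sigma> * ?D k w"] by simp
    also have "ky_fan M (\<lambda>w. \<sigma> * ?D k w) \<le> (1 + \<bar>\<sigma>\<bar>) * ky_fan M (?D k)"
      by (rule ky_fan_cmult) auto
    finally show ?case using E[of k] \<epsilon>c elim ky_fan_nonneg by (simp add: dist_real_def)
  qed
qed

text \<open>Existence of an integral, which gives the \<open>SOME\<close> in
  \<open>stochastic_integral\<close> a meaning.\<close>

lemma is_stochastic_integral_fY:
  assumes T: "0 \<le> T"
  shows "is_stochastic_integral M \<F> (\<lambda>t w. f (X t w)) Y T (fY_integral T)"
  unfolding is_stochastic_integral_def
proof (intro conjI allI impI)
  show "fY_integral T \<in> borel_measurable M" by (rule fY_integral_measurable[OF T])
  fix n \<tau> \<xi> and \<epsilon> :: real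
  assume S: "\<forall>k. simple_integrand \<F> T (n k) (\<tau> k) (\<xi> k)"
    and "\<forall>\<epsilon>>0. (\<lambda>k. prob {w \<in> space M. \<exists>s\<in>{0<..T}. \<epsilon> < \<bar>simple_value (n k) (\<tau> k) (\<xi> k) s w - f (X s w)\<bar>}) \<longlonglongrightarrow> 0"
    and \<epsilon>: "0 < \<epsilon>"
  then have bad: "(\<lambda>k. prob (f.bad T (n k) (\<tau> k) (\<xi> k) \<epsilon>)) \<longlonglongrightarrow> 0" if "\<epsilon> > 0" for \<epsilon>
    using that by (auto simp: f.bad_def)
  have SYM: "simple_integral (n k) (\<tau> k) (\<xi> k) Y \<in> borel_measurable M" for k
    using S by (intro f.simple_integral_measurable Y_measurable) auto
  have "(\<lambda>k. ky_fan M (\<lambda>w. simple_integral (n k) (\<tau> k) (\<xi> k) Y w - fY_integral T w)) \<longlonglongrightarrow> 0"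
    using S bad by (intro simple_integral_Y_tendsto[OF T]) auto
  then show "(\<lambda>k. prob {w \<in> space M. \<epsilon> < \<bar>simple_integral (n k) (\<tau> k) (\<xi> k) Y w - fY_integral T w\<bar>}) \<longlonglongrightarrow> 0"
    using conv_prob_iff_ky_fan[of "\<lambda>k w. simple_integral (n k) (\<tau> k) (\<xi> k) Y w - fY_integral T w"]
      SYM fY_integral_measurable[OF T] \<epsilon> by auto
qed

text \<open>Uniqueness: whatever \<open>SOME\<close> picks must also be the limit of the dyadic
  sums, and limits in probability agree almost surely.\<close>

lemma stochastic_integral_fY:
  assumes T: "0 \<le> T"
  defines "Z \<equiv> stochastic_integral M \<F> (\<lambda>t w. f (X t w)) (\<lambda>t w. X t w - L t w + R t w) T"
  shows "Z \<in> borel_measurable M" "AE w in M. Z w = fY_integral T w"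
proof -
  have Z: "is_stochastic_integral M \<F> (\<lambda>t w. f (X t w)) Y T Z"
    unfolding Z_def stochastic_integral_def Y_def[symmetric]
    by (rule someI[where P = "is_stochastic_integral M \<F> (\<lambda>t w. f (X t w)) Y T"]) (rule is_stochastic_integral_fY[OF T])
  then show ZM: "Z \<in> borel_measurable M" by (simp add: is_stochastic_integral_def)
  let ?S = "\<lambda>k. simple_integral (2^k) (grid T k) (\<lambda>i w. f (X (grid T k i) w)) Y"
  note gs = f.grid_simple_integrand[OF T] and gb = f.prob_bad_grid_tendsto_0[OF T]
  have SM: "?S k \<in> borel_measurable M" for k
    by (intro f.simple_integral_measurable[OF gs] Y_measurable)
  have "\<forall>\<epsilon>>0. (\<lambda>k. prob {w \<in> space M. \<epsilon> < \<bar>?S k w - Z w\<bar>}) \<longlonglongrightarrow> 0"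
    using Z[unfolded is_stochastic_integral_def, THEN conjunct2, rule_format, of "\<lambda>k. 2^k" "grid T" "\<lambda>k i w. f (X (grid T k i) w)"] gs gb
    by (simp add: f.bad_def)
  then have "(\<lambda>k. ky_fan M (\<lambda>w. ?S k w - Z w)) \<longlonglongrightarrow> 0"
    using conv_prob_iff_ky_fan[of "\<lambda>k w. ?S k w - Z w"] SM ZM by auto
  then show "AE w in M. Z w = fY_integral T w"
    using simple_integral_Y_tendsto[OF T gs gb] by (intro ky_fan_limit_unique[OF SM ZM fY_integral_measurable[OF T]])
qed

end

section \<open>Asymptotic normality\<close>

text \<open>Truncated at 1 to match \<open>ky_fan\<close>: the exponential is 1-Lipschitz, and two
  points of the unit circle are at most 2 apart.\<close>

lemma norm_iexp_diff_le: "norm (iexp a - iexp b) \<le> 2 * min 1 \<bar>a - b\<bar>"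
proof -
  have "iexp a - iexp b = iexp b * (iexp (a - b) - 1)"
    by (simp add: right_diff_distrib flip: exp_add)
  then have "norm (iexp a - iexp b) = norm (iexp (a - b) - 1)" by (simp add: norm_mult)
  moreover have "norm (iexp (a - b) - 1) \<le> \<bar>a - b\<bar>" using iexp_approx1[of "a - b" 0] by simp
  moreover have "norm (iexp (a - b) - 1) \<le> 2" using norm_triangle_ineq4[of "iexp (a - b)" 1] by simp
  ultimately show ?thesis unfolding min_def by (smt (verit) abs_ge_zero)
qed

lemma (in prob_space) char_diff_le_ky_fan:
  assumes [measurable]: "A \<in> borel_measurable M" "B \<in> borel_measurable M"
  shows "norm (expectation (\<lambda>w. iexp (t * A w)) - expectation (\<lambda>w. iexp (t * B w)))
    \<le> 2 * ((1 + \<bar>t\<bar>) * ky_fan M (\<lambda>w. A w - B w))"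
proof -
  have i: "integrable M (\<lambda>w. iexp (t * C w))" if [measurable]: "C \<in> borel_measurable M" for C
    by (rule integrable_const_bound[where B = 1]) auto
  have "norm (expectation (\<lambda>w. iexp (t * A w)) - expectation (\<lambda>w. iexp (t * B w)))
    = norm (expectation (\<lambda>w. iexp (t * A w) - iexp (t * B w)))"
    by (subst Bochner_Integration.integral_diff[OF i i]) auto
  also have "\<dots> \<le> expectation (\<lambda>w. norm (iexp (t * A w) - iexp (t * B w)))"
    by (rule integral_norm_bound)
  also have "\<dots> \<le> expectation (\<lambda>w. 2 * min 1 \<bar>t * (A w - B w)\<bar>)"
  proof (intro integral_mono integrable_norm Bochner_Integration.integrable_diff i integrable_mult_right ky_fan_integrable)
    show "norm (iexp (t * A w) - iexp (t * B w)) \<le> 2 * min 1 \<bar>t * (A w - B w)\<bar>" for w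
      using norm_iexp_diff_le[of "t * A w" "t * B w"] by (simp only: right_diff_distrib)
  qed auto
  also have "\<dots> = 2 * ky_fan M (\<lambda>w. t * (A w - B w))" by (simp add: ky_fan_def)
  also have "\<dots> \<le> 2 * ((1 + \<bar>t\<bar>) * ky_fan M (\<lambda>w. A w - B w))"
    by (intro mult_left_mono ky_fan_cmult) auto
  finally show ?thesis .
qed

lemma char_normal_density:
  assumes s: "0 < s"
  shows "char (density lborel (\<lambda>z. ennreal (normal_density 0 s z))) t = complex_of_real (exp (- (t * s)\<^sup>2 / 2))"
proof -
  interpret std: prob_space std_normal_distribution
    using real_dist_normal_dist by (simp add: real_distribution_def)
  have "distributed std_normal_distribution lborel (\<lambda>x. x) std_normal_density"
    unfolding distributed_def by (auto simp: distr_id2)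
  from std.normal_density_affine[OF this, of s 0] s
  have "distributed std_normal_distribution lborel (\<lambda>x. s * x) (normal_density 0 s)" by simp
  from distributed_distr_eq_density[OF this]
  have "density lborel (\<lambda>z. ennreal (normal_density 0 s z)) = distr std_normal_distribution borel (\<lambda>x. s * x)"
    by (simp cong: distr_cong)
  then have "char (density lborel (\<lambda>z. ennreal (normal_density 0 s z))) t = char std_normal_distribution (t * s)"
    unfolding char_def by (simp add: integral_distr mult_ac)
  then show ?thesis by (simp add: char_std_normal_distribution)
qed

lemma real_distribution_normal_density:
  "0 < s \<Longrightarrow> real_distribution (density lborel (\<lambda>z. ennreal (normal_density 0 s z)))"
  using prob_space_normal_density by (auto simp: real_distribution_def real_distribution_axioms_def)

context reflected_diffusion
begin

lemma f_square_integral_bounds: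
  assumes "0 \<le> T" "w \<in> space M"
  shows "0 \<le> integral {0..T} (\<lambda>t. (f (X t w))\<^sup>2)" "integral {0..T} (\<lambda>t. (f (X t w))\<^sup>2) \<le> B\<^sup>2 * T"
proof -
  interpret q: bounded_integrand M \<F> W "\<lambda>t w. (f (X t w))\<^sup>2" "B\<^sup>2" by (rule f_square_integrand)
  have c: "continuous_on {0..T} (\<lambda>t. (f (X t w))\<^sup>2)" by (rule continuous_on_subset[OF q.H_continuous[OF assms(2)]]) auto
  show "0 \<le> integral {0..T} (\<lambda>t. (f (X t w))\<^sup>2)"
    by (intro integral_nonneg integrable_continuous_interval c) auto
  have "norm (integral {0..T} (\<lambda>t. (f (X t w))\<^sup>2)) \<le> B\<^sup>2 * (T - 0)"
    by (rule integral_bound[OF assms(1) c]) (use q.H_bounded[OF _ assms(2)] in auto)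
  then show "integral {0..T} (\<lambda>t. (f (X t w))\<^sup>2) \<le> B\<^sup>2 * T" by simp
qed

text \<open>The exponential martingale turns the law of large numbers for the quadratic variation into
  convergence of characteristic functions.\<close>

lemma Ito_char_bound:
  fixes t :: real
  assumes T: "1 \<le> T" and F: "0 \<le> F"
  defines "c \<equiv> t\<^sup>2 / 2" and "D \<equiv> max F (B\<^sup>2)"
  shows "norm (expectation (\<lambda>w. iexp (t * (f.Ito T w / sqrt T))) - complex_of_real (exp (- c * F)))
    \<le> c * exp (c * D) * (1 + D) * ky_fan M (\<lambda>w. integral {0..T} (\<lambda>s. (f (X s w))\<^sup>2) / T - F)"
proof -
  have T0: "0 < T" "0 \<le> T" using T by auto
  let ?V = "\<lambda>w. integral {0..T} (\<lambda>s. (f (X s w))\<^sup>2) / T"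
  let ?e = "\<lambda>w. iexp (t * (f.Ito T w / sqrt T))"
  note [measurable] = bounded_integrand.integral_measurable[OF f_square_integrand T0(2)] f.Ito_spec(1)[OF T0(2)]
  have c: "0 \<le> c" by (simp add: c_def)
  have D: "0 \<le> D" using F by (simp add: D_def)
  have V: "0 \<le> ?V w" "?V w \<le> D" if "w \<in> space M" for w
    using f_square_integral_bounds[OF T0(2) that] T0 by (auto simp: D_def field_simps le_max_iff_disj)
  have kap: "(t / sqrt T)\<^sup>2 / 2 * integral {0..T} (\<lambda>s. (f (X s w))\<^sup>2) = c * ?V w" for w
    using T0 by (simp add: c_def power_divide)
  have one: "expectation (\<lambda>w. ?e w * complex_of_real (exp (c * ?V w))) = 1"
    using f.Ito_exponential[OF T0(1), of "t / sqrt T"] unfolding kap by (simp add: mult_ac)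
  have ie: "integrable M ?e" by (rule integrable_const_bound[where B = 1]) auto
  have ieV: "integrable M (\<lambda>w. ?e w * complex_of_real (exp (c * ?V w)))"
  proof (rule integrable_const_bound[where B = "exp (c * D)"])
    show "AE w in M. norm (?e w * complex_of_real (exp (c * ?V w))) \<le> exp (c * D)"
      using AE_space
    proof eventually_elim
      case (elim w)
      have "c * ?V w \<le> c * D" by (rule mult_left_mono[OF V(2)[OF elim] c])
      then show ?case by (simp add: norm_mult)
    qed
  qed measurable
  \<comment> \<open>Mean value inequality on \<open>{0..D}\<close>. Both \<open>v\<close> and
    \<open>F\<close> lie there, so their distance is at most \<open>D\<close>, and truncating it
    costs the factor \<open>1 + D\<close>.\<close>
  have exp_lip: "\<bar>exp (c * F) - exp (c * v)\<bar> \<le> c * exp (c * D) * (1 + D) * min 1 \<bar>v - F\<bar>" if v: "0 \<le> v" "v \<le> D" for v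
  proof -
    have "norm (exp (c * F) - exp (c * v)) \<le> c * exp (c * D) * norm (F - v)"
    proof (rule field_differentiable_bound[of "{0..D}" "\<lambda>y. exp (c * y)" "\<lambda>y. c * exp (c * y)"])
      show "((\<lambda>y. exp (c * y)) has_field_derivative c * exp (c * y)) (at y within {0..D})" for y
        by (auto intro!: derivative_eq_intros)
      show "norm (c * exp (c * y)) \<le> c * exp (c * D)" if "y \<in> {0..D}" for y
        using that c by (auto simp: abs_mult intro!: mult_left_mono)
    qed (use v F in \<open>auto simp: D_def\<close>)
    also have "\<dots> \<le> c * exp (c * D) * ((1 + D) * min 1 \<bar>v - F\<bar>)"
    proof (rule mult_left_mono)
      have "\<bar>v - F\<bar> \<le> D" using v F by (auto simp: D_def abs_if)
      then show "norm (F - v) \<le> (1 + D) * min 1 \<bar>v - F\<bar>"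
        using D by (cases "\<bar>v - F\<bar> \<le> 1") (auto simp: abs_minus_commute algebra_simps)
    qed (use c in auto)
    finally show ?thesis by (simp add: mult_ac)
  qed
  \<comment> \<open>Multiplication by \<open>exp (c * F)\<close> lets 1 be written as the
    expectation \<open>one\<close>, so that both terms share the factor \<open>?e\<close> of modulus
    1.\<close>
  have "norm (expectation ?e * complex_of_real (exp (c * F)) - 1)
      = norm (expectation (\<lambda>w. ?e w * complex_of_real (exp (c * F)) - ?e w * complex_of_real (exp (c * ?V w))))"
    by (simp only: Bochner_Integration.integral_diff[OF integrable_mult_left[OF ie] ieV] one Bochner_Integration.integral_mult_left[OF ie])
  also have "\<dots> \<le> expectation (\<lambda>w. norm (?e w * complex_of_real (exp (c * F)) - ?e w * complex_of_real (exp (c * ?V w))))"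
    by (rule integral_norm_bound)
  also have "\<dots> \<le> expectation (\<lambda>w. c * exp (c * D) * (1 + D) * min 1 \<bar>?V w - F\<bar>)"
  proof (intro integral_mono integrable_norm Bochner_Integration.integrable_diff ieV integrable_mult_right ky_fan_integrable integrable_mult_left ie)
    fix w assume w: "w \<in> space M"
    have "?e w * complex_of_real (exp (c * F)) - ?e w * complex_of_real (exp (c * ?V w)) = ?e w * complex_of_real (exp (c * F) - exp (c * ?V w))"
      by (simp only: right_diff_distrib of_real_diff)
    then have "norm (?e w * complex_of_real (exp (c * F)) - ?e w * complex_of_real (exp (c * ?V w))) = \<bar>exp (c * F) - exp (c * ?V w)\<bar>"
      by (simp only: norm_mult norm_of_real norm_exp_i_times mult_1_left)
    then show "norm (?e w * complex_of_real (exp (c * F)) - ?e w * complex_of_real (exp (c * ?V w))) \<le> c * exp (c * D) * (1 + D) * min 1 \<bar>?V w - F\<bar>"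
      using exp_lip[OF V[OF w]] by simp
  qed measurable
  also have "\<dots> = c * exp (c * D) * (1 + D) * ky_fan M (\<lambda>w. ?V w - F)" by (simp add: ky_fan_def)
  finally have *: "norm (expectation ?e * complex_of_real (exp (c * F)) - 1) \<le> c * exp (c * D) * (1 + D) * ky_fan M (\<lambda>w. ?V w - F)" .
  have "expectation ?e - complex_of_real (exp (- c * F)) = complex_of_real (exp (- c * F)) * (expectation ?e * complex_of_real (exp (c * F)) - 1)"
    by (simp add: right_diff_distrib exp_minus flip: of_real_mult)
  then have "norm (expectation ?e - complex_of_real (exp (- c * F))) = exp (- c * F) * norm (expectation ?e * complex_of_real (exp (c * F)) - 1)"
    by (simp only: norm_mult norm_of_real abs_exp_cancel)
  also have "\<dots> \<le> 1 * norm (expectation ?e * complex_of_real (exp (c * F)) - 1)"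
    using c F by (intro mult_right_mono) auto
  finally show ?thesis using * by simp
qed

section \<open>From the Ito integral to the estimator\<close>

definition estimator :: "real \<Rightarrow> 'a \<Rightarrow> real" where "estimator T = lse M \<F> f X L R T"

lemma estimator_measurable:
  assumes T: "0 \<le> T" shows "estimator T \<in> borel_measurable M"
proof -
  have "estimator T w = stochastic_integral M \<F> (\<lambda>t w. f (X t w)) (\<lambda>t w. X t w - L t w + R t w) T w / integral {0..T} (\<lambda>t. (f (X t w))\<^sup>2)"
    if "w \<in> space M" for w
    unfolding estimator_def lse_def
    by (subst LINT_eq_integral) (auto intro!: continuous_intros continuous_on_subset[OF f.H_continuous[OF that]])
  then show ?thesis
    using stochastic_integral_fY(1)[OF T] bounded_integrand.integral_measurable[OF f_square_integrand T]
    by (subst measurable_cong) (assumption, rule borel_measurable_divide)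
qed

text \<open>The condition is genuine: where the denominator vanishes, the estimator is 0 by the
  convention for division and its error is \<open>- \<theta>\<close>. Such paths lie in an event
  whose probability tends to 0.\<close>

lemma AE_estimator:
  assumes T: "0 \<le> T"
  shows "AE w in M. integral {0..T} (\<lambda>t. (f (X t w))\<^sup>2) \<noteq> 0 \<longrightarrow>
    estimator T w - \<theta> = \<sigma> * f.Ito T w / integral {0..T} (\<lambda>t. (f (X t w))\<^sup>2)"
  using stochastic_integral_fY(2)[OF T] AE_space
proof eventually_elim
  case (elim w)
  have "(LINT t:{0..T}|lborel. (f (X t w))\<^sup>2) = integral {0..T} (\<lambda>t. (f (X t w))\<^sup>2)"
    by (intro LINT_eq_integral continuous_intros continuous_on_subset[OF f.H_continuous[OF elim(2)]]) auto
  then show ?case using elim(1) by (simp add: estimator_def lse_def fY_integral_def field_simps)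
qed

text \<open>A quantitative form of Slutsky's lemma: replacing the random denominator by
  \<open>F\<close> costs the probability that it is far from \<open>F\<close>, plus a term linear in
  \<open>\<delta>\<close>.\<close>

lemma estimator_error_bound:
  assumes T: "1 \<le> T" and F: "0 < F" and \<delta>: "0 < \<delta>" "\<delta> \<le> F / 2"
  shows "ky_fan M (\<lambda>w. sqrt T * (estimator T w - \<theta>) - \<sigma> / F * (f.Ito T w / sqrt T))
    \<le> prob {w\<in>space M. \<bar>integral {0..T} (\<lambda>s. (f (X s w))\<^sup>2) / T - F\<bar> > \<delta>} + \<delta> * (1 / 2 + 2 * \<sigma>\<^sup>2 * B\<^sup>2 / F ^ 4)"
proof -
  have T0: "0 < T" "0 \<le> T" using T by auto
  let ?V = "\<lambda>w. integral {0..T} (\<lambda>s. (f (X s w))\<^sup>2) / T"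
  let ?E = "{w\<in>space M. \<bar>?V w - F\<bar> > \<delta>}"
  note [measurable] = bounded_integrand.integral_measurable[OF f_square_integrand T0(2)] f.Ito_spec(1)[OF T0(2)]
    estimator_measurable[OF T0(2)]
  \<comment> \<open>When the denominator \<open>r\<close> is within \<open>\<delta>\<close> of
    \<open>F\<close> and at least \<open>F / 2\<close>, the coefficients \<open>\<sigma> / r\<close>
    and \<open>\<sigma> / F\<close> differ by at most \<open>k\<close>.\<close>
  define k where "k = 2 * \<sigma> * \<delta> / F\<^sup>2"
  let ?N = "\<lambda>w. k * (f.Ito T w / sqrt T)"
  have "ky_fan M (\<lambda>w. sqrt T * (estimator T w - \<theta>) - \<sigma> / F * (f.Ito T w / sqrt T)) \<le> prob ?E + ky_fan M ?N"
  proof (rule ky_fan_off_event)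
    show "AE w in M. w \<notin> ?E \<longrightarrow> \<bar>sqrt T * (estimator T w - \<theta>) - \<sigma> / F * (f.Ito T w / sqrt T)\<bar> \<le> \<bar>?N w\<bar>"
      using AE_estimator[OF T0(2)] AE_space
    proof eventually_elim
      case (elim w)
      show ?case
      proof
        assume "w \<notin> ?E"
        then have d: "\<bar>?V w - F\<bar> \<le> \<delta>" using elim(2) by auto
        then have V: "?V w \<ge> F / 2" using \<delta> by linarith
        then have V0: "?V w > 0" using F by linarith
        define r where "r = ?V w"
        define U where "U = f.Ito T w / sqrt T"
        have r: "r > 0" "r \<ge> F / 2" "\<bar>F - r\<bar> \<le> \<delta>" using V V0 d by (auto simp: r_def abs_minus_commute)
        have IV: "integral {0..T} (\<lambda>s. (f (X s w))\<^sup>2) = r * T" using T0 by (simp add: r_def)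
        have "estimator T w - \<theta> = \<sigma> * f.Ito T w / (r * T)" using elim(1) IV r T0 by simp
        moreover have "sqrt T * (\<sigma> * f.Ito T w / (r * T)) = \<sigma> / r * U"
        proof -
          have "s * (\<sigma> * I / (r * (s * s))) = \<sigma> / r * (I / s)" if "s > 0" for s I :: real
            using that by (simp add: field_simps)
          from this[of "sqrt T" "f.Ito T w"] T0 show ?thesis by (simp add: U_def)
        qed
        ultimately have "sqrt T * (estimator T w - \<theta>) - \<sigma> / F * U = \<sigma> / r * U - \<sigma> / F * U"
          by (simp only:)
        also have "\<dots> = \<sigma> * ((F - r) / (r * F)) * U"
          using r F by (simp add: field_simps)
        also have "\<bar>\<dots>\<bar> = \<sigma> * (\<bar>F - r\<bar> / (r * F)) * \<bar>U\<bar>" using \<sigma> r F by (simp add: abs_mult abs_divide)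
        also have "\<dots> \<le> \<sigma> * (\<delta> / (F / 2 * F)) * \<bar>U\<bar>"
          using \<sigma> r F \<delta> by (intro mult_right_mono mult_left_mono frac_le) auto
        also have "\<dots> = \<bar>k * U\<bar>" using \<sigma> F \<delta> by (simp add: k_def abs_mult power2_eq_square mult_ac)
        finally show "\<bar>sqrt T * (estimator T w - \<theta>) - \<sigma> / F * (f.Ito T w / sqrt T)\<bar> \<le> \<bar>?N w\<bar>" by (simp add: U_def)
      qed
    qed
  qed measurable
  also have "ky_fan M ?N \<le> \<delta> / 2 + expectation (\<lambda>w. (?N w)\<^sup>2) / (2 * \<delta>)"
    using f.Ito_square(1)[OF T0(1)] by (intro ky_fan_le_square \<delta>) (auto simp: power_mult_distrib power_divide)
  also have "expectation (\<lambda>w. (?N w)\<^sup>2) \<le> k\<^sup>2 * B\<^sup>2"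
  proof -
    have "expectation (\<lambda>w. (?N w)\<^sup>2) = k\<^sup>2 * (expectation (\<lambda>w. (f.Ito T w)\<^sup>2) / T)"
      using T0 by (simp add: power_mult_distrib power_divide)
    also have "\<dots> \<le> k\<^sup>2 * B\<^sup>2" using f.Ito_square(2)[OF T0(1)] T0 by (intro mult_left_mono) (auto simp: field_simps)
    finally show ?thesis .
  qed
  also have "\<delta> / 2 + k\<^sup>2 * B\<^sup>2 / (2 * \<delta>) = \<delta> * (1 / 2 + 2 * \<sigma>\<^sup>2 * B\<^sup>2 / F ^ 4)"
    using F \<delta> by (simp add: k_def field_simps) (simp add: power2_eq_square power4_eq_xxxx field_simps)
  finally show ?thesis using \<delta> by (simp add: divide_right_mono)
qed

lemma estimator_char_tendsto:
  assumes F: "0 < F" and LLN: "\<exists>K\<ge>0. \<forall>T\<ge>1. ky_fan M (\<lambda>w. integral {0..T} (\<lambda>t. (f (X t w))\<^sup>2) / T - F) \<le> K / sqrt T"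
    and T: "filterlim T at_top sequentially" "\<And>n::nat. 1 \<le> T n"
  shows "(\<lambda>n. expectation (\<lambda>w. iexp (t * (sqrt (T n) * (estimator (T n) w - \<theta>)))))
           \<longlonglongrightarrow> complex_of_real (exp (- (t * sqrt (\<sigma>\<^sup>2 * inverse F))\<^sup>2 / 2))"
proof -
  have T0: "0 \<le> T n" "0 < T n" for n using T(2)[of n] by auto
  let ?V = "\<lambda>n w. integral {0..T n} (\<lambda>s. (f (X s w))\<^sup>2) / T n"
  let ?A = "\<lambda>n w. sqrt (T n) * (estimator (T n) w - \<theta>)"
  let ?G = "\<lambda>n w. \<sigma> / F * (f.Ito (T n) w / sqrt (T n))"
  have [measurable]: "(\<lambda>w. integral {0..T n} (\<lambda>s. (f (X s w))\<^sup>2)) \<in> borel_measurable M"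
    "f.Ito (T n) \<in> borel_measurable M" "estimator (T n) \<in> borel_measurable M" for n
    using bounded_integrand.integral_measurable[OF f_square_integrand T0(1)] f.Ito_spec(1)[OF T0(1)]
      estimator_measurable[OF T0(1)] by auto
  obtain K where K: "0 \<le> K" "\<And>T. 1 \<le> T \<Longrightarrow> ky_fan M (\<lambda>w. integral {0..T} (\<lambda>t. (f (X t w))\<^sup>2) / T - F) \<le> K / sqrt T"
    using LLN by blast
  have Klim: "(\<lambda>n. K / sqrt (T n)) \<longlonglongrightarrow> 0"
    by (rule real_tendsto_divide_at_top[OF tendsto_const filterlim_compose[OF sqrt_at_top T(1)]])
  have kV: "(\<lambda>n. ky_fan M (\<lambda>w. ?V n w - F)) \<longlonglongrightarrow> 0"
    by (rule tendsto_sandwich[OF _ _ tendsto_const Klim]) (auto simp: ky_fan_nonneg K(2) T(2))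
  have kA: "(\<lambda>n. ky_fan M (\<lambda>w. ?A n w - ?G n w)) \<longlonglongrightarrow> 0"
  proof (rule tendstoI)
    fix e :: real assume e: "e > 0"
    define C where "C = 1 / 2 + 2 * \<sigma>\<^sup>2 * B\<^sup>2 / F ^ 4"
    have C: "C > 0" using F by (auto simp: C_def intro!: add_pos_nonneg)
    define \<delta> where "\<delta> = min (F / 2) (e / (2 * C))"
    have \<delta>: "0 < \<delta>" "\<delta> \<le> F / 2" using F e C by (auto simp: \<delta>_def)
    have "\<delta> \<le> e / (2 * C)" by (simp add: \<delta>_def)
    then have \<delta>C: "\<delta> * C \<le> e / 2" using C by (simp add: field_simps)
    have "(\<lambda>n. prob {w\<in>space M. \<bar>?V n w - F\<bar> > \<delta>}) \<longlonglongrightarrow> 0"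
      using conv_prob_iff_ky_fan[of "\<lambda>n w. ?V n w - F"] kV \<delta>(1) by auto
    then have "\<forall>\<^sub>F n in sequentially. prob {w\<in>space M. \<bar>?V n w - F\<bar> > \<delta>} < e / 2"
      using e by (intro order_tendstoD(2)[where y = 0]) auto
    then show "\<forall>\<^sub>F n in sequentially. dist (ky_fan M (\<lambda>w. ?A n w - ?G n w)) 0 < e"
    proof eventually_elim
      case (elim n)
      show ?case using estimator_error_bound[OF T(2)[of n] F \<delta>] elim \<delta>C
          ky_fan_nonneg[of "\<lambda>w. ?A n w - ?G n w"]
        by (simp add: dist_real_def C_def[symmetric])
    qed
  qed
  \<comment> \<open>The characteristic function of \<open>\<sigma> / F\<close> times the normalised
    integral at \<open>t\<close> is that of the integral at \<open>t'\<close>; then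
    \<open>t'\<^sup>2 * F = t\<^sup>2 * \<sigma>\<^sup>2 / F\<close>, the limiting variance.\<close>
  define t' where "t' = t * \<sigma> / F"
  define c where "c = t'\<^sup>2 / 2"
  define D where "D = max F (B\<^sup>2)"
  have "(\<lambda>n. expectation (\<lambda>w. iexp (t * ?G n w)) - complex_of_real (exp (- c * F))) \<longlonglongrightarrow> 0"
  proof (rule Lim_null_comparison)
    show "(\<lambda>n. c * exp (c * D) * (1 + D) * ky_fan M (\<lambda>w. ?V n w - F)) \<longlonglongrightarrow> 0"
      by (rule tendsto_mult_right_zero[OF kV])
    have "norm (expectation (\<lambda>w. iexp (t * ?G n w)) - complex_of_real (exp (- c * F))) \<le> c * exp (c * D) * (1 + D) * ky_fan M (\<lambda>w. ?V n w - F)" for n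
      using Ito_char_bound[OF T(2)[of n] less_imp_le[OF F], of t'] unfolding c_def D_def t'_def by (simp add: mult_ac)
    then show "\<forall>\<^sub>F n in sequentially. norm (expectation (\<lambda>w. iexp (t * ?G n w)) - complex_of_real (exp (- c * F))) \<le> c * exp (c * D) * (1 + D) * ky_fan M (\<lambda>w. ?V n w - F)"
      by simp
  qed
  moreover have "(\<lambda>n. expectation (\<lambda>w. iexp (t * ?A n w)) - expectation (\<lambda>w. iexp (t * ?G n w))) \<longlonglongrightarrow> 0"
  proof (rule Lim_null_comparison)
    show "(\<lambda>n. 2 * ((1 + \<bar>t\<bar>) * ky_fan M (\<lambda>w. ?A n w - ?G n w))) \<longlonglongrightarrow> 0"
      by (intro tendsto_mult_right_zero kA)
    have "norm (expectation (\<lambda>w. iexp (t * ?A n w)) - expectation (\<lambda>w. iexp (t * ?G n w))) \<le> 2 * ((1 + \<bar>t\<bar>) * ky_fan M (\<lambda>w. ?A n w - ?G n w))" for n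
      by (rule char_diff_le_ky_fan) measurable
    then show "\<forall>\<^sub>F n in sequentially. norm (expectation (\<lambda>w. iexp (t * ?A n w)) - expectation (\<lambda>w. iexp (t * ?G n w))) \<le> 2 * ((1 + \<bar>t\<bar>) * ky_fan M (\<lambda>w. ?A n w - ?G n w))"
      by simp
  qed
  ultimately have "(\<lambda>n. expectation (\<lambda>w. iexp (t * ?A n w)) - complex_of_real (exp (- c * F))) \<longlonglongrightarrow> 0"
    using tendsto_add[of "\<lambda>n. expectation (\<lambda>w. iexp (t * ?A n w)) - expectation (\<lambda>w. iexp (t * ?G n w))" 0 sequentially
        "\<lambda>n. expectation (\<lambda>w. iexp (t * ?G n w)) - complex_of_real (exp (- c * F))" 0] by simp
  then have "(\<lambda>n. expectation (\<lambda>w. iexp (t * ?A n w))) \<longlonglongrightarrow> complex_of_real (exp (- c * F))"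
    by (rule LIM_zero_cancel)
  moreover have "- c * F = - (t * sqrt (\<sigma>\<^sup>2 * inverse F))\<^sup>2 / 2"
    using F by (simp add: c_def t'_def power_mult_distrib power2_eq_square field_simps)
  ultimately show ?thesis by (simp only:)
qed

text \<open>A limit over real times is tested along sequences of times, and Levy's continuity
  theorem applies to each of them.\<close>

lemma estimator_weak_conv:
  assumes F: "0 < F" and LLN: "\<exists>K\<ge>0. \<forall>T\<ge>1. ky_fan M (\<lambda>w. integral {0..T} (\<lambda>t. (f (X t w))\<^sup>2) / T - F) \<le> K / sqrt T"
  shows "weak_conv_m_at_top (\<lambda>T. distr M borel (\<lambda>w. sqrt T * (estimator T w - \<theta>)))
           (density lborel (\<lambda>z. ennreal (normal_density 0 (sqrt (\<sigma>\<^sup>2 * inverse F)) z)))"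
    (is "weak_conv_m_at_top ?\<mu> ?\<nu>")
  unfolding weak_conv_m_at_top_def
proof (intro allI impI tendsto_at_topI_sequentially)
  fix y and T :: "nat \<Rightarrow> real" assume y: "isCont (cdf ?\<nu>) y" and T: "filterlim T at_top sequentially"
  \<comment> \<open>The estimates hold from time 1 on; the modified sequence obeys this for every
    index and eventually coincides with \<open>T\<close>.\<close>
  define T' where "T' = (\<lambda>n. max 1 (T n))"
  have T'1: "1 \<le> T' n" for n by (simp add: T'_def)
  have T': "filterlim T' at_top sequentially"
    by (rule filterlim_at_top_mono[OF T]) (simp add: T'_def)
  have s: "0 < sqrt (\<sigma>\<^sup>2 * inverse F)" using \<sigma> F by simp
  have "weak_conv_m (\<lambda>n. ?\<mu> (T' n)) ?\<nu>"
  proof (rule levy_continuity)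
    have M: "(\<lambda>w. sqrt (T' n) * (estimator (T' n) w - \<theta>)) \<in> borel_measurable M" for n
      using estimator_measurable[of "T' n"] T'1[of n] by simp
    then show "real_distribution (?\<mu> (T' n))" for n by (rule real_distribution_distr)
    show "real_distribution ?\<nu>" by (rule real_distribution_normal_density[OF s])
    show "(\<lambda>n. char (?\<mu> (T' n)) t) \<longlonglongrightarrow> char ?\<nu> t" for t
      using estimator_char_tendsto[OF F LLN T' T'1, of t]
      unfolding char_normal_density[OF s] by (simp add: char_def integral_distr[OF M])
  qed
  then have "(\<lambda>n. cdf (?\<mu> (T' n)) y) \<longlonglongrightarrow> cdf ?\<nu> y"
    using y by (simp add: weak_conv_m_def weak_conv_def)
  moreover have "\<forall>\<^sub>F n in sequentially. cdf (?\<mu> (T' n)) y = cdf (?\<mu> (T n)) y"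
    using filterlim_at_top[THEN iffD1, OF T, rule_format, of 1]
    by eventually_elim (simp add: T'_def max_def)
  ultimately show "(\<lambda>n. cdf (?\<mu> (T n)) y) \<longlonglongrightarrow> cdf ?\<nu> y"
    by (rule Lim_transform_eventually)
qed

end

text \<open>Identifies \<open>F\<close> with the constant \<open>m\<close> forced by the Neumann
  condition at \<open>u\<close>; this is where the positive sign in the exponent of
  \<open>invariant_density\<close> matters. Positivity holds because a continuous nonnegative
  function with integral 0 vanishes on the whole interval.\<close>

lemma invariant_density_mean:
  fixes f :: "real \<Rightarrow> real" and \<theta> \<sigma> :: real
  assumes lu: "l < u" and f: "continuous_on {l..u} f" and nz: "y0 \<in> {l..u}" "f y0 \<noteq> 0"
  defines "F \<equiv> (LINT y:{l..u}|lborel. (f y)\<^sup>2 * invariant_density l u \<theta> \<sigma> f y)"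
  shows "F = integral {l..u} (\<lambda>y. (f y)\<^sup>2 * exp (2 * \<theta> / \<sigma>\<^sup>2 * integral {l..y} f)) /
             integral {l..u} (\<lambda>y. exp (2 * \<theta> / \<sigma>\<^sup>2 * integral {l..y} f))"
    and "0 < F"
proof -
  let ?s = "\<lambda>y. exp (2 * \<theta> / \<sigma>\<^sup>2 * integral {l..y} f)"
  have sc: "continuous_on {l..u} ?s"
    by (intro continuous_intros indefinite_integral_continuous_1 integrable_continuous_interval f)
  have gc: "continuous_on {l..u} (\<lambda>y. (f y)\<^sup>2 * ?s y)" by (intro continuous_intros sc f)
  have Lf: "(LINT r:{l..y}|lborel. f r) = integral {l..y} f" if "y \<in> {l..u}" for y
    by (rule LINT_eq_integral) (rule continuous_on_subset[OF f], use that in auto)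
  define S where "S = integral {l..u} ?s"
  have Z: "(LINT z:{l..u}|lborel. exp (2 * \<theta> / \<sigma>\<^sup>2 * (LINT r:{l..z}|lborel. f r))) = S"
  proof -
    have "(LINT z:{l..u}|lborel. exp (2 * \<theta> / \<sigma>\<^sup>2 * (LINT r:{l..z}|lborel. f r))) = (LINT z:{l..u}|lborel. ?s z)"
      by (rule set_lebesgue_integral_cong) (auto simp: Lf)
    also have "\<dots> = S" unfolding S_def by (rule LINT_eq_integral[OF sc])
    finally show ?thesis .
  qed
  have "F = (LINT y:{l..u}|lborel. (f y)\<^sup>2 * ?s y / S)"
    unfolding F_def invariant_density_def Z
    by (rule set_lebesgue_integral_cong) (auto simp: Lf)
  also have "\<dots> = integral {l..u} (\<lambda>y. (f y)\<^sup>2 * ?s y / S)"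
    using continuous_on_mult_right[OF gc, of "inverse S"]
    by (intro LINT_eq_integral) (simp add: divide_inverse)
  also have "\<dots> = integral {l..u} (\<lambda>y. (f y)\<^sup>2 * ?s y) / S"
    by (simp add: divide_inverse)
  finally show F: "F = integral {l..u} (\<lambda>y. (f y)\<^sup>2 * ?s y) / integral {l..u} ?s" by (simp add: S_def)
  have pos: "0 < integral {l..u} g"
    if g: "continuous_on {l..u} g" "\<And>y. y \<in> {l..u} \<Longrightarrow> 0 \<le> g y" "0 < g y0" for g :: "real \<Rightarrow> real"
  proof -
    have "0 \<le> integral {l..u} g" using g by (intro integral_nonneg integrable_continuous_interval) auto
    moreover have "integral {l..u} g \<noteq> 0"
      using integral_eq_0_iff[OF g(1) lu g(2)] g(3) nz(1) by force
    ultimately show ?thesis by linarith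
  qed
  show "0 < F" unfolding F using nz by (intro divide_pos_pos pos sc gc) auto
qed

theorem theorem6:
  fixes M :: "'a measure" and \<F> :: "real \<Rightarrow> 'a measure"
    and W X L R :: "real \<Rightarrow> 'a \<Rightarrow> real"
    and f :: "real \<Rightarrow> real" and l u \<sigma> x \<theta>\<^sub>0 \<rho> F :: real and \<Theta> :: "real set"
  assumes "0 \<le> l" and "l < u" and "\<sigma> > 0" and "x \<in> {l..u}" and "\<rho> > 0"
    and f_measurable: "f \<in> borel_measurable (restrict_space borel {l..u})"
    and f_lipschitz: "\<exists>K>0. \<forall>x\<^sub>1\<in>{l..u}. \<forall>x\<^sub>2\<in>{l..u}. \<bar>f x\<^sub>1 - f x\<^sub>2\<bar> \<le> K * \<bar>x\<^sub>1 - x\<^sub>2\<bar>"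
    and f_nonzero: "\<exists>y\<in>{l..u}. f y \<noteq> 0"
    and parameter_space: "\<Theta> = {\<theta>. \<bar>\<theta> - \<theta>\<^sub>0\<bar> \<le> \<rho>}"
    and "filtered_prob_space M \<F>"
    and "brownian_motion M \<F> W"
    and "reflected_sde_solution M \<F> W (\<lambda>y. \<theta>\<^sub>0 * f y) \<sigma> l u x X L R"
    and F_def: "F = (LINT y:{l..u}|lborel. (f y)\<^sup>2 * invariant_density l u \<theta>\<^sub>0 \<sigma> f y)"
  shows "weak_conv_m_at_top
           (\<lambda>T. distr M borel (\<lambda>\<omega>. sqrt T * (lse M \<F> f X L R T \<omega> - \<theta>\<^sub>0)))
           (density lborel (\<lambda>z. ennreal (normal_density 0 (sqrt (\<sigma>\<^sup>2 * inverse F)) z)))"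
proof -
  obtain K where K: "K > 0" "\<And>y z. y \<in> {l..u} \<Longrightarrow> z \<in> {l..u} \<Longrightarrow> \<bar>f y - f z\<bar> \<le> K * \<bar>y - z\<bar>"
    using f_lipschitz by blast
  have f_cont: "continuous_on {l..u} f"
    by (rule lipschitz_on_continuous_on[of K], rule lipschitz_onI) (use K in \<open>auto simp: dist_real_def\<close>)
  obtain B where B: "\<And>y. y \<in> {l..u} \<Longrightarrow> \<bar>f y\<bar> \<le> B"
    using continuous_interval_bound[OF f_cont] by blast
  obtain y0 where y0: "y0 \<in> {l..u}" "f y0 \<noteq> 0" using f_nonzero by blast
  interpret prob_space M using \<open>filtered_prob_space M \<F>\<close> by (simp add: filtered_prob_space_def)
  interpret brownian_filtration M \<F> W by unfold_locales fact+
  interpret reflected_diffusion M \<F> W f \<theta>\<^sub>0 \<sigma> l u x B X L R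
    by unfold_locales (fact assms f_cont | rule B; assumption)+
  note F = invariant_density_mean[OF \<open>l < u\<close> f_cont y0, of \<theta>\<^sub>0 \<sigma>, folded F_def]
  \<comment> \<open>The Lipschitz bound for \<open>g = f\<^sup>2\<close> that
    \<open>ergodic_bound\<close> asks for, from the difference of squares.\<close>
  have "\<bar>(f y)\<^sup>2 - (f z)\<^sup>2\<bar> \<le> (K * (2 * B)) * \<bar>y - z\<bar>" if yz: "y \<in> {l..u}" "z \<in> {l..u}" for y z
  proof -
    have "\<bar>(f y)\<^sup>2 - (f z)\<^sup>2\<bar> = \<bar>f y - f z\<bar> * \<bar>f y + f z\<bar>"
      by (simp add: power2_eq_square square_diff_square_factored abs_mult mult.commute)
    also have "\<dots> \<le> (K * \<bar>y - z\<bar>) * (2 * B)"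
      using K yz B[OF yz(1)] B[OF yz(2)] by (intro mult_mono) auto
    finally show ?thesis by (simp add: mult_ac)
  qed
  from ergodic_bound[OF K(2) this F(1)] estimator_weak_conv[OF F(2)]
  show ?thesis unfolding estimator_def by blast
qed

end
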